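(* For all real $\rho$ and $R$ with $0<\rho^2<1$ and $0\le R\le 2$ there is a stationary Markov chain $(X_k)_{k\in\mathbb{Z}}$ of square-integrable real random variables with $E(X_k)=0$, $E(X_k^2)=1$, $\mathrm{corr}(X_0,X_1)=\rho$ and $\mathrm{corr}(X_0,X_2)+1-2|\rho|>0$, for which there are real constants $a,b,A,B,C$ such that for all $k\in\mathbb{Z}$ $$E(X_k\mid \dots,X_{k-2},X_{k-1},X_{k+1},X_{k+2},\dots)=a(X_{k-1}+X_{k+1})+b,$$ $$E(X_k^2\mid \dots,X_{k-2},X_{k-1},X_{k+1},X_{k+2},\dots)=A(X_{k-1}^2+X_{k+1}^2)+BX_{k-1}X_{k+1}+C,$$ with $$A\left(\rho^2+\frac{1}{\rho^2}\right)+B=1\quad\text{and}\quad R=B\left(\rho+\frac1\rho\right)^2 .$$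
   Context: The conditional expectations are given the $\sigma$-field generated by $\{X_j: j\ne k\}$, with equalities almost surely. "Stationary" means strictly stationary. *)

theory Defs
  imports "HOL-Probability.Probability"
begin

definition sigma_field_of ::
    "'a measure \<Rightarrow> (int \<Rightarrow> 'a \<Rightarrow> real) \<Rightarrow> int set \<Rightarrow> 'a measure" where
  "sigma_field_of M X J =
     sigma (space M) {X j -` S \<inter> space M | j S. j \<in> J \<and> S \<in> sets borel}"

text \<open>\<^const>\<open>real_cond_exp\<close> is a junk value unless its second argument is a subalgebra.\<close>

lemma subalgebra_sigma_field_of:
  assumes "\<And>j. j \<in> J \<Longrightarrow> X j \<in> borel_measurable M"
  shows "subalgebra M (sigma_field_of M X J)"
proof -
  let ?G = "{X j -` S \<inter> space M | j S. j \<in> J \<and> S \<in> sets borel}"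
  have "?G \<subseteq> sets M"
    using assms by (auto intro: measurable_sets)
  moreover have "?G \<subseteq> Pow (space M)" by auto
  ultimately show ?thesis
    unfolding subalgebra_def sigma_field_of_def
    by (simp add: space_measure_of_conv sets.sigma_sets_subset)
qed

text \<open>Strict stationarity: the finite-dimensional laws are invariant under time shifts.\<close>

definition stationary :: "'a measure \<Rightarrow> (int \<Rightarrow> 'a \<Rightarrow> real) \<Rightarrow> bool" where
  "stationary M X \<longleftrightarrow>
     (\<forall>J h. finite J \<longrightarrow>
        distr M (PiM J (\<lambda>_. borel)) (\<lambda>\<omega>. \<lambda>j\<in>J. X (j + h) \<omega>) =
        distr M (PiM J (\<lambda>_. borel)) (\<lambda>\<omega>. \<lambda>j\<in>J. X j \<omega>))"

text \<open>The Markov property for a general (real) state space: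
  \<open>P(X\<^bsub>n+1\<^esub> \<in> S | X\<^sub>j, j \<le> n) = P(X\<^bsub>n+1\<^esub> \<in> S | X\<^sub>n)\<close> almost surely.\<close>

definition markov_chain :: "'a measure \<Rightarrow> (int \<Rightarrow> 'a \<Rightarrow> real) \<Rightarrow> bool" where
  "markov_chain M X \<longleftrightarrow>
     (\<forall>n. \<forall>S\<in>sets borel. AE \<omega> in M.
        real_cond_exp M (sigma_field_of M X {..n}) (\<lambda>\<omega>. indicator S (X (n + 1) \<omega>)) \<omega> =
        real_cond_exp M (sigma_field_of M X {n}) (\<lambda>\<omega>. indicator S (X (n + 1) \<omega>)) \<omega>)"

definition covar :: "'a measure \<Rightarrow> ('a \<Rightarrow> real) \<Rightarrow> ('a \<Rightarrow> real) \<Rightarrow> real" where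
  "covar M U V =
     integral\<^sup>L M (\<lambda>\<omega>. (U \<omega> - integral\<^sup>L M U) * (V \<omega> - integral\<^sup>L M V))"

definition corr :: "'a measure \<Rightarrow> ('a \<Rightarrow> real) \<Rightarrow> ('a \<Rightarrow> real) \<Rightarrow> real" where
  "corr M U V = covar M U V / sqrt (covar M U U * covar M V V)"

definition cond_exp_others ::
    "'a measure \<Rightarrow> (int \<Rightarrow> 'a \<Rightarrow> real) \<Rightarrow> int \<Rightarrow> ('a \<Rightarrow> real) \<Rightarrow> 'a \<Rightarrow> real" where
  "cond_exp_others M X k = real_cond_exp M (sigma_field_of M X (- {k}))"

end

theory Submission
  imports Defs
begin

text \<open>
  The chain is reversible: its stationary law \<open>\<pi>\<close> is fixed first, and a transition from \<open>x\<close> has a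
  symmetric density \<open>p x\<close> with respect to \<open>\<pi>\<close>. The joint density of consecutive states is then a
  product of factors \<open>p (x i) (x (i + 1))\<close>, so that given all other coordinates the law of
  \<open>X k\<close> has a density proportional to \<open>p (X (k - 1)) \<cdot> p \<cdot> (X (k + 1))\<close>. Both required regressions
  become statements about the integrals \<open>\<integral>x. p y x * p x z * x ^ i \<partial>\<pi>\<close>: for \<open>i = 1, 2\<close> they
  have to equal a linear, respectively quadratic, function of \<open>y\<close> and \<open>z\<close> times the integral for
  \<open>i = 0\<close> (\<open>quadratic_chain_exists\<close>).

  The pairs \<open>(\<pi>, p)\<close> come from the stationary q-Ornstein-Uhlenbeck family, \<open>-1 \<le> q \<le> 1\<close>: the law
  \<open>\<pi>\<close> orthogonalises the q-Hermite polynomials \<open>H n\<close>, and \<open>p\<close> is the Mehler kernel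
  \<open>\<Sum>n. \<rho> ^ n * H n x * H n y / (q; q)\<^sub>n\<close>. The two conditions on \<open>A\<close> and \<open>B\<close> fix them in terms of
  \<open>\<rho>\<close> and \<open>R\<close>, and they hold for the parameter \<open>q\<close> exactly if
  \<open>R = (1 - \<rho>^4) * (1 + q) / (1 - q * \<rho>^4)\<close>. As \<open>q\<close> runs through \<open>[-1, 1]\<close>, this value runs through
  \<open>[0, 2]\<close>. The end points are classical: \<open>q = 1\<close> is the Gaussian chain and \<open>q = -1\<close> the
  symmetric chain on \<open>{-1, 1}\<close>. For \<open>\<bar>q\<bar> < 1\<close> three things have to be shown.

  The orthogonality (\<open>qherm_orthogonal\<close>). With \<open>E u = \<Prod>k. 1 - q ^ k * u\<close>, the law has the density
  \<open>sin\<^sup>2 \<theta> * \<bar>E (q * exp (2 * \<i> * \<theta>))\<bar>\<^sup>2\<close> in the angle \<open>\<theta>\<close>, up to normalisation. The functional equation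
  \<open>E u = (1 - u) * E (q * u)\<close> gives a first order recursion for its integrals against Chebyshev
  polynomials, and the three-term recurrence carries this over to the \<open>H n\<close>.

  The positivity of the Mehler kernel (\<open>mehler_pos\<close>). As a function of \<open>\<rho>\<close> the kernel satisfies
  a functional equation that writes its value at \<open>\<rho>\<close> as a positive multiple of its value at
  \<open>q * \<rho>\<close>. Iteration moves the argument to \<open>0\<close>, where the kernel is \<open>1\<close>.

  The two integral identities (\<open>mehler_regression\<close>, \<open>mehler_quadratic_regression\<close>). Orthogonality
  turns the integrals into series \<open>\<Sum>n. t ^ n * H (n + i) y * H (n + j) z / (q; q)\<^sub>n\<close> with \<open>t = \<rho>\<^sup>2\<close>, and
  the three-term recurrence supplies enough linear relations between these series.
\<close>

section \<open>Conditional expectations given a family of coordinates\<close>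

lemma measurable_sigma_field_of:
  assumes "j \<in> J" shows "X j \<in> borel_measurable (sigma_field_of M X J)"
proof -
  let ?G = "{X j -` S \<inter> space M | j S. j \<in> J \<and> S \<in> sets borel}"
  have "?G \<subseteq> Pow (space M)" by auto
  then have *: "space (sigma_field_of M X J) = space M" "sets (sigma_field_of M X J) = sigma_sets (space M) ?G"
    by (simp_all add: sigma_field_of_def space_measure_of_conv)
  show ?thesis
    by (rule measurableI) (use assms in \<open>auto simp: * intro!: sigma_sets.Basic\<close>)
qed

text \<open>
  The events that constrain finitely many of the coordinates in \<open>J\<close> generate the sigma-field and are
  stable under intersection, so Dynkin's lemma extends the integral identity from them to all
  events of the sigma-field.
\<close>

lemma real_cond_exp_sigma_field_eqI:
  fixes X :: "int \<Rightarrow> 'a \<Rightarrow> real"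
  assumes "prob_space M" and X: "\<And>j. X j \<in> borel_measurable M"
    and U: "integrable M U" and V: "integrable M V"
    and V': "V \<in> borel_measurable (sigma_field_of M X J)"
    and eq: "\<And>I S. finite I \<Longrightarrow> I \<subseteq> J \<Longrightarrow> (\<And>i. S i \<in> sets borel) \<Longrightarrow>
      (\<integral>\<omega>. (\<Prod>i\<in>I. indicator (S i) (X i \<omega>)) * U \<omega> \<partial>M) =
      (\<integral>\<omega>. (\<Prod>i\<in>I. indicator (S i) (X i \<omega>)) * V \<omega> \<partial>M)"
  shows "AE \<omega> in M. real_cond_exp M (sigma_field_of M X J) U \<omega> = V \<omega>"
proof -
  interpret prob_space M by fact
  note X [measurable]
  let ?F = "sigma_field_of M X J"
  interpret F: finite_measure_subalgebra M ?F
    by unfold_locales (intro subalgebra_sigma_field_of X)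
  interpret F: sigma_finite_subalgebra M ?F
    by (rule finite_measure_subalgebra_is_sigma_finite) unfold_locales
  \<comment> \<open>The single preimages that define the sigma-field are not stable under intersection; their
    finite intersections are.\<close>
  define E where "E = {{\<omega> \<in> space M. \<forall>i\<in>I. X i \<omega> \<in> S i} | I S.
    finite I \<and> I \<subseteq> J \<and> (\<forall>i. S i \<in> sets borel)}"
  have EI: "{\<omega> \<in> space M. \<forall>i\<in>I. X i \<omega> \<in> S i} \<in> E"
    if "finite I" "I \<subseteq> J" "\<And>i. S i \<in> sets borel" for I S
    unfolding E_def using that by blast
  have E_sets: "E \<subseteq> sets M"
  proof
    fix A assume "A \<in> E"
    then obtain I S where A: "A = {\<omega> \<in> space M. \<forall>i\<in>I. X i \<omega> \<in> S i}"
      and [measurable]: "finite I" "\<And>i. S i \<in> sets borel" by (auto simp: E_def)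
    show "A \<in> sets M" unfolding A by measurable
  qed
  then have E_Pow: "E \<subseteq> Pow (space M)" using sets.space_closed by blast
  have "Int_stable E"
  proof (rule Int_stableI)
    fix A B assume "A \<in> E" "B \<in> E"
    then obtain I S I' S' where A: "A = {\<omega> \<in> space M. \<forall>i\<in>I. X i \<omega> \<in> S i}"
      and I: "finite I" "I \<subseteq> J" "\<And>i. S i \<in> sets borel"
      and B: "B = {\<omega> \<in> space M. \<forall>i\<in>I'. X i \<omega> \<in> S' i}"
      and I': "finite I'" "I' \<subseteq> J" "\<And>i. S' i \<in> sets borel" by (auto simp: E_def)
    let ?S = "\<lambda>i. (if i \<in> I then S i else UNIV) \<inter> (if i \<in> I' then S' i else UNIV)"
    have "A \<inter> B = {\<omega> \<in> space M. \<forall>i\<in>I \<union> I'. X i \<omega> \<in> ?S i}" unfolding A B by auto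
    also have "\<dots> \<in> E" using I I' by (intro EI) auto
    finally show "A \<inter> B \<in> E" .
  qed
  have F_sub: "sets ?F \<subseteq> sigma_sets (space M) E"
  proof -
    let ?G = "{X j -` S \<inter> space M | j S. j \<in> J \<and> S \<in> sets borel}"
    have "?G \<subseteq> E"
    proof safe
      fix j and S :: "real set" assume "j \<in> J" "S \<in> sets borel"
      then have "{\<omega> \<in> space M. \<forall>i\<in>{j}. X i \<omega> \<in> S} \<in> E" by (intro EI) auto
      also have "{\<omega> \<in> space M. \<forall>i\<in>{j}. X i \<omega> \<in> S} = X j -` S \<inter> space M" by auto
      finally show "X j -` S \<inter> space M \<in> E" .
    qed
    then have "sigma_sets (space M) ?G \<subseteq> sigma_sets (space M) E" by (rule sigma_sets_mono')
    moreover have "?G \<subseteq> Pow (space M)" by auto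
    ultimately show ?thesis by (simp add: sigma_field_of_def)
  qed
  have sigma_sets_M: "A \<in> sets M" if "A \<in> sigma_sets (space M) E" for A
    using sets.sigma_sets_subset[OF E_sets] that by blast
  have UV: "set_integrable M A U" "set_integrable M A V" if "A \<in> sets M" for A
    using integrable_mult_indicator[OF that U] integrable_mult_indicator[OF that V]
    by (simp_all add: set_integrable_def)
  have "(\<integral>\<omega>\<in>A. U \<omega> \<partial>M) = (\<integral>\<omega>\<in>A. V \<omega> \<partial>M)" if "A \<in> sigma_sets (space M) E" for A
    using \<open>Int_stable E\<close> E_Pow that
  proof (induction rule: sigma_sets_induct_disjoint)
    case (basic A)
    then obtain I S where A: "A = {\<omega> \<in> space M. \<forall>i\<in>I. X i \<omega> \<in> S i}"
      and I: "finite I" "I \<subseteq> J" "\<And>i. S i \<in> sets borel" by (auto simp: E_def)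
    have "indicator A \<omega> = (\<Prod>i\<in>I. indicator (S i) (X i \<omega>) :: real)" if "\<omega> \<in> space M" for \<omega>
      using that I(1) unfolding A by (auto simp: indicator_def)
    then have "(\<integral>\<omega>\<in>A. W \<omega> \<partial>M) = (\<integral>\<omega>. (\<Prod>i\<in>I. indicator (S i) (X i \<omega>)) * W \<omega> \<partial>M)"
      for W :: "'a \<Rightarrow> real"
      unfolding set_lebesgue_integral_def by (intro Bochner_Integration.integral_cong) auto
    then show ?case using eq[OF I] by simp
  next
    case empty
    show ?case by (simp add: set_lebesgue_integral_def)
  next
    case (compl A)
    have A: "A \<in> sets M" using compl by (intro sigma_sets_M)
    have *: "(\<integral>\<omega>\<in>space M - A. W \<omega> \<partial>M) = (\<integral>\<omega>. W \<omega> \<partial>M) - (\<integral>\<omega>\<in>A. W \<omega> \<partial>M)"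
      if "integrable M W" for W :: "'a \<Rightarrow> real"
    proof -
      have "(\<integral>\<omega>\<in>space M - A. W \<omega> \<partial>M) = (\<integral>\<omega>. W \<omega> - indicator A \<omega> * W \<omega> \<partial>M)"
        unfolding set_lebesgue_integral_def
        by (intro Bochner_Integration.integral_cong) (auto simp: indicator_def)
      also have "\<dots> = (\<integral>\<omega>. W \<omega> \<partial>M) - (\<integral>\<omega>\<in>A. W \<omega> \<partial>M)"
        using integrable_mult_indicator[OF A that] that
        by (simp add: set_lebesgue_integral_def)
      finally show ?thesis .
    qed
    show ?case using *[OF U] *[OF V] eq[of "{}" "\<lambda>_. UNIV"] compl by simp
  next
    case (union A)
    then have A: "\<And>i. A i \<in> sets M" by (intro sigma_sets_M) auto
    have disj: "\<And>i j. i \<noteq> j \<Longrightarrow> A i \<inter> A j = {}" using union(1) by (auto simp: disjoint_family_on_def)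
    have "(\<integral>\<omega>\<in>(\<Union>i. A i). W \<omega> \<partial>M) = (\<Sum>i. (\<integral>\<omega>\<in>A i. W \<omega> \<partial>M))"
      if "set_integrable M (\<Union>i. A i) W" for W :: "'a \<Rightarrow> real"
      using A disj that by (intro lebesgue_integral_countable_add)
    then show ?case using UV[of "\<Union>i. A i"] A union(3) by auto
  qed
  then show ?thesis
    using F_sub U V V' by (intro F.real_cond_exp_charact) auto
qed

section \<open>The two-sided chain of a symmetric transition density\<close>

text \<open>
  From the state \<open>x\<close> the chain jumps according to the density \<open>p x\<close> with respect to \<open>\<pi>\<close>. Symmetry of
  \<open>p\<close> makes \<open>\<pi>\<close> stationary and the chain reversible, so that the past can be treated like the future.
\<close>

locale stationary_kernel = prob_space \<pi> for \<pi> :: "real measure" +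
  fixes p :: "real \<Rightarrow> real \<Rightarrow> real"
  assumes sets_pi [measurable_cong]: "sets \<pi> = sets borel"
    and measurable_p: "(\<lambda>(x, y). p x y) \<in> borel_measurable (borel \<Otimes>\<^sub>M borel)"
    and p_nonneg [simp]: "0 \<le> p x y"
    and p_sym: "p x y = p y x"
    and nn_integral_p: "(\<integral>\<^sup>+y. ennreal (p x y) \<partial>\<pi>) = 1"
begin

lemma space_pi [simp]: "space \<pi> = UNIV"
  using sets_eq_imp_space_eq[OF sets_pi] by simp

lemma borel_measurable_p [measurable (raw)]:
  assumes "f \<in> borel_measurable N" "g \<in> borel_measurable N"
  shows "(\<lambda>x. p (f x) (g x)) \<in> borel_measurable N"
  using measurable_compose[OF measurable_Pair[OF assms] measurable_p] by simp

lemma integrable_p: "integrable \<pi> (p x)"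
  by (rule integrableI_nonneg) (auto simp: nn_integral_p)

lemma integral_p: "(\<integral>y. p x y \<partial>\<pi>) = 1"
  by (simp add: integral_eq_nn_integral nn_integral_p)

sublocale P: product_sigma_finite "\<lambda>_::int. \<pi>"
  by standard

lemma sets_PiM_pi [measurable_cong]: "sets (PiM J (\<lambda>_::int. \<pi>)) = sets (PiM J (\<lambda>_. borel))"
  by (rule sets_PiM_cong) (simp_all add: sets_pi)

lemma space_PiM_pi: "space (PiM J (\<lambda>_::int. \<pi>)) = space (PiM J (\<lambda>_. borel :: real measure))"
  by (rule sets_eq_imp_space_eq) (rule sets_PiM_pi)

text \<open>
  The initial state contributes no factor, because its law is the reference measure \<open>\<pi>\<close> itself.
\<close>

definition path_density :: "int \<Rightarrow> int \<Rightarrow> (int \<Rightarrow> real) \<Rightarrow> real" where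
  "path_density m n x = (\<Prod>i\<in>{m..<n}. p (x i) (x (i + 1)))"

definition window_law :: "int \<Rightarrow> int \<Rightarrow> (int \<Rightarrow> real) measure" where
  "window_law m n = density (PiM {m..n} (\<lambda>_. \<pi>)) (\<lambda>x. ennreal (path_density m n x))"

lemma path_density_nonneg [simp]: "0 \<le> path_density m n x"
  unfolding path_density_def by (intro prod_nonneg) simp

lemma measurable_path_density [measurable]:
  "path_density m n \<in> borel_measurable (PiM {m..n} (\<lambda>_. borel))"
  unfolding path_density_def
  by (intro borel_measurable_prod borel_measurable_p measurable_component_singleton) auto

lemma path_density_eq:
  assumes "\<And>i. i \<in> {m..n} \<Longrightarrow> x i = y i"
  shows "path_density m n x = path_density m n y"
  unfolding path_density_def using assms by (intro prod.cong) auto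

lemma path_density_last:
  "m \<le> n \<Longrightarrow> path_density m (n + 1) x = path_density m n x * p (x n) (x (n + 1))"
proof -
  assume "m \<le> n"
  then have "{m..<n + 1} = insert n {m..<n}" by auto
  then show ?thesis by (simp add: path_density_def)
qed

lemma path_density_first:
  "m \<le> n \<Longrightarrow> path_density (m - 1) n x = p (x (m - 1)) (x m) * path_density m n x"
proof -
  assume "m \<le> n"
  then have "{m - 1..<n} = insert (m - 1) {m..<n}" by auto
  then show ?thesis by (simp add: path_density_def)
qed

lemma sets_window_law [measurable_cong, simp]:
  "sets (window_law m n) = sets (PiM {m..n} (\<lambda>_. borel))"
  by (simp add: window_law_def sets_PiM_pi)

lemma space_window_law [simp]:
  "space (window_law m n) = space (PiM {m..n} (\<lambda>_. borel :: real measure))"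
  by (simp add: window_law_def space_PiM_pi)

text \<open>
  A coordinate \<open>k\<close> at either end of the window occurs only in the factor that links it to its
  neighbour \<open>l\<close>, and this factor integrates to \<open>1\<close>. By the symmetry of \<open>p\<close> the factor can be read as a
  transition from \<open>l\<close> to \<open>k\<close> at the left end as well.
\<close>

lemma window_law_drop:
  assumes k: "k \<notin> J" "finite J" and H: "{m'..n'} = insert k {m..n}" "J = {m..n}"
    and split: "\<And>x. path_density m' n' x = path_density m n x * p (x l) (x k)"
    and l: "l \<in> J"
  shows "distr (window_law m' n') (PiM {m..n} (\<lambda>_. borel)) (\<lambda>x. restrict x {m..n}) = window_law m n"
proof (rule measure_eqI)
  fix A assume "A \<in> sets (distr (window_law m' n') (PiM {m..n} (\<lambda>_. borel)) (\<lambda>x. restrict x {m..n}))"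
  then have A [measurable]: "A \<in> sets (PiM J (\<lambda>_. borel))" by (simp add: H)
  have H': "{m'..n'} = insert k J" "{m..n} = J" using H by auto
  have lk: "l \<noteq> k" using l k by auto
  have meas: "path_density m' n' \<in> borel_measurable (PiM (insert k J) (\<lambda>_. borel))"
    "path_density m n \<in> borel_measurable (PiM J (\<lambda>_. borel))"
    using measurable_path_density[of m' n'] measurable_path_density[of m n] by (simp_all add: H')
  note meas [measurable]
  have R [measurable]: "(\<lambda>x. restrict x J) \<in> PiM (insert k J) (\<lambda>_. borel) \<rightarrow>\<^sub>M PiM J (\<lambda>_. borel :: real measure)"
    by (rule measurable_restrict_subset) auto
  have "emeasure (distr (window_law m' n') (PiM J (\<lambda>_. borel)) (\<lambda>x. restrict x J)) A =
      (\<integral>\<^sup>+x. indicator A x \<partial>distr (window_law m' n') (PiM J (\<lambda>_. borel)) (\<lambda>x. restrict x J))"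
    by simp
  also have "\<dots> = (\<integral>\<^sup>+x. indicator A (restrict x J) \<partial>window_law m' n')"
    by (rule nn_integral_distr) (use R in \<open>auto simp: H' cong: measurable_cong_sets\<close>)
  also have "\<dots> = (\<integral>\<^sup>+x. ennreal (path_density m' n' x) * indicator A (restrict x J)
        \<partial>PiM (insert k J) (\<lambda>_. \<pi>))"
    unfolding window_law_def H' by (rule nn_integral_density) measurable
  also have "\<dots> = (\<integral>\<^sup>+x. (\<integral>\<^sup>+y. ennreal (path_density m' n' (x(k := y))) *
        indicator A (restrict (x(k := y)) J) \<partial>\<pi>) \<partial>PiM J (\<lambda>_. \<pi>))"
    by (rule P.product_nn_integral_insert) (use k in auto)
  also have "\<dots> = (\<integral>\<^sup>+x. ennreal (path_density m n x) * indicator A x \<partial>PiM J (\<lambda>_. \<pi>))"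
  proof (rule nn_integral_cong)
    fix x assume x: "x \<in> space (PiM J (\<lambda>_. \<pi>))"
    have 1: "restrict (x(k := y)) J = x" for y
      using x k by (auto simp: space_PiM fun_eq_iff PiE_def extensional_def)
    have 2: "path_density m n (x(k := y)) = path_density m n x" for y
      by (rule path_density_eq) (use H' k in auto)
    have "(\<integral>\<^sup>+y. ennreal (path_density m' n' (x(k := y))) * indicator A (restrict (x(k := y)) J) \<partial>\<pi>)
      = (\<integral>\<^sup>+y. ennreal (path_density m n x) * indicator A x * ennreal (p (x l) y) \<partial>\<pi>)"
      by (intro nn_integral_cong) (simp only: 1 2 split, use lk in \<open>simp add: ennreal_mult mult_ac\<close>)
    also have "\<dots> = ennreal (path_density m n x) * indicator A x"
      by (subst nn_integral_cmult) (simp_all add: nn_integral_p)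
    finally show "(\<integral>\<^sup>+y. ennreal (path_density m' n' (x(k := y))) *
        indicator A (restrict (x(k := y)) J) \<partial>\<pi>) = ennreal (path_density m n x) * indicator A x" .
  qed
  also have "\<dots> = emeasure (window_law m n) A"
    unfolding window_law_def H' by (rule emeasure_density[symmetric]) measurable
  finally show "emeasure (distr (window_law m' n') (PiM {m..n} (\<lambda>_. borel)) (\<lambda>x. restrict x {m..n})) A
     = emeasure (window_law m n) A" by (simp add: H')
qed simp

lemma window_law_drop_last:
  "m \<le> n \<Longrightarrow> distr (window_law m (n + 1)) (PiM {m..n} (\<lambda>_. borel)) (\<lambda>x. restrict x {m..n}) = window_law m n"
  by (rule window_law_drop[where k = "n + 1" and l = n and J = "{m..n}"]) (auto simp: path_density_last)

lemma window_law_drop_first: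
  "m \<le> n \<Longrightarrow> distr (window_law (m - 1) n) (PiM {m..n} (\<lambda>_. borel)) (\<lambda>x. restrict x {m..n}) = window_law m n"
  by (rule window_law_drop[where k = "m - 1" and l = m and J = "{m..n}"])
     (auto simp: path_density_first p_sym mult.commute)

lemma distr_window_restrict:
  assumes "K \<subseteq> {m..n}" "J \<subseteq> K"
  shows "distr (distr (window_law m n) (PiM K (\<lambda>_. borel)) (\<lambda>x. restrict x K)) (PiM J (\<lambda>_. borel)) (\<lambda>x. restrict x J)
    = distr (window_law m n) (PiM J (\<lambda>_. borel)) (\<lambda>x. restrict x J)"
proof (subst distr_distr)
  show "(\<lambda>x. restrict x J) \<in> PiM K (\<lambda>_. borel) \<rightarrow>\<^sub>M PiM J (\<lambda>_. borel :: real measure)"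
    using assms by (intro measurable_restrict_subset)
  show "(\<lambda>x. restrict x K) \<in> window_law m n \<rightarrow>\<^sub>M PiM K (\<lambda>_. borel)"
    unfolding measurable_cong_sets[OF sets_window_law refl]
    using assms by (intro measurable_restrict_subset)
  show "distr (window_law m n) (PiM J (\<lambda>_. borel)) ((\<lambda>x. restrict x J) \<circ> (\<lambda>x. restrict x K))
    = distr (window_law m n) (PiM J (\<lambda>_. borel)) (\<lambda>x. restrict x J)"
    using assms by (intro distr_cong) (auto simp: o_def fun_eq_iff restrict_def)
qed

lemma window_law_self: "distr (window_law m n) (PiM {m..n} (\<lambda>_. borel)) (\<lambda>x. restrict x {m..n}) = window_law m n"
proof -
  have "distr (window_law m n) (PiM {m..n} (\<lambda>_. borel)) (\<lambda>x. restrict x {m..n})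
     = distr (window_law m n) (window_law m n) (\<lambda>x. x)"
    by (rule distr_cong) (auto simp: space_PiM)
  then show ?thesis by simp
qed

lemma window_law_shrink:
  assumes "m' \<le> m" "m \<le> n" "n \<le> n'"
  shows "distr (window_law m' n') (PiM {m..n} (\<lambda>_. borel)) (\<lambda>x. restrict x {m..n}) = window_law m n"
proof -
  have right: "distr (window_law m n') (PiM {m..n} (\<lambda>_. borel)) (\<lambda>x. restrict x {m..n}) = window_law m n"
    using assms(3,2)
  proof (induction n' rule: int_ge_induct)
    case base
    show ?case by (rule window_law_self)
  next
    case (step n')
    have "distr (window_law m (n' + 1)) (PiM {m..n} (\<lambda>_. borel)) (\<lambda>x. restrict x {m..n}) =
      distr (distr (window_law m (n' + 1)) (PiM {m..n'} (\<lambda>_. borel)) (\<lambda>x. restrict x {m..n'}))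
        (PiM {m..n} (\<lambda>_. borel)) (\<lambda>x. restrict x {m..n})"
      using step by (intro distr_window_restrict[symmetric]) auto
    also have "distr (window_law m (n' + 1)) (PiM {m..n'} (\<lambda>_. borel)) (\<lambda>x. restrict x {m..n'}) = window_law m n'"
      using step by (intro window_law_drop_last) auto
    finally show ?case by (rule trans) (rule step.IH[OF step.prems])
  qed
  show ?thesis
    using assms(1)
  proof (induction m' rule: int_le_induct)
    case base
    show ?case by (rule right)
  next
    case (step m')
    have "distr (window_law (m' - 1) n') (PiM {m..n} (\<lambda>_. borel)) (\<lambda>x. restrict x {m..n}) =
      distr (distr (window_law (m' - 1) n') (PiM {m'..n'} (\<lambda>_. borel)) (\<lambda>x. restrict x {m'..n'}))
        (PiM {m..n} (\<lambda>_. borel)) (\<lambda>x. restrict x {m..n})"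
      using step assms by (intro distr_window_restrict[symmetric]) auto
    also have "distr (window_law (m' - 1) n') (PiM {m'..n'} (\<lambda>_. borel)) (\<lambda>x. restrict x {m'..n'}) = window_law m' n'"
      using step assms by (intro window_law_drop_first) auto
    finally show ?case by (rule trans) (rule step.IH)
  qed
qed

lemma prob_space_window_law:
  assumes "m \<le> n" shows "prob_space (window_law m n)"
proof -
  have 0: "prob_space (window_law m m)"
  proof -
    have "path_density m m = (\<lambda>x. 1)" by (simp add: path_density_def fun_eq_iff)
    then have "window_law m m = PiM {m} (\<lambda>_. \<pi>)" by (simp add: window_law_def density_1)
    then show ?thesis by (simp add: prob_space_PiM prob_space_axioms)
  qed
  have "prob_space (distr (window_law m n) (PiM {m..m} (\<lambda>_. borel)) (\<lambda>x. restrict x {m..m}))"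
    using 0 assms by (subst window_law_shrink) auto
  then show ?thesis
    by (rule prob_space_distrD[rotated]) (auto simp: measurable_cong_sets[OF sets_window_law refl] assms intro!: measurable_restrict_subset)
qed

definition radius :: "int set \<Rightarrow> int" where
  "radius J = Max (insert 0 (abs ` J))"

lemma subset_radius: "finite J \<Longrightarrow> J \<subseteq> {- radius J..radius J}"
proof
  fix j assume "finite J" "j \<in> J"
  then have "\<bar>j\<bar> \<le> radius J" unfolding radius_def by (intro Max_ge) auto
  then show "j \<in> {- radius J..radius J}" by auto
qed

lemma radius_nonneg: "finite J \<Longrightarrow> 0 \<le> radius J"
  unfolding radius_def by (intro Max_ge) auto

text \<open>
  Any window that contains \<open>J\<close> would do; the symmetric one is a canonical choice.
\<close>

definition fdd :: "int set \<Rightarrow> (int \<Rightarrow> real) measure" where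
  "fdd J = distr (window_law (- radius J) (radius J)) (PiM J (\<lambda>_. borel)) (\<lambda>x. restrict x J)"

text \<open>
  Both windows are marginals of a common larger one.
\<close>

lemma fdd_eq:
  assumes J: "finite J" "J \<subseteq> {m..n}" "m \<le> n"
  shows "fdd J = distr (window_law m n) (PiM J (\<lambda>_. borel)) (\<lambda>x. restrict x J)"
proof -
  define r where "r = radius J"
  define a b where "a = min m (- r)" and "b = max n r"
  have r: "0 \<le> r" "J \<subseteq> {- r..r}" using radius_nonneg subset_radius J(1) by (auto simp: r_def)
  have "distr (window_law m' n') (PiM J (\<lambda>_. borel)) (\<lambda>x. restrict x J) =
      distr (window_law a b) (PiM J (\<lambda>_. borel)) (\<lambda>x. restrict x J)"
    if "a \<le> m'" "m' \<le> n'" "n' \<le> b" "J \<subseteq> {m'..n'}" for m' n'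
    using distr_window_restrict[of "{m'..n'}" a b J] window_law_shrink[of a m' n' b] that by auto
  from this[of m n] this[of "- r" r] show ?thesis
    using J r by (auto simp: fdd_def r_def[symmetric] a_def b_def)
qed

text \<open>
  The marginals are consistent, so Kolmogorov's extension theorem gives a law on all of
  \<open>int \<Rightarrow> real\<close>.
\<close>

sublocale proj: polish_projective "UNIV :: int set" fdd
proof (intro polish_projective.intro projective_family.intro)
  fix J H :: "int set" assume JH: "J \<subseteq> H" "finite H"
  have r: "- radius H \<le> radius H" using radius_nonneg[OF JH(2)] by simp
  show "fdd J = distr (fdd H) (PiM J (\<lambda>_. borel)) (\<lambda>f. restrict f J)"
    unfolding fdd_def[of H]
    by (subst distr_window_restrict)
       (use JH subset_radius[of H] r finite_subset[OF JH] in \<open>auto intro!: fdd_eq\<close>)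
next
  fix J :: "int set" assume J: "finite J"
  show "prob_space (fdd J)"
    unfolding fdd_def
    by (rule prob_space.prob_space_distr[OF prob_space_window_law])
       (use radius_nonneg[OF J] subset_radius[OF J] in
         \<open>auto simp: measurable_cong_sets[OF sets_window_law refl] intro!: measurable_restrict_subset\<close>)
qed

abbreviation (input) chain :: "(int \<Rightarrow> real) measure" where
  "chain \<equiv> proj.lim"

lemma distr_chain:
  assumes "m \<le> n"
  shows "distr chain (PiM {m..n} (\<lambda>_. borel)) (\<lambda>\<omega>. restrict \<omega> {m..n}) = window_law m n"
proof (rule measure_eqI)
  fix A assume "A \<in> sets (distr chain (PiM {m..n} (\<lambda>_. borel)) (\<lambda>\<omega>. restrict \<omega> {m..n}))"
  then have A: "A \<in> sets (PiM {m..n} (\<lambda>_. borel :: real measure))" by simp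
  have "emeasure (distr chain (PiM {m..n} (\<lambda>_. borel)) (\<lambda>\<omega>. restrict \<omega> {m..n})) A =
    emeasure chain (proj.emb UNIV {m..n} A)"
    using A by (subst emeasure_distr)
      (auto simp: prod_emb_def measurable_cong_sets[OF proj.sets_lim refl] space_PiM intro!: measurable_restrict_subset arg_cong2[where f = emeasure])
  also have "\<dots> = emeasure (fdd {m..n}) A"
    using A by (intro proj.emeasure_lim_emb) auto
  also have "fdd {m..n} = window_law m n"
    using assms fdd_eq[of "{m..n}" m n] by (simp add: window_law_self)
  finally show "emeasure (distr chain (PiM {m..n} (\<lambda>_. borel)) (\<lambda>\<omega>. restrict \<omega> {m..n})) A
     = emeasure (window_law m n) A" .
qed simp

end

section \<open>Integration by resampling one coordinate\<close>

context stationary_kernel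
begin

lemma space_chain [simp]: "space chain = UNIV"
  by (simp add: space_PiM)

lemma measurable_chain_coord: "(\<lambda>\<omega>. \<omega> k) \<in> borel_measurable chain"
  unfolding measurable_cong_sets[OF proj.sets_lim refl] by (rule measurable_component_singleton) simp

lemma measurable_chain_restrict:
  "(\<lambda>\<omega>. restrict \<omega> J) \<in> chain \<rightarrow>\<^sub>M PiM J (\<lambda>_. borel)"
  unfolding measurable_cong_sets[OF proj.sets_lim refl] by (rule measurable_restrict_subset) simp

lemma integrable_chain:
  fixes f :: "(int \<Rightarrow> real) \<Rightarrow> real"
  assumes "m \<le> n" "f \<in> borel_measurable (PiM {m..n} (\<lambda>_. borel))"
    and "\<And>\<omega>. f (restrict \<omega> {m..n}) = f \<omega>"
  shows "integrable chain f \<longleftrightarrow> integrable (PiM {m..n} (\<lambda>_. \<pi>)) (\<lambda>x. path_density m n x * f x)"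
proof -
  have "integrable chain f \<longleftrightarrow> integrable (window_law m n) f"
    using integrable_distr_eq[OF measurable_chain_restrict assms(2)] assms(3)
    by (simp add: distr_chain[OF assms(1)])
  also have "\<dots> \<longleftrightarrow> integrable (PiM {m..n} (\<lambda>_. \<pi>)) (\<lambda>x. path_density m n x * f x)"
    unfolding window_law_def by (rule integrable_real_density)
      (use assms(2) in \<open>simp_all add: measurable_cong_sets[OF sets_PiM_pi refl]\<close>)
  finally show ?thesis .
qed

lemma integral_chain:
  fixes f :: "(int \<Rightarrow> real) \<Rightarrow> real"
  assumes "m \<le> n" "f \<in> borel_measurable (PiM {m..n} (\<lambda>_. borel))"
    and "\<And>\<omega>. f (restrict \<omega> {m..n}) = f \<omega>"
  shows "(\<integral>\<omega>. f \<omega> \<partial>chain) = (\<integral>x. path_density m n x * f x \<partial>PiM {m..n} (\<lambda>_. \<pi>))"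
proof -
  have "(\<integral>\<omega>. f \<omega> \<partial>chain) = (\<integral>\<omega>. f \<omega> \<partial>window_law m n)"
    using integral_distr[OF measurable_chain_restrict assms(2)] assms(3)
    by (simp add: distr_chain[OF assms(1)])
  also have "\<dots> = (\<integral>x. path_density m n x * f x \<partial>PiM {m..n} (\<lambda>_. \<pi>))"
    unfolding window_law_def by (rule integral_real_density)
      (use assms(2) in \<open>simp_all add: measurable_cong_sets[OF sets_PiM_pi refl]\<close>)
  finally show ?thesis .
qed

text \<open>
  The only factor of the joint density that involves the coordinate \<open>k\<close> is \<open>r\<close>. If \<open>k\<close> is integrated
  out first, then \<open>U\<close> may be exchanged for any \<open>V\<close> with the same \<open>r\<close>-weighted integral over that
  coordinate. All conditional expectations of the chain are obtained in this way.
\<close>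

lemma resample:
  fixes f U V w r :: "(int \<Rightarrow> real) \<Rightarrow> real"
  assumes k: "m \<le> k" "k \<le> n"
    and split: "\<And>x. path_density m n x = w x * r x"
    and w: "\<And>x y. w (x(k := y)) = w x" and f: "\<And>x y. f (x(k := y)) = f x"
    and meas: "(\<lambda>x. f x * U x) \<in> borel_measurable (PiM {m..n} (\<lambda>_. borel))"
      "(\<lambda>x. f x * V x) \<in> borel_measurable (PiM {m..n} (\<lambda>_. borel))"
    and restr: "\<And>\<omega>. f (restrict \<omega> {m..n}) = f \<omega>" "\<And>\<omega>. U (restrict \<omega> {m..n}) = U \<omega>"
      "\<And>\<omega>. V (restrict \<omega> {m..n}) = V \<omega>"
    and int: "integrable chain (\<lambda>\<omega>. f \<omega> * U \<omega>)" "integrable chain (\<lambda>\<omega>. f \<omega> * V \<omega>)"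
    and inner: "AE x in PiM ({m..n} - {k}) (\<lambda>_. \<pi>).
      (\<integral>y. r (x(k := y)) * U (x(k := y)) \<partial>\<pi>) = (\<integral>y. r (x(k := y)) * V (x(k := y)) \<partial>\<pi>)"
  shows "(\<integral>\<omega>. f \<omega> * U \<omega> \<partial>chain) = (\<integral>\<omega>. f \<omega> * V \<omega> \<partial>chain)"
proof -
  let ?J = "{m..n} - {k}"
  let ?g = "\<lambda>T x y. path_density m n (x(k := y)) * (f (x(k := y)) * T (x(k := y)))"
  have J: "{m..n} = insert k ?J" using k by auto
  have mn: "m \<le> n" using k by simp
  have *: "(\<integral>\<omega>. f \<omega> * T \<omega> \<partial>chain) = (\<integral>x. (\<integral>y. ?g T x y \<partial>\<pi>) \<partial>PiM ?J (\<lambda>_. \<pi>)) \<and>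
      (\<lambda>x. \<integral>y. ?g T x y \<partial>\<pi>) \<in> borel_measurable (PiM ?J (\<lambda>_. \<pi>))"
    if T: "(\<lambda>x. f x * T x) \<in> borel_measurable (PiM {m..n} (\<lambda>_. borel))"
      "\<And>\<omega>. T (restrict \<omega> {m..n}) = T \<omega>" "integrable chain (\<lambda>\<omega>. f \<omega> * T \<omega>)" for T :: "(int \<Rightarrow> real) \<Rightarrow> real"
  proof
    have "integrable (PiM (insert k ?J) (\<lambda>_. \<pi>)) (\<lambda>x. path_density m n x * (f x * T x))"
      using integrable_chain[OF mn T(1)] T(2,3) restr(1) J by simp
    then have "(\<integral>x. path_density m n x * (f x * T x) \<partial>PiM (insert k ?J) (\<lambda>_. \<pi>)) =
      (\<integral>x. \<integral>y. ?g T x y \<partial>\<pi> \<partial>PiM ?J (\<lambda>_. \<pi>))"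
      by (intro P.product_integral_insert) auto
    then show "(\<integral>\<omega>. f \<omega> * T \<omega> \<partial>chain) = (\<integral>x. (\<integral>y. ?g T x y \<partial>\<pi>) \<partial>PiM ?J (\<lambda>_. \<pi>))"
      using integral_chain[OF mn T(1)] T(2) restr(1) J by simp
    have "(\<lambda>x. path_density m n x * (f x * T x)) \<in> borel_measurable (PiM {m..n} (\<lambda>_. borel))"
      by (rule borel_measurable_times[OF measurable_path_density T(1)])
    then have "(\<lambda>x. path_density m n x * (f x * T x)) \<in> borel_measurable (PiM (insert k ?J) (\<lambda>_. \<pi>))"
      using J by (simp add: measurable_cong_sets[OF sets_PiM_pi refl])
    from measurable_compose[OF measurable_add_dim this]
    have "(\<lambda>(x, y). ?g T x y) \<in> borel_measurable (PiM ?J (\<lambda>_. \<pi>) \<Otimes>\<^sub>M \<pi>)"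
      by (simp add: case_prod_beta')
    then show "(\<lambda>x. \<integral>y. ?g T x y \<partial>\<pi>) \<in> borel_measurable (PiM ?J (\<lambda>_. \<pi>))"
      by (rule borel_measurable_lebesgue_integral)
  qed
  have **: "(\<integral>y. ?g T x y \<partial>\<pi>) = w x * f x * (\<integral>y. r (x(k := y)) * T (x(k := y)) \<partial>\<pi>)"
    for T :: "(int \<Rightarrow> real) \<Rightarrow> real" and x
  proof -
    have "(\<integral>y. ?g T x y \<partial>\<pi>) = (\<integral>y. (w x * f x) * (r (x(k := y)) * T (x(k := y))) \<partial>\<pi>)"
      by (simp add: split w f mult_ac)
    then show ?thesis by simp
  qed
  have "(\<integral>x. (\<integral>y. ?g U x y \<partial>\<pi>) \<partial>PiM ?J (\<lambda>_. \<pi>)) = (\<integral>x. (\<integral>y. ?g V x y \<partial>\<pi>) \<partial>PiM ?J (\<lambda>_. \<pi>))"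
    using inner *[OF meas(1) restr(2) int(1)] *[OF meas(2) restr(3) int(2)]
    by (intro integral_cong_AE) (auto simp: **)
  then show ?thesis
    using *[OF meas(1) restr(2) int(1)] *[OF meas(2) restr(3) int(2)] by simp
qed

lemma distr_chain_coord: "distr chain borel (\<lambda>\<omega>. \<omega> k) = \<pi>"
proof -
  interpret product_prob_space "\<lambda>_. \<pi>" "{k}" by standard
  have "path_density k k = (\<lambda>x. 1)" by (simp add: path_density_def fun_eq_iff)
  then have w: "window_law k k = PiM {k} (\<lambda>_. \<pi>)" by (simp add: window_law_def density_1)
  have "distr chain borel (\<lambda>\<omega>. \<omega> k) =
      distr (distr chain (PiM {k..k} (\<lambda>_. borel)) (\<lambda>\<omega>. restrict \<omega> {k..k})) borel (\<lambda>\<omega>. \<omega> k)"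
    by (subst distr_distr) (auto intro!: measurable_chain_restrict measurable_component_singleton simp: o_def)
  also have "\<dots> = distr (PiM {k} (\<lambda>_. \<pi>)) \<pi> (\<lambda>\<omega>. \<omega> k)"
    unfolding distr_chain[OF order_refl] w by (rule distr_cong) (simp_all add: sets_pi)
  also have "\<dots> = \<pi>" by (rule PiM_component) simp
  finally show ?thesis .
qed

lemma
  fixes f :: "real \<Rightarrow> real"
  assumes f: "f \<in> borel_measurable borel"
  shows integrable_chain_coord: "integrable chain (\<lambda>\<omega>. f (\<omega> k)) \<longleftrightarrow> integrable \<pi> f"
    and integral_chain_coord: "(\<integral>\<omega>. f (\<omega> k) \<partial>chain) = (\<integral>x. f x \<partial>\<pi>)"
  using integrable_distr_eq[OF measurable_chain_coord f] integral_distr[OF measurable_chain_coord f]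
  by (simp_all add: distr_chain_coord)

lemma stationary_chain: "stationary chain (\<lambda>k \<omega>. \<omega> k)"
  unfolding stationary_def
proof (intro allI impI)
  fix J :: "int set" and h :: int assume J: "finite J"
  define m n where "m = - radius J" and "n = radius J"
  have mn: "m \<le> n" "J \<subseteq> {m..n}" using radius_nonneg[OF J] subset_radius[OF J] by (auto simp: m_def n_def)
  have Jmn: "m \<le> j \<and> j \<le> n" if "j \<in> J" for j using mn(2) that by auto
  let ?K = "{m..n}" and ?L = "{m + h..n + h}"
  let ?s = "\<lambda>\<omega>. \<lambda>j\<in>?K. \<omega> (j + h)"
  have s: "?s \<in> PiM ?L (\<lambda>_. borel) \<rightarrow>\<^sub>M PiM ?K (\<lambda>_. borel :: real measure)"
    by (intro measurable_restrict measurable_component_singleton) auto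
  have s': "?s \<in> PiM ?L (\<lambda>_. \<pi>) \<rightarrow>\<^sub>M PiM ?K (\<lambda>_. \<pi>)"
    by (intro measurable_restrict measurable_component_singleton) auto
  have pd: "path_density (m + h) (n + h) x = path_density m n (?s x)" for x
  proof -
    have "path_density (m + h) (n + h) x = (\<Prod>i\<in>{m..<n}. p (x (i + h)) (x (i + h + 1)))"
      unfolding path_density_def
      by (rule prod.reindex_bij_witness[of _ "\<lambda>i. i + h" "\<lambda>i. i - h"]) auto
    also have "\<dots> = path_density m n (?s x)"
      unfolding path_density_def by (intro prod.cong) (auto simp: add_ac)
    finally show ?thesis .
  qed
  have shift: "distr (window_law (m + h) (n + h)) (PiM ?K (\<lambda>_. borel)) ?s = window_law m n"
  proof -
    have "distr (PiM ?L (\<lambda>_. \<pi>)) (PiM ?K (\<lambda>_. \<pi>)) ?s = PiM ?K (\<lambda>_. \<pi>)"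
      using distr_PiM_reindex[of ?L "\<lambda>_. \<pi>" "\<lambda>j. j + h" ?K] prob_space_axioms by (auto simp: inj_on_def)
    moreover have "distr (density (PiM ?L (\<lambda>_. \<pi>)) (\<lambda>x. ennreal (path_density m n (?s x)))) (PiM ?K (\<lambda>_. \<pi>)) ?s =
       density (distr (PiM ?L (\<lambda>_. \<pi>)) (PiM ?K (\<lambda>_. \<pi>)) ?s) (\<lambda>x. ennreal (path_density m n x))"
      by (rule density_distr[symmetric]) (use s' in measurable)
    moreover have "distr (window_law (m + h) (n + h)) (PiM ?K (\<lambda>_. borel)) ?s =
       distr (window_law (m + h) (n + h)) (PiM ?K (\<lambda>_. \<pi>)) ?s"
      by (rule distr_cong) (simp_all add: sets_PiM_pi)
    ultimately show ?thesis by (simp add: window_law_def pd)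
  qed
  have rJ: "(\<lambda>\<omega>. restrict \<omega> J) \<in> PiM ?K (\<lambda>_. borel) \<rightarrow>\<^sub>M PiM J (\<lambda>_. borel :: real measure)"
    using mn by (intro measurable_restrict_subset)
  have "distr chain (PiM J (\<lambda>_. borel)) (\<lambda>\<omega>. \<lambda>j\<in>J. \<omega> (j + h)) =
     distr (distr (distr chain (PiM ?L (\<lambda>_. borel)) (\<lambda>\<omega>. restrict \<omega> ?L)) (PiM ?K (\<lambda>_. borel)) ?s)
       (PiM J (\<lambda>_. borel)) (\<lambda>\<omega>. restrict \<omega> J)"
    using Jmn
    by (subst distr_distr[OF s measurable_chain_restrict], subst distr_distr[OF rJ measurable_comp[OF measurable_chain_restrict s]])
       (auto intro!: distr_cong simp: fun_eq_iff restrict_def)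
  also have "\<dots> = distr (window_law m n) (PiM J (\<lambda>_. borel)) (\<lambda>\<omega>. restrict \<omega> J)"
    using mn by (simp add: distr_chain shift)
  also have "\<dots> = distr (distr chain (PiM ?K (\<lambda>_. borel)) (\<lambda>\<omega>. restrict \<omega> ?K)) (PiM J (\<lambda>_. borel)) (\<lambda>\<omega>. restrict \<omega> J)"
    using mn by (simp add: distr_chain)
  also have "\<dots> = distr chain (PiM J (\<lambda>_. borel)) (\<lambda>\<omega>. \<lambda>j\<in>J. \<omega> j)"
    using Jmn by (subst distr_distr[OF rJ measurable_chain_restrict])
       (auto intro!: distr_cong simp: fun_eq_iff restrict_def)
  finally show "distr chain (PiM J (\<lambda>_. borel)) (\<lambda>\<omega>. \<lambda>j\<in>J. \<omega> (j + h)) =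
     distr chain (PiM J (\<lambda>_. borel)) (\<lambda>\<omega>. \<lambda>j\<in>J. \<omega> j)" .
qed

text \<open>
  Product measures over \<open>I\<close> only see functions on extensional arguments. Invariance under
  restriction lets such a function be evaluated on full trajectories as well.
\<close>

definition depends_on :: "int set \<Rightarrow> ((int \<Rightarrow> real) \<Rightarrow> real) \<Rightarrow> bool" where
  "depends_on I f \<longleftrightarrow> f \<in> borel_measurable (PiM I (\<lambda>_. borel)) \<and> (\<forall>\<omega>. f (restrict \<omega> I) = f \<omega>)"

lemma depends_on_mono: "depends_on I f \<Longrightarrow> I \<subseteq> K \<Longrightarrow> depends_on K f"
proof -
  assume f: "depends_on I f" and K: "I \<subseteq> K"
  have "(\<lambda>\<omega>. f (restrict \<omega> I)) \<in> borel_measurable (PiM K (\<lambda>_. borel))"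
    by (rule measurable_compose[OF measurable_restrict_subset[OF K]]) (use f in \<open>simp add: depends_on_def\<close>)
  moreover have "f (restrict \<omega> K) = f \<omega>" for \<omega>
  proof -
    have "f (restrict \<omega> K) = f (restrict (restrict \<omega> K) I)" using f by (simp only: depends_on_def)
    also have "restrict (restrict \<omega> K) I = restrict \<omega> I" using K by (auto simp: restrict_def fun_eq_iff)
    finally show ?thesis using f by (simp only: depends_on_def)
  qed
  ultimately show ?thesis using f unfolding depends_on_def by simp
qed

lemma depends_on_upd: "depends_on I f \<Longrightarrow> k \<notin> I \<Longrightarrow> f (x(k := y)) = f x"
proof -
  assume f: "depends_on I f" and k: "k \<notin> I"
  have "f (x(k := y)) = f (restrict (x(k := y)) I)" using f by (simp only: depends_on_def)
  also have "restrict (x(k := y)) I = restrict x I" using k by (auto simp: restrict_def fun_eq_iff)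
  finally show ?thesis using f by (simp only: depends_on_def)
qed

lemma depends_on_coord: "i \<in> I \<Longrightarrow> g \<in> borel_measurable borel \<Longrightarrow> depends_on I (\<lambda>\<omega>. g (\<omega> i))"
  unfolding depends_on_def
  by (auto intro!: measurable_compose[OF measurable_component_singleton[of i I "\<lambda>_. borel"]])

lemma depends_on_coord2:
  assumes "i \<in> I" "j \<in> I" "(\<lambda>(x, y). g x y) \<in> borel_measurable (borel \<Otimes>\<^sub>M borel)"
  shows "depends_on I (\<lambda>\<omega>. g (\<omega> i) (\<omega> j))"
proof -
  have "(\<lambda>\<omega>. (\<omega> i, \<omega> j)) \<in> PiM I (\<lambda>_. borel :: real measure) \<rightarrow>\<^sub>M borel \<Otimes>\<^sub>M borel"
    using assms by (intro measurable_Pair measurable_component_singleton)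
  from measurable_compose[OF this assms(3)] show ?thesis
    using assms by (simp add: depends_on_def)
qed

lemma depends_on_mult: "depends_on I f \<Longrightarrow> depends_on I g \<Longrightarrow> depends_on I (\<lambda>\<omega>. f \<omega> * g \<omega>)"
  unfolding depends_on_def by (auto intro: borel_measurable_times)

lemma depends_on_cylinder:
  assumes "I \<subseteq> K" "\<And>i. S i \<in> sets borel"
  shows "depends_on K (\<lambda>\<omega>. \<Prod>i\<in>I. indicator (S i) (\<omega> i))"
proof -
  have "(\<lambda>\<omega>. \<Prod>i\<in>I. indicator (S i) (\<omega> i) :: real) \<in> borel_measurable (PiM K (\<lambda>_. borel))"
    using assms by (intro borel_measurable_prod measurable_compose[OF measurable_component_singleton]
        borel_measurable_indicator) auto
  moreover have "(\<Prod>i\<in>I. indicator (S i) (restrict \<omega> K i)) = (\<Prod>i\<in>I. indicator (S i) (\<omega> i) :: real)" for \<omega>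
    using assms by (intro prod.cong) auto
  ultimately show ?thesis unfolding depends_on_def by blast
qed

text \<open>
  The last coordinate has a single neighbour, so its weighted integral is a transition integral.
\<close>

lemma resample_last:
  assumes f: "depends_on {m..n} f" and mn: "m \<le> n"
    and g: "g \<in> borel_measurable borel" and h: "h \<in> borel_measurable borel"
    and gh: "AE x in \<pi>. (\<integral>y. p x y * g y \<partial>\<pi>) = h x"
    and int: "integrable chain (\<lambda>\<omega>. f \<omega> * g (\<omega> (n + 1)))" "integrable chain (\<lambda>\<omega>. f \<omega> * h (\<omega> n))"
  shows "(\<integral>\<omega>. f \<omega> * g (\<omega> (n + 1)) \<partial>chain) = (\<integral>\<omega>. f \<omega> * h (\<omega> n) \<partial>chain)"
proof -
  have f': "depends_on {m..n + 1} f" using f by (rule depends_on_mono) auto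
  have gd: "depends_on {m..n + 1} (\<lambda>\<omega>. g (\<omega> (n + 1)))" and hd: "depends_on {m..n + 1} (\<lambda>\<omega>. h (\<omega> n))"
    using g h mn by (auto intro!: depends_on_coord)
  show ?thesis
  proof (rule resample[where m = m and n = "n + 1" and k = "n + 1" and w = "path_density m n"
        and r = "\<lambda>x. p (x n) (x (n + 1))"])
    show "path_density m (n + 1) x = path_density m n x * p (x n) (x (n + 1))" for x
      using mn by (rule path_density_last)
    show "path_density m n (x(n + 1 := y)) = path_density m n x" for x y
      by (rule path_density_eq) auto
    show "f (x(n + 1 := y)) = f x" for x y
      using f by (rule depends_on_upd) auto
    have J: "{m..n + 1} - {n + 1} = {m..n}" by auto
    have "AE x in PiM {m..n} (\<lambda>_. \<pi>). (\<integral>y. p (x n) y * g y \<partial>\<pi>) = h (x n)"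
      using mn gh by (intro AE_PiM_component[where P = "\<lambda>x. (\<integral>y. p x y * g y \<partial>\<pi>) = h x"])
         (auto simp: prob_space_axioms)
    then show "AE x in PiM ({m..n + 1} - {n + 1}) (\<lambda>_. \<pi>).
      (\<integral>y. p ((x(n + 1 := y)) n) ((x(n + 1 := y)) (n + 1)) * g ((x(n + 1 := y)) (n + 1)) \<partial>\<pi>) =
      (\<integral>y. p ((x(n + 1 := y)) n) ((x(n + 1 := y)) (n + 1)) * h ((x(n + 1 := y)) n) \<partial>\<pi>)"
      unfolding J by eventually_elim (simp add: integral_p)
    show "(\<lambda>x. f x * g (x (n + 1))) \<in> borel_measurable (PiM {m..n + 1} (\<lambda>_. borel))"
      "(\<lambda>x. f x * h (x n)) \<in> borel_measurable (PiM {m..n + 1} (\<lambda>_. borel))"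
      using depends_on_mult[OF f' gd] depends_on_mult[OF f' hd] by (simp_all add: depends_on_def)
    show "f (restrict \<omega> {m..n + 1}) = f \<omega>" for \<omega> using f' by (simp only: depends_on_def)
  qed (use mn int in auto)
qed

text \<open>
  An inner coordinate is weighted with the product of the two factors that link it to its neighbours.
\<close>

lemma resample_middle:
  assumes f: "depends_on I f" and I: "finite I" "k \<notin> I"
    and g: "g \<in> borel_measurable borel" and h: "(\<lambda>(y, z). h y z) \<in> borel_measurable (borel \<Otimes>\<^sub>M borel)"
    and S: "AE x in \<pi>. x \<in> S"
    and gh: "\<And>y z. y \<in> S \<Longrightarrow> z \<in> S \<Longrightarrow>
      (\<integral>x. p y x * p x z * g x \<partial>\<pi>) = h y z * (\<integral>x. p y x * p x z \<partial>\<pi>)"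
    and int: "integrable chain (\<lambda>\<omega>. f \<omega> * g (\<omega> k))"
      "integrable chain (\<lambda>\<omega>. f \<omega> * h (\<omega> (k - 1)) (\<omega> (k + 1)))"
  shows "(\<integral>\<omega>. f \<omega> * g (\<omega> k) \<partial>chain) = (\<integral>\<omega>. f \<omega> * h (\<omega> (k - 1)) (\<omega> (k + 1)) \<partial>chain)"
proof -
  define n where "n = radius (insert k I) + 1"
  have "insert k I \<subseteq> {- radius (insert k I)..radius (insert k I)}" using I by (intro subset_radius) auto
  then have IK: "I \<subseteq> {- n..n}" and kn: "- n \<le> k - 1" "k + 1 \<le> n" by (auto simp: n_def)
  let ?K = "{- n..n}"
  have f': "depends_on ?K f" using f IK by (rule depends_on_mono)
  have gd: "depends_on ?K (\<lambda>\<omega>. g (\<omega> k))" and hd: "depends_on ?K (\<lambda>\<omega>. h (\<omega> (k - 1)) (\<omega> (k + 1)))"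
    using g h kn by (auto intro!: depends_on_coord depends_on_coord2)
  let ?w = "\<lambda>x. \<Prod>i\<in>{- n..<n} - {k - 1, k}. p (x i) (x (i + 1))"
  let ?r = "\<lambda>x. p (x (k - 1)) (x k) * p (x k) (x (k + 1))"
  show ?thesis
  proof (rule resample[where m = "- n" and n = n and k = k and w = ?w and r = ?r])
    show "path_density (- n) n x = ?w x * ?r x" for x
    proof -
      have 1: "{- n..<n} = insert (k - 1) (insert k ({- n..<n} - {k - 1, k}))" using kn by auto
      show ?thesis unfolding path_density_def by (subst 1) simp
    qed
    show "?w (x(k := y)) = ?w x" for x y by (intro prod.cong) auto
    show "f (x(k := y)) = f x" for x y
      using f I by (intro depends_on_upd)
    have "AE x in PiM (?K - {k}) (\<lambda>_. \<pi>). x (k - 1) \<in> S"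
      using kn S by (intro AE_PiM_component[where P = "\<lambda>x. x \<in> S"]) (auto simp: prob_space_axioms)
    moreover have "AE x in PiM (?K - {k}) (\<lambda>_. \<pi>). x (k + 1) \<in> S"
      using kn S by (intro AE_PiM_component[where P = "\<lambda>x. x \<in> S"]) (auto simp: prob_space_axioms)
    ultimately show "AE x in PiM (?K - {k}) (\<lambda>_. \<pi>).
      (\<integral>y. ?r (x(k := y)) * g ((x(k := y)) k) \<partial>\<pi>) =
      (\<integral>y. ?r (x(k := y)) * h ((x(k := y)) (k - 1)) ((x(k := y)) (k + 1)) \<partial>\<pi>)"
      by eventually_elim (simp add: gh)
    show "(\<lambda>x. f x * g (x k)) \<in> borel_measurable (PiM ?K (\<lambda>_. borel))"
      "(\<lambda>x. f x * h (x (k - 1)) (x (k + 1))) \<in> borel_measurable (PiM ?K (\<lambda>_. borel))"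
      using depends_on_mult[OF f' gd] depends_on_mult[OF f' hd] by (simp_all add: depends_on_def)
    show "f (restrict \<omega> ?K) = f \<omega>" for \<omega> using f' by (simp only: depends_on_def)
  qed (use kn int in auto)
qed

end

section \<open>Markov property, correlations and regressions of the chain\<close>

context stationary_kernel
begin

lemma depends_on_measurable_chain:
  assumes "depends_on I f" shows "f \<in> borel_measurable chain"
proof -
  have "(\<lambda>\<omega>. f (restrict \<omega> I)) \<in> borel_measurable chain"
    by (rule measurable_compose[OF measurable_chain_restrict]) (use assms in \<open>simp add: depends_on_def\<close>)
  moreover have "(\<lambda>\<omega>. f (restrict \<omega> I)) = f" using assms by (simp only: depends_on_def)
  ultimately show ?thesis by simp
qed

lemma integrable_cylinder_mult:
  fixes f :: "(int \<Rightarrow> real) \<Rightarrow> real"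
  assumes "integrable chain f" "\<And>i. S i \<in> sets borel"
  shows "integrable chain (\<lambda>\<omega>. (\<Prod>i\<in>I. indicator (S i) (\<omega> i)) * f \<omega>)"
proof (rule Bochner_Integration.integrable_bound[OF assms(1)])
  have "(\<lambda>\<omega>. \<Prod>i\<in>I. indicator (S i) (\<omega> i) :: real) \<in> borel_measurable chain"
    using assms(2) by (intro depends_on_measurable_chain[OF depends_on_cylinder[of I I]]) auto
  then show "(\<lambda>\<omega>. (\<Prod>i\<in>I. indicator (S i) (\<omega> i)) * f \<omega>) \<in> borel_measurable chain"
    using assms(1) by (intro borel_measurable_times) auto
  have "\<bar>\<Prod>i\<in>I. indicator (S i) (\<omega> i) :: real\<bar> \<le> 1" for \<omega>
    by (auto simp: abs_prod indicator_def intro!: prod_le_1)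
  then show "AE \<omega> in chain. norm ((\<Prod>i\<in>I. indicator (S i) (\<omega> i)) * f \<omega>) \<le> norm (f \<omega>)"
    by (auto simp: abs_mult intro!: AE_I2 mult_left_le_one_le)
qed

text \<open>
  The right-hand side depends on the present state only. With \<open>J = {..n}\<close> and \<open>J = {n}\<close> it is thus a
  common version of both sides of the Markov property.
\<close>

lemma cond_exp_next:
  assumes J: "n \<in> J" "J \<subseteq> {..n}" and S: "S \<in> sets borel"
  shows "AE \<omega> in chain. real_cond_exp chain (sigma_field_of chain (\<lambda>k \<omega>. \<omega> k) J)
    (\<lambda>\<omega>. indicator S (\<omega> (n + 1))) \<omega> = (\<integral>y. p (\<omega> n) y * indicator S y \<partial>\<pi>)"
proof -
  define g where "g x = (\<integral>y. p x y * indicator S y \<partial>\<pi>)" for x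
  note S [measurable]
  have "(\<lambda>(x, y). p x y * indicator S y) \<in> borel_measurable (borel \<Otimes>\<^sub>M \<pi>)" by measurable
  then have g: "g \<in> borel_measurable borel"
    unfolding g_def by (rule borel_measurable_lebesgue_integral)
  have ind: "(\<lambda>x. indicator S x :: real) \<in> borel_measurable borel" by measurable
  have "integrable \<pi> (\<lambda>y. p x y * indicator S y)" for x
    by (rule Bochner_Integration.integrable_bound[OF integrable_p[of x]]) (auto simp: indicator_def)
  then have "0 \<le> g x" "g x \<le> 1" for x
    using integral_mono[of \<pi> "\<lambda>y. p x y * indicator S y" "p x"] integrable_p[of x] integral_p[of x]
    by (auto simp: g_def indicator_def intro!: integral_nonneg_AE)
  then have "integrable \<pi> g"
    using g by (intro integrable_const_bound[where B = 1]) auto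
  then have V: "integrable chain (\<lambda>\<omega>. g (\<omega> n))" using integrable_chain_coord[OF g] by simp
  have "integrable \<pi> (\<lambda>x. indicator S x :: real)"
    using ind by (intro integrable_const_bound[where B = 1]) (auto simp: indicator_def)
  then have U: "integrable chain (\<lambda>\<omega>. indicator S (\<omega> (n + 1)) :: real)"
    using integrable_chain_coord[OF ind] by simp
  have "AE \<omega> in chain. real_cond_exp chain (sigma_field_of chain (\<lambda>k \<omega>. \<omega> k) J)
    (\<lambda>\<omega>. indicator S (\<omega> (n + 1))) \<omega> = g (\<omega> n)"
  proof (rule real_cond_exp_sigma_field_eqI[OF proj.P.prob_space_axioms measurable_chain_coord U V])
    show "(\<lambda>\<omega>. g (\<omega> n)) \<in> borel_measurable (sigma_field_of chain (\<lambda>k \<omega>. \<omega> k) J)"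
      using J by (intro measurable_compose[OF measurable_sigma_field_of g])
    fix I and T :: "int \<Rightarrow> real set" assume I: "finite I" "I \<subseteq> J" and T: "\<And>i. T i \<in> sets borel"
    have sub: "I \<subseteq> {- radius (insert n I)..n}" and n: "- radius (insert n I) \<le> n"
      using subset_radius[of "insert n I"] I subset_trans[OF I(2) J(2)]
      by (fastforce simp: subset_eq)+
    have "depends_on {- radius (insert n I)..n} (\<lambda>\<omega>. \<Prod>i\<in>I. indicator (T i) (\<omega> i))"
      using T by (intro depends_on_cylinder sub)
    then show "(\<integral>\<omega>. (\<Prod>i\<in>I. indicator (T i) (\<omega> i)) * indicator S (\<omega> (n + 1)) \<partial>chain) =
       (\<integral>\<omega>. (\<Prod>i\<in>I. indicator (T i) (\<omega> i)) * g (\<omega> n) \<partial>chain)"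
      using U V T by (intro resample_last[OF _ n ind g] integrable_cylinder_mult) (auto simp: g_def)
  qed
  then show ?thesis by (simp add: g_def)
qed

lemma markov_chain_chain: "markov_chain chain (\<lambda>k \<omega>. \<omega> k)"
  unfolding markov_chain_def
proof (intro allI ballI)
  fix n :: int and S :: "real set" assume S: "S \<in> sets borel"
  show "AE \<omega> in chain.
     real_cond_exp chain (sigma_field_of chain (\<lambda>k \<omega>. \<omega> k) {..n}) (\<lambda>\<omega>. indicator S (\<omega> (n + 1))) \<omega> =
     real_cond_exp chain (sigma_field_of chain (\<lambda>k \<omega>. \<omega> k) {n}) (\<lambda>\<omega>. indicator S (\<omega> (n + 1))) \<omega>"
    using cond_exp_next[of n "{..n}" S] cond_exp_next[of n "{n}" S] S by auto
qed

lemma cond_exp_others_chain: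
  assumes g: "g \<in> borel_measurable borel" and h: "(\<lambda>(y, z). h y z) \<in> borel_measurable (borel \<Otimes>\<^sub>M borel)"
    and S: "AE x in \<pi>. x \<in> S"
    and gh: "\<And>y z. y \<in> S \<Longrightarrow> z \<in> S \<Longrightarrow>
      (\<integral>x. p y x * p x z * g x \<partial>\<pi>) = h y z * (\<integral>x. p y x * p x z \<partial>\<pi>)"
    and U: "integrable \<pi> g" and V: "integrable chain (\<lambda>\<omega>. h (\<omega> (k - 1)) (\<omega> (k + 1)))"
  shows "AE \<omega> in chain. cond_exp_others chain (\<lambda>k \<omega>. \<omega> k) k (\<lambda>\<omega>. g (\<omega> k)) \<omega> =
    h (\<omega> (k - 1)) (\<omega> (k + 1))"
  unfolding cond_exp_others_def
proof (rule real_cond_exp_sigma_field_eqI[OF proj.P.prob_space_axioms measurable_chain_coord _ V])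
  show U': "integrable chain (\<lambda>\<omega>. g (\<omega> k))" using U integrable_chain_coord[OF g] by simp
  have "(\<lambda>\<omega>. (\<omega> (k - 1), \<omega> (k + 1))) \<in>
    sigma_field_of chain (\<lambda>k \<omega>. \<omega> k) (- {k}) \<rightarrow>\<^sub>M borel \<Otimes>\<^sub>M borel"
    using measurable_sigma_field_of[of _ "- {k}" "\<lambda>k \<omega>. \<omega> k" chain] by (intro measurable_Pair) auto
  from measurable_compose[OF this h]
  show "(\<lambda>\<omega>. h (\<omega> (k - 1)) (\<omega> (k + 1))) \<in> borel_measurable (sigma_field_of chain (\<lambda>k \<omega>. \<omega> k) (- {k}))"
    by simp
  fix I and T :: "int \<Rightarrow> real set" assume I: "finite I" "I \<subseteq> - {k}" and T: "\<And>i. T i \<in> sets borel"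
  have "depends_on I (\<lambda>\<omega>. \<Prod>i\<in>I. indicator (T i) (\<omega> i))"
    using T by (intro depends_on_cylinder) auto
  then show "(\<integral>\<omega>. (\<Prod>i\<in>I. indicator (T i) (\<omega> i)) * g (\<omega> k) \<partial>chain) =
     (\<integral>\<omega>. (\<Prod>i\<in>I. indicator (T i) (\<omega> i)) * h (\<omega> (k - 1)) (\<omega> (k + 1)) \<partial>chain)"
    using I T U' V by (intro resample_middle[OF _ _ _ g h S gh] integrable_cylinder_mult) auto
qed

lemma integrable_chain_product:
  assumes "integrable \<pi> (\<lambda>x. x\<^sup>2)"
  shows "integrable chain (\<lambda>\<omega>. \<omega> i * \<omega> j)"
proof -
  have "integrable chain (\<lambda>\<omega>. (\<omega> i)\<^sup>2 + (\<omega> j)\<^sup>2)"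
    using integrable_chain_coord[of "\<lambda>x. x\<^sup>2"] assms by auto
  then show ?thesis
  proof (rule Bochner_Integration.integrable_bound)
    show "(\<lambda>\<omega>. \<omega> i * \<omega> j) \<in> borel_measurable chain"
      by (intro borel_measurable_times measurable_chain_coord)
    have "\<bar>x * y\<bar> \<le> x\<^sup>2 + y\<^sup>2" for x y :: real
    proof -
      have "2 * (\<bar>x\<bar> * \<bar>y\<bar>) \<le> x\<^sup>2 + y\<^sup>2" using sum_squares_bound[of "\<bar>x\<bar>" "\<bar>y\<bar>"] by simp
      moreover have "0 \<le> \<bar>x\<bar> * \<bar>y\<bar>" by simp
      ultimately show ?thesis unfolding abs_mult by linarith
    qed
    then show "AE \<omega> in chain. norm (\<omega> i * \<omega> j) \<le> norm ((\<omega> i)\<^sup>2 + (\<omega> j)\<^sup>2)" by simp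
  qed
qed

end

text \<open>
  This is the list of properties demanded in \<open>proposition8p1\<close>, with the intercept \<open>b = 0\<close>. The
  equations that tie \<open>A\<close> and \<open>B\<close> to \<open>\<rho>\<close> and \<open>R\<close> are kept apart.
\<close>

definition quadratic_regression_chain ::
    "'a measure \<Rightarrow> (int \<Rightarrow> 'a \<Rightarrow> real) \<Rightarrow> real \<Rightarrow> real \<Rightarrow> real \<Rightarrow> real \<Rightarrow> real \<Rightarrow> bool" where
  "quadratic_regression_chain M X \<rho> a A B C \<longleftrightarrow>
    prob_space M \<and>
    (\<forall>k. X k \<in> borel_measurable M \<and> integrable M (\<lambda>\<omega>. (X k \<omega>)\<^sup>2)) \<and>
    stationary M X \<and> markov_chain M X \<and>
    (\<forall>k. integral\<^sup>L M (X k) = 0 \<and> integral\<^sup>L M (\<lambda>\<omega>. (X k \<omega>)\<^sup>2) = 1) \<and>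
    corr M (X 0) (X 1) = \<rho> \<and> corr M (X 0) (X 2) + 1 - 2 * \<bar>\<rho>\<bar> > 0 \<and>
    (\<forall>k. AE \<omega> in M. cond_exp_others M X k (X k) \<omega> = a * (X (k - 1) \<omega> + X (k + 1) \<omega>)) \<and>
    (\<forall>k. AE \<omega> in M. cond_exp_others M X k (\<lambda>\<omega>. (X k \<omega>)\<^sup>2) \<omega> =
      A * ((X (k - 1) \<omega>)\<^sup>2 + (X (k + 1) \<omega>)\<^sup>2) + B * X (k - 1) \<omega> * X (k + 1) \<omega> + C)"

text \<open>
  This reduces the probabilistic problem to integrals over the state space. The hypotheses about \<open>y\<close>
  and \<open>z\<close> are only asked on a set \<open>S\<close> of full measure, since the q-Hermite series are only under
  control on the support of their law.
\<close>

lemma quadratic_chain_exists: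
  fixes \<rho> a A B C :: real
  assumes "stationary_kernel \<pi> p" and rho: "\<rho>\<^sup>2 < 1" and S: "AE x in \<pi>. x \<in> S"
    and sq: "integrable \<pi> (\<lambda>x. x\<^sup>2)" and mean: "(\<integral>x. x \<partial>\<pi>) = 0" and var: "(\<integral>x. x\<^sup>2 \<partial>\<pi>) = 1"
    and lin: "\<And>x. x \<in> S \<Longrightarrow> (\<integral>y. p x y * y \<partial>\<pi>) = \<rho> * x"
    and one: "\<And>y z. y \<in> S \<Longrightarrow> z \<in> S \<Longrightarrow>
      (\<integral>x. p y x * p x z * x \<partial>\<pi>) = a * (y + z) * (\<integral>x. p y x * p x z \<partial>\<pi>)"
    and two: "\<And>y z. y \<in> S \<Longrightarrow> z \<in> S \<Longrightarrow>
      (\<integral>x. p y x * p x z * x\<^sup>2 \<partial>\<pi>) = (A * (y\<^sup>2 + z\<^sup>2) + B * y * z + C) * (\<integral>x. p y x * p x z \<partial>\<pi>)"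
  shows "\<exists>(M :: (int \<Rightarrow> real) measure) X. quadratic_regression_chain M X \<rho> a A B C"
proof -
  interpret stationary_kernel \<pi> p by fact
  let ?M = proj.lim and ?X = "\<lambda>(k :: int) (\<omega> :: int \<Rightarrow> real). \<omega> k"
  have id: "(\<lambda>x :: real. x) \<in> borel_measurable borel" "(\<lambda>x :: real. x\<^sup>2) \<in> borel_measurable borel" by auto
  have int1: "integrable \<pi> (\<lambda>x. x)"
    by (rule square_integrable_imp_integrable)
       (use sq in \<open>simp_all add: measurable_cong_sets[OF sets_pi refl]\<close>)
  have E1: "(\<integral>\<omega>. \<omega> k \<partial>?M) = 0" and E2: "(\<integral>\<omega>. (\<omega> k)\<^sup>2 \<partial>?M) = 1" for k
    using integral_chain_coord[OF id(1)] integral_chain_coord[OF id(2)] mean var by simp_all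
  have I1: "integrable ?M (\<lambda>\<omega>. \<omega> k)" and I2: "integrable ?M (\<lambda>\<omega>. (\<omega> k)\<^sup>2)" for k
    using integrable_chain_coord[OF id(1)] integrable_chain_coord[OF id(2)] int1 sq by simp_all
  have lin': "AE x in \<pi>. (\<integral>y. p x y * y \<partial>\<pi>) = \<rho> * x" using S by eventually_elim (rule lin)
  note prod = integrable_chain_product[OF sq]
  \<comment> \<open>Each step multiplies the covariance by \<open>\<rho>\<close>, so lag two has the correlation \<open>\<rho>\<^sup>2\<close> and the last
    inequality on correlations becomes \<open>(1 - \<bar>\<rho>\<bar>)\<^sup>2 > 0\<close>.\<close>
  have step: "(\<integral>\<omega>. \<omega> m * \<omega> (n + 1) \<partial>?M) = \<rho> * (\<integral>\<omega>. \<omega> m * \<omega> n \<partial>?M)" if mn: "m \<le> n" for m n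
  proof -
    have "depends_on {m..n} (\<lambda>\<omega>. \<omega> m)" using mn by (intro depends_on_coord id) auto
    then have "(\<integral>\<omega>. \<omega> m * \<omega> (n + 1) \<partial>?M) = (\<integral>\<omega>. \<omega> m * (\<rho> * \<omega> n) \<partial>?M)"
      by (rule resample_last[OF _ mn id(1) _ lin']) (use prod in \<open>auto simp: mult.left_commute\<close>)
    then show ?thesis by (simp add: mult.left_commute)
  qed
  have c1: "(\<integral>\<omega>. \<omega> 0 * \<omega> 1 \<partial>?M) = \<rho>"
    using step[of 0 0] E2[of 0] by (simp add: power2_eq_square)
  have c2: "(\<integral>\<omega>. \<omega> 0 * \<omega> 2 \<partial>?M) = \<rho>\<^sup>2"
    using step[of 0 1] c1 by (simp add: power2_eq_square)
  have covar: "covar ?M (?X i) (?X j) = (\<integral>\<omega>. \<omega> i * \<omega> j \<partial>?M)" for i j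
    by (simp add: covar_def E1)
  have v: "covar ?M (?X i) (?X i) = 1" for i using E2[of i] by (simp add: covar power2_eq_square)
  have "corr ?M (?X 0) (?X 1) = \<rho>" and c02: "corr ?M (?X 0) (?X 2) = \<rho>\<^sup>2"
    by (simp_all only: corr_def v) (simp_all add: covar c1 c2)
  moreover have "\<rho>\<^sup>2 + 1 - 2 * \<bar>\<rho>\<bar> > 0"
  proof -
    have "\<bar>\<rho>\<bar> < 1" using rho by (simp add: abs_square_less_1)
    then have "0 < (1 - \<bar>\<rho>\<bar>)\<^sup>2" by simp
    then show ?thesis by (simp add: power2_diff)
  qed
  moreover have "AE \<omega> in ?M. cond_exp_others ?M ?X k (?X k) \<omega> =
     a * (?X (k - 1) \<omega> + ?X (k + 1) \<omega>)" for k
  proof -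
    have "AE \<omega> in ?M. cond_exp_others ?M ?X k (\<lambda>\<omega>. \<omega> k) \<omega> = a * (\<omega> (k - 1) + \<omega> (k + 1))"
    proof (rule cond_exp_others_chain[OF id(1) _ S one int1])
      show "(\<lambda>(y, z). a * (y + z)) \<in> borel_measurable (borel \<Otimes>\<^sub>M borel)" by measurable
      show "integrable ?M (\<lambda>\<omega>. a * (\<omega> (k - 1) + \<omega> (k + 1)))"
        by (intro integrable_mult_right Bochner_Integration.integrable_add I1)
    qed
    then show ?thesis .
  qed
  moreover have "AE \<omega> in ?M. cond_exp_others ?M ?X k (\<lambda>\<omega>. (?X k \<omega>)\<^sup>2) \<omega> =
     A * ((?X (k - 1) \<omega>)\<^sup>2 + (?X (k + 1) \<omega>)\<^sup>2) + B * ?X (k - 1) \<omega> * ?X (k + 1) \<omega> + C" for k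
  proof -
    have "AE \<omega> in ?M. cond_exp_others ?M ?X k (\<lambda>\<omega>. (\<omega> k)\<^sup>2) \<omega> =
      A * ((\<omega> (k - 1))\<^sup>2 + (\<omega> (k + 1))\<^sup>2) + B * \<omega> (k - 1) * \<omega> (k + 1) + C"
    proof (rule cond_exp_others_chain[OF id(2) _ S two sq])
      show "(\<lambda>(y, z). A * (y\<^sup>2 + z\<^sup>2) + B * y * z + C) \<in> borel_measurable (borel \<Otimes>\<^sub>M borel)"
        by measurable
      show "integrable ?M (\<lambda>\<omega>. A * ((\<omega> (k - 1))\<^sup>2 + (\<omega> (k + 1))\<^sup>2) + B * \<omega> (k - 1) * \<omega> (k + 1) + C)"
        unfolding mult.assoc[of B]
        by (intro Bochner_Integration.integrable_add integrable_mult_right I2 prod) simp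
    qed
    then show ?thesis .
  qed
  ultimately show ?thesis
    using proj.P.prob_space_axioms measurable_chain_coord I2 stationary_chain markov_chain_chain E1 E2
    unfolding quadratic_regression_chain_def
    by (intro exI[of _ ?M] exI[of _ ?X] conjI allI) (simp_all only: c02)
qed

section \<open>The q-exponential function\<close>

locale q_parameter =
  fixes q :: real
  assumes abs_q_less_1: "\<bar>q\<bar> < 1"
begin

lemma q_power_less_1: "0 < n \<Longrightarrow> \<bar>q ^ n\<bar> < 1"
  using abs_q_less_1 by (simp add: power_abs power_less_one_iff)

lemma one_minus_q_power_pos: "0 < n \<Longrightarrow> 0 < 1 - q ^ n"
  using q_power_less_1[of n] by linarith

lemma one_minus_q_power_ge: "1 - \<bar>q\<bar> \<le> 1 - q ^ Suc n"
proof -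
  have "\<bar>q\<bar> ^ Suc n \<le> \<bar>q\<bar> ^ 1" using abs_q_less_1 by (intro power_decreasing) auto
  then have "\<bar>q ^ Suc n\<bar> \<le> \<bar>q\<bar>" by (simp only: power_abs power_one_right)
  then show ?thesis using abs_ge_self[of "q ^ Suc n"] by linarith
qed

lemma tendsto_q_power: "(\<lambda>n. q ^ n) \<longlonglongrightarrow> 0"
  using abs_q_less_1 by (intro LIMSEQ_power_zero) simp

text \<open>
  These are the coefficients of Euler's series for the infinite product \<open>\<Prod>k. 1 - q ^ k * u\<close>. The
  series converges everywhere and can be integrated term by term on the unit circle.
\<close>

primrec qexp_coeff :: "nat \<Rightarrow> real" where
  "qexp_coeff 0 = 1"
| "qexp_coeff (Suc j) = - (q ^ j / (1 - q ^ Suc j)) * qexp_coeff j"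

lemma summable_qexp_coeff: "summable (\<lambda>j. \<bar>qexp_coeff j\<bar> * r ^ j)"
proof -
  have "(\<lambda>j. \<bar>q\<bar> ^ j * (\<bar>r\<bar> / (1 - \<bar>q\<bar>))) \<longlonglongrightarrow> 0 * (\<bar>r\<bar> / (1 - \<bar>q\<bar>))"
    using abs_q_less_1 by (intro tendsto_mult LIMSEQ_power_zero tendsto_const) simp
  then have "eventually (\<lambda>j. \<bar>q\<bar> ^ j * (\<bar>r\<bar> / (1 - \<bar>q\<bar>)) < 1 / 2) sequentially"
    by (rule order_tendstoD) simp
  then obtain N where N: "\<And>j. j \<ge> N \<Longrightarrow> \<bar>q\<bar> ^ j * (\<bar>r\<bar> / (1 - \<bar>q\<bar>)) < 1 / 2"
    by (auto simp: eventually_sequentially)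
  show ?thesis
  proof (rule summable_ratio_test[of "1/2" N])
    fix j assume "N \<le> j"
    have pos: "0 < 1 - q ^ Suc j" by (rule one_minus_q_power_pos) simp
    have "\<bar>q\<bar> ^ j * \<bar>r\<bar> / (1 - q ^ Suc j) \<le> \<bar>q\<bar> ^ j * \<bar>r\<bar> / (1 - \<bar>q\<bar>)"
      using one_minus_q_power_ge[of j] abs_q_less_1 by (intro divide_left_mono mult_pos_pos pos) auto
    also have "\<dots> \<le> 1 / 2" using N[OF \<open>N \<le> j\<close>] by simp
    finally have "(\<bar>q\<bar> ^ j * \<bar>r\<bar> / (1 - q ^ Suc j)) * (\<bar>qexp_coeff j\<bar> * \<bar>r\<bar> ^ j)
        \<le> 1 / 2 * (\<bar>qexp_coeff j\<bar> * \<bar>r\<bar> ^ j)" by (intro mult_right_mono) auto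
    then show "norm (\<bar>qexp_coeff (Suc j)\<bar> * r ^ Suc j) \<le> 1 / 2 * norm (\<bar>qexp_coeff j\<bar> * r ^ j)"
      using pos by (simp add: abs_mult power_abs field_simps)
  qed simp
qed

definition qexp :: "complex \<Rightarrow> complex" where
  "qexp u = (\<Sum>j. of_real (qexp_coeff j) * u ^ j)"

lemma summable_qexp: "summable (\<lambda>j. of_real (qexp_coeff j) * (u::complex) ^ j)"
  by (rule summable_norm_cancel) (use summable_qexp_coeff[of "norm u"] in \<open>simp add: norm_mult norm_power\<close>)

lemma isCont_qexp: "isCont qexp u"
  unfolding qexp_def by (rule isCont_powser_converges_everywhere) (rule summable_qexp)

lemma qexp_0 [simp]: "qexp 0 = 1"
  unfolding qexp_def by (subst suminf_finite[of "{0}"]) auto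

text \<open>
  In terms of the infinite product, the first factor is split off. The coefficients are defined so
  that the series satisfies the same equation.
\<close>

lemma qexp_shift: "qexp u = (1 - u) * qexp (of_real q * u)"
proof -
  let ?t = "\<lambda>j. of_real (qexp_coeff j) * (1 - of_real q ^ j) * u ^ j"
  have s: "summable (\<lambda>j. of_real (qexp_coeff j) * (of_real q * u) ^ j)"
    by (rule summable_qexp)
  have shifted: "?t (Suc j) = - u * (of_real (qexp_coeff j) * (of_real q * u) ^ j)" for j
  proof -
    have "qexp_coeff (Suc j) * (1 - q ^ Suc j) = - (q ^ j * qexp_coeff j)"
      using one_minus_q_power_pos[of "Suc j"] by simp
    then have "of_real (qexp_coeff (Suc j) * (1 - q ^ Suc j)) = (of_real (- (q ^ j * qexp_coeff j)) :: complex)"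
      by (rule arg_cong)
    then have "of_real (qexp_coeff (Suc j)) * (1 - of_real q ^ Suc j) = (- (of_real q ^ j * of_real (qexp_coeff j)) :: complex)"
      by (simp only: of_real_mult of_real_diff of_real_minus of_real_power of_real_1)
    then have "?t (Suc j) = (- (of_real q ^ j * of_real (qexp_coeff j))) * u ^ Suc j"
      by (simp only:)
    also have "\<dots> = - u * (of_real (qexp_coeff j) * (of_real q * u) ^ j)"
      by (simp add: power_mult_distrib)
    finally show ?thesis .
  qed
  have "qexp u - qexp (of_real q * u) = (\<Sum>j. ?t j)"
    unfolding qexp_def by (subst suminf_diff[OF summable_qexp s]) (simp add: algebra_simps power_mult_distrib)
  also have "\<dots> = (\<Sum>j. ?t (Suc j)) + ?t 0"
    using suminf_split_head[of ?t] summable_diff[OF summable_qexp[of u] s]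
    by (simp add: algebra_simps power_mult_distrib)
  also have "\<dots> = (\<Sum>j. - u * (of_real (qexp_coeff j) * (of_real q * u) ^ j))"
    unfolding shifted by simp
  also have "\<dots> = - u * qexp (of_real q * u)"
    unfolding qexp_def by (rule suminf_mult[OF s])
  finally show ?thesis by (simp add: algebra_simps)
qed

text \<open>
  By the functional equation a zero at \<open>u\<close> would be passed on to all points \<open>q ^ n * u\<close>, which tend
  to \<open>0\<close>; but the function is continuous there with the value \<open>1\<close>.
\<close>

lemma qexp_nonzero:
  assumes "norm u < 1" shows "qexp u \<noteq> 0"
proof -
  have "(\<lambda>n. of_real (q ^ n) * u) \<longlonglongrightarrow> of_real 0 * u"
    by (intro tendsto_mult tendsto_of_real tendsto_q_power tendsto_const)
  then have "(\<lambda>n. qexp (of_real (q ^ n) * u)) \<longlonglongrightarrow> qexp 0"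
    by (intro isCont_tendsto_compose[OF isCont_qexp]) simp
  then have "eventually (\<lambda>n. qexp (of_real (q ^ n) * u) \<noteq> 0) sequentially"
    by (rule tendsto_imp_eventually_ne) simp
  then obtain N where "qexp (of_real (q ^ N) * u) \<noteq> 0" by (auto simp: eventually_sequentially)
  then show ?thesis
  proof (induction N)
    case (Suc N)
    have "norm (of_real (q ^ N) * u) < 1"
    proof -
      have "\<bar>q ^ N\<bar> \<le> 1" using abs_q_less_1 by (simp add: power_abs power_le_one)
      then have "\<bar>q ^ N\<bar> * norm u \<le> 1 * norm u" by (rule mult_right_mono) simp
      then show ?thesis using assms by (simp add: norm_mult power_abs norm_power)
    qed
    then have "1 - of_real (q ^ N) * u \<noteq> 0" by auto
    then have "qexp (of_real (q ^ N) * u) \<noteq> 0"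
      using Suc.prems qexp_shift[of "of_real (q ^ N) * u"] by (simp add: mult.assoc)
    then show ?case by (rule Suc.IH)
  qed simp
qed

lemma cnj_qexp: "cnj (qexp u) = qexp (cnj u)"
proof -
  have "(\<lambda>j. cnj (of_real (qexp_coeff j) * u ^ j)) sums cnj (qexp u)"
    unfolding sums_cnj qexp_def by (rule summable_sums[OF summable_qexp])
  then show ?thesis unfolding qexp_def by (simp add: sums_iff)
qed

end

section \<open>Fourier integrals of power series on the unit circle\<close>

text \<open>
  The states are parametrised by an angle between \<open>0\<close> and \<open>pi\<close>; the doubled angle then runs through the
  unit circle once.
\<close>

definition angle :: "real measure" where
  "angle = restrict_space lborel {0..pi}"

lemma sets_angle: "sets angle = sets (restrict_space borel {0..pi})"
  unfolding angle_def by (rule sets_restrict_space_cong) simp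

lemma space_angle [simp]: "space angle = {0..pi}"
  by (simp add: angle_def space_restrict_space)

lemma measurable_angle: "f \<in> borel_measurable borel \<Longrightarrow> f \<in> borel_measurable angle"
  unfolding angle_def by (intro measurable_restrict_space1) simp

lemma finite_measure_angle: "finite_measure angle"
  by (rule finite_measureI) (simp add: angle_def emeasure_restrict_space space_restrict_space)

lemma integral_angle:
  fixes f :: "real \<Rightarrow> 'b::{banach, second_countable_topology}"
  shows "(\<integral>x. f x \<partial>angle) = (\<integral>x. indicator {0..pi} x *\<^sub>R f x \<partial>lborel)"
  unfolding angle_def by (rule integral_restrict_space) simp

lemma integrable_angle:
  fixes f :: "real \<Rightarrow> 'b::{banach, second_countable_topology}"
  assumes "continuous_on UNIV f"
  shows "integrable angle f"
proof -
  have c: "continuous_on {0..pi} f" using assms by (rule continuous_on_subset) simp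
  have "integrable lborel (\<lambda>x. indicator {0..pi} x *\<^sub>R f x)"
    using borel_integrable_compact[OF _ c] by (simp add: set_integrable_def)
  then show ?thesis unfolding angle_def by (subst integrable_restrict_space) (auto simp: set_integrable_def)
qed

definition circle :: "real \<Rightarrow> complex" where
  "circle \<theta> = cis (2 * \<theta>)"

lemma norm_circle [simp]: "norm (circle \<theta>) = 1"
  by (simp add: circle_def)

lemma continuous_circle [continuous_intros]: "continuous_on A circle"
  unfolding circle_def by (intro continuous_intros)

lemma integral_circle_power:
  "(\<integral>\<theta>. circle \<theta> ^ m * cnj (circle \<theta>) ^ n \<partial>angle) = (if m = n then of_real pi else 0)"
proof (cases "m = n")
  case True
  have "circle \<theta> ^ m * cnj (circle \<theta>) ^ n = (circle \<theta> * cnj (circle \<theta>)) ^ n" for \<theta>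
    by (simp only: True power_mult_distrib)
  then have "circle \<theta> ^ m * cnj (circle \<theta>) ^ n = 1" for \<theta>
    by (simp add: circle_def cis_cnj cis_mult)
  then have "(\<integral>\<theta>. circle \<theta> ^ m * cnj (circle \<theta>) ^ n \<partial>angle) = of_real (measure angle (space angle))"
    by (simp add: of_real_def)
  also have "measure angle (space angle) = pi"
    by (simp add: angle_def measure_restrict_space)
  finally show ?thesis using True by simp
next
  case False
  define c where "c = 2 * \<i> * (of_nat m - of_nat n :: complex)"
  have c: "c \<noteq> 0" using False by (simp add: c_def)
  have eq: "circle \<theta> ^ m * cnj (circle \<theta>) ^ n = exp (c * of_real \<theta>)" for \<theta>
  proof -
    have "circle \<theta> ^ m * cnj (circle \<theta>) ^ n = exp (of_nat m * (\<i> * of_real (2 * \<theta>))) * exp (of_nat n * (\<i> * of_real (- (2 * \<theta>))))"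
      unfolding circle_def cis_cnj unfolding cis_conv_exp exp_of_nat_mult ..
    also have "\<dots> = exp (of_nat m * (\<i> * of_real (2 * \<theta>)) + of_nat n * (\<i> * of_real (- (2 * \<theta>))))"
      by (rule exp_add[symmetric])
    also have "of_nat m * (\<i> * of_real (2 * \<theta>)) + of_nat n * (\<i> * of_real (- (2 * \<theta>))) = c * of_real \<theta>"
      by (simp add: c_def algebra_simps)
    finally show ?thesis .
  qed
  have "(\<integral>\<theta>. indicator {0..pi} \<theta> *\<^sub>R exp (c * of_real \<theta>) \<partial>lborel) = exp (c * of_real pi) / c - exp (c * of_real 0) / c"
  proof (rule integral_FTC_Icc)
    fix x :: real
    have "((\<lambda>z. exp (c * z) / c) has_field_derivative exp (c * of_real x)) (at (of_real x))"
      using c by (auto intro!: derivative_eq_intros)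
    then show "((\<lambda>\<theta>. exp (c * of_real \<theta>) / c) has_vector_derivative exp (c * of_real x)) (at x within {0..pi})"
      by (rule has_vector_derivative_real_field)
  qed (auto intro!: continuous_intros)
  also have "exp (c * of_real pi) = 1"
    by (auto simp: exp_eq_1 c_def intro!: exI[of _ "int m - int n"])
  finally show ?thesis using False by (simp add: integral_angle eq)
qed


lemma integral_power_series:
  fixes f :: "nat \<Rightarrow> real" and h :: "real \<Rightarrow> complex"
  assumes f: "summable (\<lambda>j. \<bar>f j\<bar>)" and h: "continuous_on UNIV h"
  shows "(\<integral>\<theta>. h \<theta> * (\<Sum>j. of_real (f j) * circle \<theta> ^ j) \<partial>angle) =
    (\<Sum>j. of_real (f j) * (\<integral>\<theta>. h \<theta> * circle \<theta> ^ j \<partial>angle))"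
proof -
  let ?g = "\<lambda>j \<theta>. of_real (f j) * (h \<theta> * circle \<theta> ^ j)"
  have int: "integrable angle (\<lambda>\<theta>. h \<theta> * circle \<theta> ^ j)" for j
    by (intro integrable_angle continuous_intros h)
  have norm: "norm (?g j \<theta>) = \<bar>f j\<bar> * norm (h \<theta>)" for j \<theta>
    by (simp add: norm_mult norm_power)
  have sum1: "summable (\<lambda>j. of_real (f j) * circle \<theta> ^ j)" for \<theta>
    by (rule summable_norm_cancel) (simp add: norm_mult norm_power f)
  have "(\<integral>\<theta>. h \<theta> * (\<Sum>j. of_real (f j) * circle \<theta> ^ j) \<partial>angle) = (\<integral>\<theta>. (\<Sum>j. ?g j \<theta>) \<partial>angle)"
    by (simp add: suminf_mult[OF sum1, symmetric] mult.left_commute)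
  also have "\<dots> = (\<Sum>j. \<integral>\<theta>. ?g j \<theta> \<partial>angle)"
  proof (rule integral_suminf)
    show "integrable angle (?g j)" for j by (rule integrable_mult_right) (use int in simp)
    show "AE \<theta> in angle. summable (\<lambda>j. norm (?g j \<theta>))"
      unfolding norm by (intro AE_I2 summable_mult2 f)
    show "summable (\<lambda>j. \<integral>\<theta>. norm (?g j \<theta>) \<partial>angle)"
      unfolding norm by (simp add: summable_mult2 f)
  qed
  finally show ?thesis by simp
qed

lemma summable_mult_shift:
  fixes f g :: "nat \<Rightarrow> real"
  assumes f: "summable (\<lambda>j. \<bar>f j\<bar>)" and g: "summable (\<lambda>j. \<bar>g j\<bar>)"
  shows "summable (\<lambda>j. f j * g (j + k))"
proof -
  have "(\<lambda>j. \<bar>g (j + k)\<bar>) \<longlonglongrightarrow> 0"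
    using summable_ignore_initial_segment[OF g] by (rule summable_LIMSEQ_zero)
  then have "Bseq (\<lambda>j. \<bar>g (j + k)\<bar>)" by (intro convergent_imp_Bseq convergentI)
  then obtain K where K: "\<And>j. \<bar>g (j + k)\<bar> \<le> K" by (auto simp: Bseq_def)
  show ?thesis
    by (rule summable_comparison_test'[OF summable_mult[OF f, of K], of 0])
       (use K in \<open>auto simp: abs_mult mult.commute[of "\<bar>f _\<bar>"] intro!: mult_right_mono\<close>)
qed

text \<open>
  Both series are integrated term by term, and only equal powers of the circle variable survive.
\<close>

lemma integral_circle_parseval:
  fixes f g :: "nat \<Rightarrow> real"
  assumes f: "summable (\<lambda>j. \<bar>f j\<bar>)" and g: "summable (\<lambda>j. \<bar>g j\<bar>)"
    and G: "continuous_on UNIV (\<lambda>\<theta>. \<Sum>j. of_real (g j) * circle \<theta> ^ j)"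
  shows "(\<integral>\<theta>. circle \<theta> ^ k * (\<Sum>j. of_real (f j) * circle \<theta> ^ j) *
      cnj (\<Sum>j. of_real (g j) * circle \<theta> ^ j) \<partial>angle) =
    of_real (pi * (\<Sum>j. f j * g (j + k)))"
proof -
  let ?G = "\<lambda>\<theta>. \<Sum>j. of_real (g j) * circle \<theta> ^ j"
  have 1: "(\<integral>\<theta>. circle \<theta> ^ k * cnj (?G \<theta>) * circle \<theta> ^ j \<partial>angle) = of_real (pi * g (j + k))" for j
  proof -
    have "(\<integral>\<theta>. cnj (circle \<theta>) ^ (j + k) * ?G \<theta> \<partial>angle) =
       (\<Sum>i. of_real (g i) * (\<integral>\<theta>. cnj (circle \<theta>) ^ (j + k) * circle \<theta> ^ i \<partial>angle))"
      by (rule integral_power_series[OF g]) (intro continuous_intros)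
    also have "\<dots> = (\<Sum>i. if i = j + k then of_real (pi * g (j + k)) else 0)"
      by (intro suminf_cong) (simp add: mult.commute[of "cnj _ ^ _"] integral_circle_power)
    also have "\<dots> = of_real (pi * g (j + k))" by (rule sums_unique[OF sums_single, symmetric])
    finally have 2: "(\<integral>\<theta>. cnj (circle \<theta>) ^ (j + k) * ?G \<theta> \<partial>angle) = of_real (pi * g (j + k))" .
    have "(\<integral>\<theta>. circle \<theta> ^ k * cnj (?G \<theta>) * circle \<theta> ^ j \<partial>angle) =
        (\<integral>\<theta>. cnj (cnj (circle \<theta>) ^ (j + k) * ?G \<theta>) \<partial>angle)"
      by (simp add: power_add mult_ac del: Bochner_Integration.integral_cnj)
    also have "\<dots> = cnj (of_real (pi * g (j + k)))"
      unfolding Bochner_Integration.integral_cnj 2 ..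
    finally show ?thesis by simp
  qed
  note prod = summable_mult_shift[OF f g]
  have "(\<integral>\<theta>. circle \<theta> ^ k * (\<Sum>j. of_real (f j) * circle \<theta> ^ j) * cnj (?G \<theta>) \<partial>angle) =
     (\<integral>\<theta>. (circle \<theta> ^ k * cnj (?G \<theta>)) * (\<Sum>j. of_real (f j) * circle \<theta> ^ j) \<partial>angle)"
    by (simp add: mult_ac)
  also have "\<dots> = (\<Sum>j. of_real (f j) * of_real (pi * g (j + k)))"
    unfolding 1[symmetric] by (rule integral_power_series[OF f]) (intro continuous_intros G)
  also have "\<dots> = (\<Sum>j. of_real (pi * (f j * g (j + k))))" by (simp add: mult_ac)
  also have "\<dots> = of_real (\<Sum>j. pi * (f j * g (j + k)))"
    by (rule bounded_linear.suminf[OF bounded_linear_of_real, symmetric]) (intro summable_mult prod)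
  also have "(\<Sum>j. pi * (f j * g (j + k))) = pi * (\<Sum>j. f j * g (j + k))"
    by (rule suminf_mult[OF prod])
  finally show ?thesis .
qed


section \<open>The weight of the continuous q-Hermite polynomials\<close>

context q_parameter
begin

lemma qexp_circle_series:
  "qexp (of_real q * circle \<theta>) = (\<Sum>j. of_real (q ^ j * qexp_coeff j) * circle \<theta> ^ j)"
  by (simp add: qexp_def power_mult_distrib mult_ac)

lemma summable_abs_qexp_coeff: "summable (\<lambda>j. \<bar>qexp_coeff j\<bar>)"
  using summable_qexp_coeff[of 1] by simp

lemma summable_abs_qexp_coeff': "summable (\<lambda>j. \<bar>q ^ j * qexp_coeff j\<bar>)"
  using summable_qexp_coeff[of "\<bar>q\<bar>"] by (simp add: abs_mult power_abs mult.commute)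

lemma continuous_qexp [continuous_intros]:
  "continuous_on A f \<Longrightarrow> continuous_on A (\<lambda>x. qexp (f x))"
  by (rule continuous_on_compose2[OF continuous_at_imp_continuous_on[where s = UNIV]])
     (auto simp: isCont_qexp)

text \<open>
  On the circle, \<open>qexp (q * z)\<close> times its conjugate is the product of the factors
  \<open>(1 - q ^ k * z) * (1 - q ^ k / z)\<close>, \<open>k \<ge> 1\<close>: the quotient of the q-Hermite weight by the weight of the
  Chebyshev polynomials of the second kind.
\<close>

definition theta_factor :: "real \<Rightarrow> real" where
  "theta_factor \<theta> = (norm (qexp (of_real q * circle \<theta>)))\<^sup>2"

lemma continuous_theta_factor [continuous_intros]: "continuous_on A theta_factor"
  unfolding theta_factor_def by (intro continuous_intros)

lemma theta_factor_pos: "0 < theta_factor \<theta>"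
  using qexp_nonzero[of "of_real q * circle \<theta>"] abs_q_less_1
  by (simp add: theta_factor_def norm_mult)

lemma theta_factor_reflect: "theta_factor (pi - \<theta>) = theta_factor \<theta>"
proof -
  have "circle (pi - \<theta>) = cnj (circle \<theta>)"
    by (simp add: circle_def cis_cnj right_diff_distrib complex_eq_iff cos_diff sin_diff)
  then have "qexp (of_real q * circle (pi - \<theta>)) = cnj (qexp (of_real q * circle \<theta>))"
    by (simp add: cnj_qexp)
  then show ?thesis by (simp add: theta_factor_def)
qed

text \<open>
  The factor \<open>1 - circle \<theta>\<close> can be absorbed into \<open>qexp\<close> by its functional equation, on the
  unconjugated side or, since \<open>circle \<theta> * cnj (circle \<theta>) = 1\<close>, on the conjugated side. The two
  resulting coefficient sums differ only by a power of \<open>q\<close>. This replaces the usual shift of the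
  contour from \<open>z\<close> to \<open>q * z\<close>.
\<close>

lemma theta_moment_Suc:
  "(\<integral>\<theta>. circle \<theta> ^ Suc k * (1 - circle \<theta>) * of_real (theta_factor \<theta>) \<partial>angle) =
    - of_real (q ^ Suc k) * (\<integral>\<theta>. circle \<theta> ^ k * (1 - circle \<theta>) * of_real (theta_factor \<theta>) \<partial>angle)"
proof -
  have sq: "of_real (theta_factor \<theta>) = qexp (of_real q * circle \<theta>) * cnj (qexp (of_real q * circle \<theta>))" for \<theta>
    unfolding theta_factor_def by (rule complex_norm_square)
  have c1: "circle \<theta> * cnj (circle \<theta>) = 1" for \<theta> by (simp add: circle_def cis_cnj cis_mult)
  have "circle \<theta> ^ Suc k * (1 - circle \<theta>) * of_real (theta_factor \<theta>) =
      circle \<theta> ^ Suc k * qexp (circle \<theta>) * cnj (qexp (of_real q * circle \<theta>))" for \<theta>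
    unfolding sq by (subst (3) qexp_shift) (simp add: mult_ac)
  then have "(\<integral>\<theta>. circle \<theta> ^ Suc k * (1 - circle \<theta>) * of_real (theta_factor \<theta>) \<partial>angle) =
      (\<integral>\<theta>. circle \<theta> ^ Suc k * qexp (circle \<theta>) * cnj (qexp (of_real q * circle \<theta>)) \<partial>angle)"
    by (simp only:)
  also have "\<dots> = of_real (pi * (\<Sum>j. qexp_coeff j * (q ^ (j + Suc k) * qexp_coeff (j + Suc k))))"
    unfolding qexp_circle_series unfolding qexp_def
    by (rule integral_circle_parseval[OF summable_abs_qexp_coeff summable_abs_qexp_coeff'])
       (unfold qexp_circle_series[symmetric], intro continuous_intros continuous_circle)
  also have "(\<Sum>j. qexp_coeff j * (q ^ (j + Suc k) * qexp_coeff (j + Suc k))) =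
     (\<Sum>j. q ^ Suc k * (q ^ j * qexp_coeff j * qexp_coeff (j + Suc k)))"
    by (intro suminf_cong) (simp add: power_add mult_ac del: qexp_coeff.simps)
  also have "\<dots> = q ^ Suc k * (\<Sum>j. q ^ j * qexp_coeff j * qexp_coeff (j + Suc k))"
    by (intro suminf_mult summable_mult_shift summable_abs_qexp_coeff summable_abs_qexp_coeff')
  finally have 1: "(\<integral>\<theta>. circle \<theta> ^ Suc k * (1 - circle \<theta>) * of_real (theta_factor \<theta>) \<partial>angle) =
     of_real (pi * (q ^ Suc k * (\<Sum>j. q ^ j * qexp_coeff j * qexp_coeff (j + Suc k))))" .
  have "circle \<theta> ^ k * (1 - circle \<theta>) * of_real (theta_factor \<theta>) =
      - (circle \<theta> ^ Suc k * qexp (of_real q * circle \<theta>) * cnj (qexp (circle \<theta>)))" for \<theta>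
  proof -
    have "circle \<theta> ^ Suc k * qexp (of_real q * circle \<theta>) * cnj (qexp (circle \<theta>)) =
       circle \<theta> ^ Suc k * (1 - cnj (circle \<theta>)) * of_real (theta_factor \<theta>)"
      unfolding sq by (subst (2) qexp_shift) (simp add: mult_ac)
    also have "circle \<theta> ^ Suc k * (1 - cnj (circle \<theta>)) = circle \<theta> ^ k * (circle \<theta> - circle \<theta> * cnj (circle \<theta>))"
      by (simp add: algebra_simps)
    finally show ?thesis unfolding c1 by (simp add: algebra_simps)
  qed
  then have "(\<integral>\<theta>. circle \<theta> ^ k * (1 - circle \<theta>) * of_real (theta_factor \<theta>) \<partial>angle) =
      - (\<integral>\<theta>. circle \<theta> ^ Suc k * qexp (of_real q * circle \<theta>) * cnj (qexp (circle \<theta>)) \<partial>angle)"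
    by (simp only: Bochner_Integration.integral_minus)
  also have "(\<integral>\<theta>. circle \<theta> ^ Suc k * qexp (of_real q * circle \<theta>) * cnj (qexp (circle \<theta>)) \<partial>angle) =
     of_real (pi * (\<Sum>j. q ^ j * qexp_coeff j * qexp_coeff (j + Suc k)))"
    unfolding qexp_circle_series unfolding qexp_def
    by (rule integral_circle_parseval[OF summable_abs_qexp_coeff' summable_abs_qexp_coeff])
       (unfold qexp_def[symmetric], intro continuous_intros continuous_circle)
  finally show ?thesis unfolding 1 by simp
qed

text \<open>
  Up to normalisation this is the integral of the \<open>m\<close>-th Chebyshev polynomial of the second kind
  against the q-Hermite law, because that polynomial is \<open>sin ((m + 1) * \<theta>) / sin \<theta>\<close> at \<open>cos \<theta>\<close>.
\<close>

definition sine_moment :: "nat \<Rightarrow> real" where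
  "sine_moment m = (\<integral>\<theta>. sin (real (Suc m) * \<theta>) * sin \<theta> * theta_factor \<theta> \<partial>angle)"

lemma sine_moment_even: "sine_moment (2 * Suc k) = - (q ^ Suc k) * sine_moment (2 * k)"
proof -
  have *: "sine_moment (2 * k) = Re (\<integral>\<theta>. circle \<theta> ^ k * (1 - circle \<theta>) * of_real (theta_factor \<theta>) \<partial>angle) / 2" for k
  proof -
    have "sin (real (Suc (2 * k)) * \<theta>) * sin \<theta> * theta_factor \<theta> =
       Re (circle \<theta> ^ k * (1 - circle \<theta>) * of_real (theta_factor \<theta>)) / 2" for \<theta>
    proof -
      have "circle \<theta> ^ k * (1 - circle \<theta>) = cis (2 * real k * \<theta>) - cis (2 * real k * \<theta> + 2 * \<theta>)"
      proof -
        have "circle \<theta> ^ k = cis (2 * real k * \<theta>)" unfolding circle_def Complex.DeMoivre by (rule arg_cong[where f = cis]) simp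
        then show ?thesis by (simp add: circle_def cis_mult right_diff_distrib)
      qed
      then have "Re (circle \<theta> ^ k * (1 - circle \<theta>)) = cos (2 * real k * \<theta>) - cos (2 * real k * \<theta> + 2 * \<theta>)"
        by simp
      moreover have "sin (real (Suc (2 * k)) * \<theta>) * sin \<theta> = (cos (2 * real k * \<theta>) - cos (2 * real k * \<theta> + 2 * \<theta>)) / 2"
        using sin_times_sin[of "real (Suc (2 * k)) * \<theta>" \<theta>] by (simp add: algebra_simps)
      moreover have "Re (z * of_real t) = Re z * t" for z t by simp
      ultimately show ?thesis by (simp only: times_divide_eq_left)
    qed
    moreover have "integrable angle (\<lambda>\<theta>. circle \<theta> ^ k * (1 - circle \<theta>) * of_real (theta_factor \<theta>))"
      by (intro integrable_angle continuous_intros)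
    ultimately show ?thesis
      unfolding sine_moment_def by (simp only: integral_divide_zero integral_Re)
  qed
  show ?thesis unfolding *[of "Suc k"] *[of k] theta_moment_Suc by simp
qed

lemma integral_angle_reflect:
  fixes f :: "real \<Rightarrow> real"
  shows "(\<integral>\<theta>. f (pi - \<theta>) \<partial>angle) = (\<integral>\<theta>. f \<theta> \<partial>angle)"
proof -
  have "indicator {0..pi} (pi - x) = (indicator {0..pi} x :: real)" for x by (auto simp: indicator_def)
  then show ?thesis
    using lborel_integral_real_affine[of "-1" "\<lambda>x. indicator {0..pi} x *\<^sub>R f x" pi]
    by (simp add: integral_angle)
qed

lemma sine_moment_odd: "sine_moment (2 * k + 1) = 0"
proof -
  have "sin (real (Suc (2 * k + 1)) * (pi - \<theta>)) = - sin (real (Suc (2 * k + 1)) * \<theta>)" for \<theta>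
  proof -
    have "real (Suc (2 * k + 1)) * (pi - \<theta>) = 2 * real (Suc k) * pi - real (Suc (2 * k + 1)) * \<theta>"
      by (simp add: algebra_simps)
    then show ?thesis by (simp only: sin_diff sin_2npi cos_2npi)
  qed
  then have "sine_moment (2 * k + 1) = - sine_moment (2 * k + 1)"
    unfolding sine_moment_def
    by (subst integral_angle_reflect[symmetric]) (simp only: theta_factor_reflect, simp)
  then show ?thesis by simp
qed

lemma sine_moment_0_pos: "0 < sine_moment 0"
proof -
  interpret finite_measure angle by (rule finite_measure_angle)
  have pos: "0 < sin \<theta> * sin \<theta> * theta_factor \<theta>" if "\<theta> \<in> {0<..<pi}" for \<theta>
    using that sin_gt_zero[of \<theta>] theta_factor_pos[of \<theta>] by simp
  have "(\<integral>\<theta>. 0 \<partial>angle) < (\<integral>\<theta>. sin \<theta> * sin \<theta> * theta_factor \<theta> \<partial>angle)"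
  proof (rule integral_less_AE)
    show "integrable angle (\<lambda>\<theta>. sin \<theta> * sin \<theta> * theta_factor \<theta>)"
      by (intro integrable_angle continuous_intros)
    show "{0<..<pi} \<in> sets angle" by (auto simp: sets_angle sets_restrict_space image_iff intro!: bexI[of _ "{0<..<pi}"])
    have "emeasure angle {0<..<pi} = emeasure lborel {0<..<pi}"
      unfolding angle_def by (rule emeasure_restrict_space) auto
    then show "emeasure angle {0<..<pi} \<noteq> 0" by simp
    show "AE \<theta> in angle. \<theta> \<in> {0<..<pi} \<longrightarrow> 0 \<noteq> sin \<theta> * sin \<theta> * theta_factor \<theta>"
      using pos by (intro AE_I2) (auto simp: less_imp_neq)
    show "AE \<theta> in angle. 0 \<le> sin \<theta> * sin \<theta> * theta_factor \<theta>"
      using theta_factor_pos by (intro AE_I2 mult_nonneg_nonneg) (auto simp: less_imp_le sin_ge_zero)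
  qed simp
  then show ?thesis by (simp add: sine_moment_def)
qed

end

context q_parameter
begin

text \<open>
  With the scale \<open>kap * x = 2 * cos \<theta>\<close> the state \<open>x\<close> has variance one.
\<close>

definition kap :: real where
  "kap = sqrt (1 - q)"

lemma kap_pos: "0 < kap" and kap_sq: "kap\<^sup>2 = 1 - q"
  using abs_q_less_1 by (simp_all add: kap_def)

definition angle_law :: "real measure" where
  "angle_law = density angle (\<lambda>\<theta>. ennreal (sin \<theta> * sin \<theta> * theta_factor \<theta> / sine_moment 0))"

definition qlaw :: "real measure" where
  "qlaw = distr angle_law borel (\<lambda>\<theta>. 2 * cos \<theta> / kap)"

lemma angle_density_nonneg: "0 \<le> sin \<theta> * sin \<theta> * theta_factor \<theta> / sine_moment 0"
  using sine_moment_0_pos theta_factor_pos[of \<theta>] by (intro divide_nonneg_nonneg mult_nonneg_nonneg[OF zero_le_square]) (auto simp: less_imp_le)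

lemma measurable_angle_density:
  "(\<lambda>\<theta>. sin \<theta> * sin \<theta> * theta_factor \<theta> / sine_moment 0) \<in> borel_measurable angle"
  by (intro measurable_angle borel_measurable_continuous_onI continuous_intros)
     (use sine_moment_0_pos in auto)

lemma measurable_state: "(\<lambda>\<theta>. 2 * cos \<theta> / kap) \<in> borel_measurable angle_law"
proof -
  have "(\<lambda>\<theta>. 2 * cos \<theta> / kap) \<in> borel_measurable angle"
    by (intro measurable_angle borel_measurable_continuous_onI continuous_intros) (use kap_pos in auto)
  then show ?thesis by (simp add: angle_law_def)
qed

lemma sets_qlaw [measurable_cong, simp]: "sets qlaw = sets borel"
  by (simp add: qlaw_def)

lemma space_qlaw [simp]: "space qlaw = UNIV"
  by (simp add: qlaw_def)

lemma integral_qlaw: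
  fixes f :: "real \<Rightarrow> real"
  assumes f: "f \<in> borel_measurable borel"
  shows "(\<integral>x. f x \<partial>qlaw) =
    (\<integral>\<theta>. f (2 * cos \<theta> / kap) * (sin \<theta> * sin \<theta> * theta_factor \<theta>) \<partial>angle) / sine_moment 0"
proof -
  have "(\<lambda>\<theta>. f (2 * cos \<theta> / kap)) \<in> borel_measurable angle"
    using measurable_compose[OF measurable_state f] by (simp add: angle_law_def)
  then have "(\<integral>\<theta>. f (2 * cos \<theta> / kap) \<partial>angle_law) =
      (\<integral>\<theta>. sin \<theta> * sin \<theta> * theta_factor \<theta> / sine_moment 0 * f (2 * cos \<theta> / kap) \<partial>angle)"
    unfolding angle_law_def
    by (intro integral_real_density measurable_angle_density AE_I2 angle_density_nonneg)
  also have "\<dots> = (\<integral>\<theta>. f (2 * cos \<theta> / kap) * (sin \<theta> * sin \<theta> * theta_factor \<theta>) / sine_moment 0 \<partial>angle)"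
    by (intro Bochner_Integration.integral_cong) (auto simp: mult_ac)
  finally show ?thesis
    unfolding qlaw_def by (simp add: integral_distr[OF measurable_state f])
qed

lemma prob_space_qlaw: "prob_space qlaw"
proof -
  interpret finite_measure angle by (rule finite_measure_angle)
  have int: "integrable angle (\<lambda>\<theta>. sin \<theta> * sin \<theta> * theta_factor \<theta> / sine_moment 0)"
    by (intro integrable_angle continuous_intros) (use sine_moment_0_pos in auto)
  have "emeasure angle_law (space angle_law) =
      (\<integral>\<^sup>+\<theta>. ennreal (sin \<theta> * sin \<theta> * theta_factor \<theta> / sine_moment 0) \<partial>angle)"
    unfolding angle_law_def using measurable_angle_density sets.top[of angle]
    by (subst emeasure_density) (auto intro!: nn_integral_cong)
  also have "\<dots> = ennreal (\<integral>\<theta>. sin \<theta> * sin \<theta> * theta_factor \<theta> / sine_moment 0 \<partial>angle)"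
    by (rule nn_integral_eq_integral[OF int]) (intro AE_I2 angle_density_nonneg)
  also have "(\<integral>\<theta>. sin \<theta> * sin \<theta> * theta_factor \<theta> / sine_moment 0 \<partial>angle) = 1"
    using sine_moment_0_pos by (simp add: sine_moment_def)
  finally have "prob_space angle_law" by (intro prob_spaceI) simp
  then show ?thesis unfolding qlaw_def by (rule prob_space.prob_space_distr[OF _ measurable_state])
qed

definition support :: "real set" where
  "support = {x. \<bar>kap * x\<bar> \<le> 2}"

lemma AE_qlaw_support: "AE x in qlaw. x \<in> support"
proof -
  have "{x. \<bar>kap * x\<bar> \<le> 2} \<in> sets borel" by measurable
  then show ?thesis
    unfolding qlaw_def support_def
    by (subst AE_distr_iff[OF measurable_state]) (use kap_pos in \<open>auto simp: abs_mult\<close>)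
qed

lemma integrable_qlaw:
  fixes f :: "real \<Rightarrow> real"
  assumes "f \<in> borel_measurable borel" "\<And>x. x \<in> support \<Longrightarrow> \<bar>f x\<bar> \<le> b"
  shows "integrable qlaw f"
proof -
  interpret prob_space qlaw by (rule prob_space_qlaw)
  show ?thesis
    using AE_qlaw_support assms by (intro integrable_const_bound[where B = b]) (auto elim: eventually_mono)
qed

lemma compact_support: "compact support"
proof -
  have "support = {- (2 / kap)..2 / kap}"
    using kap_pos unfolding support_def by (auto simp: abs_le_iff field_simps)
  then show ?thesis by simp
qed

lemma integrable_qlaw_continuous:
  fixes f :: "real \<Rightarrow> real"
  assumes f: "continuous_on UNIV f"
  shows "integrable qlaw f"
proof -
  have "compact (f ` support)"
    using f compact_support by (intro compact_continuous_image continuous_on_subset[OF f]) auto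
  then obtain b where "\<And>x. x \<in> support \<Longrightarrow> \<bar>f x\<bar> \<le> b"
    using compact_imp_bounded by (force simp: bounded_iff)
  then show ?thesis using f by (intro integrable_qlaw borel_measurable_continuous_onI)
qed

section \<open>Orthogonality of the q-Hermite polynomials\<close>

text \<open>
  The continuous q-Hermite polynomials in the variable \<open>kap * x / 2\<close>.
\<close>

fun qherm :: "nat \<Rightarrow> real \<Rightarrow> real" where
  "qherm 0 x = 1"
| "qherm (Suc 0) x = kap * x"
| "qherm (Suc (Suc n)) x = kap * x * qherm (Suc n) x - (1 - q ^ Suc n) * qherm n x"

fun cheb :: "nat \<Rightarrow> real \<Rightarrow> real" where
  "cheb 0 x = 1"
| "cheb (Suc 0) x = kap * x"
| "cheb (Suc (Suc n)) x = kap * x * cheb (Suc n) x - cheb n x"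

text \<open>
  For \<open>n = 0\<close> the last coefficient vanishes, so the truncated index \<open>n - 1\<close> is harmless and the
  recurrence needs no special case.
\<close>

lemma qherm_Suc: "qherm (Suc n) x = kap * x * qherm n x - (1 - q ^ n) * qherm (n - 1) x"
  by (cases n) auto

lemma cheb_Suc: "0 < n \<Longrightarrow> cheb (Suc n) x = kap * x * cheb n x - cheb (n - 1) x"
  by (cases n) auto

lemma continuous_qherm [continuous_intros]: "continuous_on A (qherm n)"
proof (induction n rule: less_induct)
  case (less n)
  show ?case
  proof (cases n)
    case 0
    then have "qherm n = (\<lambda>_. 1)" by auto
    then show ?thesis by simp
  next
    case (Suc m)
    then have "qherm n = (\<lambda>x. kap * x * qherm m x - (1 - q ^ m) * qherm (m - 1) x)"
      by (simp add: fun_eq_iff qherm_Suc)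
    moreover have "continuous_on A (\<lambda>x. kap * x * qherm m x - (1 - q ^ m) * qherm (m - 1) x)"
      using Suc by (intro continuous_intros less.IH) auto
    ultimately show ?thesis by simp
  qed
qed

lemma continuous_cheb [continuous_intros]: "continuous_on A (cheb n)"
proof (induction n rule: less_induct)
  case (less n)
  consider "n = 0" | "n = 1" | m where "n = Suc m" "0 < m" by (cases n) auto
  then show ?case
  proof cases
    case 1
    then have "cheb n = (\<lambda>_. 1)" by auto
    then show ?thesis by simp
  next
    case 2
    then have "cheb n = (\<lambda>x. kap * x)" by auto
    then show ?thesis by (simp add: continuous_intros)
  next
    case 3
    then have "cheb n = (\<lambda>x. kap * x * cheb m x - cheb (m - 1) x)"
      by (simp add: fun_eq_iff cheb_Suc)
    moreover have "continuous_on A (\<lambda>x. kap * x * cheb m x - cheb (m - 1) x)"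
      using 3 by (intro continuous_intros less.IH) auto
    ultimately show ?thesis by simp
  qed
qed

lemma cheb_cos: "cheb m (2 * cos \<theta> / kap) * sin \<theta> = sin (real (Suc m) * \<theta>)"
proof -
  have "cheb m (2 * cos \<theta> / kap) * sin \<theta> = sin (real (Suc m) * \<theta>) \<and>
     cheb (Suc m) (2 * cos \<theta> / kap) * sin \<theta> = sin (real (Suc (Suc m)) * \<theta>)"
  proof (induction m)
    case 0
    then show ?case using kap_pos sin_double[of \<theta>] by (simp add: mult_ac)
  next
    case (Suc m)
    have "sin (real (Suc (Suc (Suc m))) * \<theta>) + sin (real (Suc m) * \<theta>) = 2 * cos \<theta> * sin (real (Suc (Suc m)) * \<theta>)"
      using sin_add[of "real (Suc (Suc m)) * \<theta>" \<theta>] sin_diff[of "real (Suc (Suc m)) * \<theta>" \<theta>]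
      by (simp add: algebra_simps)
    then have "cheb (Suc (Suc m)) (2 * cos \<theta> / kap) * sin \<theta> = sin (real (Suc (Suc (Suc m))) * \<theta>)"
      using Suc kap_pos by (simp add: algebra_simps) 
    then show ?case using Suc by blast
  qed
  then show ?thesis ..
qed

text \<open>
  Orthogonality is first proved against the Chebyshev polynomials, for which the integrals of the
  weight are already known.
\<close>

definition cross_moment :: "nat \<Rightarrow> nat \<Rightarrow> real" where
  "cross_moment n m = (\<integral>x. qherm n x * cheb m x \<partial>qlaw)"

lemma cross_moment_0: "cross_moment 0 m = sine_moment m / sine_moment 0"
proof -
  have "cheb m (2 * cos \<theta> / kap) * (sin \<theta> * sin \<theta> * theta_factor \<theta>) =
      sin (real (Suc m) * \<theta>) * sin \<theta> * theta_factor \<theta>" for \<theta>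
    using cheb_cos[of m \<theta>] by (metis mult.assoc)
  then have "(\<integral>x. cheb m x \<partial>qlaw) = sine_moment m / sine_moment 0"
    by (simp only: sine_moment_def[of m] integral_qlaw[OF borel_measurable_continuous_onI[OF continuous_cheb]])
  then show ?thesis by (simp add: cross_moment_def)
qed

lemma cross_moment_Suc:
  "cross_moment (Suc n) (Suc m) = cross_moment n (Suc (Suc m)) + cross_moment n m - (1 - q ^ n) * cross_moment (n - 1) (Suc m)"
  "cross_moment (Suc n) 0 = cross_moment n 1 - (1 - q ^ n) * cross_moment (n - 1) 0"
proof -
  have int: "integrable qlaw (\<lambda>x. qherm i x * cheb j x)" for i j
    by (intro integrable_qlaw_continuous continuous_intros)
  have "qherm (Suc n) x * cheb (Suc m) x = qherm n x * cheb (Suc (Suc m)) x + qherm n x * cheb m x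
     - (1 - q ^ n) * (qherm (n - 1) x * cheb (Suc m) x)" for x
    by (simp add: qherm_Suc algebra_simps)
  then show "cross_moment (Suc n) (Suc m) = cross_moment n (Suc (Suc m)) + cross_moment n m - (1 - q ^ n) * cross_moment (n - 1) (Suc m)"
    unfolding cross_moment_def by (simp only: int Bochner_Integration.integral_add Bochner_Integration.integral_diff
       Bochner_Integration.integrable_add integrable_mult_right integral_mult_right_zero)
  have "qherm (Suc n) x * cheb 0 x = qherm n x * cheb 1 x - (1 - q ^ n) * (qherm (n - 1) x * cheb 0 x)" for x
    by (simp add: qherm_Suc algebra_simps)
  then show "cross_moment (Suc n) 0 = cross_moment n 1 - (1 - q ^ n) * cross_moment (n - 1) 0"
    unfolding cross_moment_def by (simp only: int Bochner_Integration.integral_diff integrable_mult_right integral_mult_right_zero)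
qed

primrec theta_coeff :: "nat \<Rightarrow> real" where
  "theta_coeff 0 = 1"
| "theta_coeff (Suc k) = - (q ^ Suc k) * theta_coeff k"

lemma sine_moment_theta: "sine_moment (2 * k) / sine_moment 0 = theta_coeff k"
proof (induction k)
  case 0 then show ?case using sine_moment_0_pos by simp
next
  case (Suc k) then show ?case unfolding sine_moment_even by (simp only: theta_coeff.simps times_divide_eq_right[symmetric])
qed

text \<open>
  The recurrences of both families give a recursion in \<open>n\<close> that starts from the Chebyshev integrals of
  the weight. Its solution vanishes for \<open>m < n\<close> and for \<open>m - n\<close> odd; on the remaining diagonals it is an explicit
  product, and in the induction step this comes down to one polynomial identity in powers of \<open>q\<close>.
\<close>

lemma cross_moment_table:
  "(\<forall>m<n. cross_moment n m = 0) \<and>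
   (\<forall>k. cross_moment n (n + 2 * k) = theta_coeff k * (\<Prod>i<n. 1 - q ^ (k + 1 + i))) \<and>
   (\<forall>k. cross_moment n (n + 2 * k + 1) = 0)"
proof (induction n rule: less_induct)
  case (less n)
  show ?case
  proof (cases n)
    case 0
    then show ?thesis using sine_moment_theta sine_moment_odd by (simp add: cross_moment_0)
  next
    case (Suc n')
    let ?P = "\<lambda>n k. \<Prod>i<n. 1 - q ^ (k + 1 + i)"
    have IH: "\<And>m. m < n' \<Longrightarrow> cross_moment n' m = 0"
      "\<And>k. cross_moment n' (n' + 2 * k) = theta_coeff k * ?P n' k"
      "\<And>k. cross_moment n' (n' + 2 * k + 1) = 0"
      using less.IH[of n'] Suc by auto
    have IH': "\<And>m. m < n' - 1 \<Longrightarrow> (1 - q ^ n') * cross_moment (n' - 1) m = 0"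
      "\<And>k. (1 - q ^ n') * cross_moment (n' - 1) (n' - 1 + 2 * k) = (1 - q ^ n') * (theta_coeff k * ?P (n' - 1) k)"
      "\<And>k. (1 - q ^ n') * cross_moment (n' - 1) (n' - 1 + 2 * k + 1) = 0"
      using less.IH[of "n' - 1"] Suc by auto
    have prod_last: "?P (Suc n) k = ?P n k * (1 - q ^ (k + 1 + n))" for n k by simp
    have prod_first: "?P (Suc n) k = (1 - q ^ (k + 1)) * ?P n (k + 1)" for n k
      by (subst prod.lessThan_Suc_shift) simp
    have "cross_moment n m = 0" if mn: "m < n" for m
    proof (cases m)
      case 0
      show ?thesis
      proof (cases "n' = 0")
        case True then show ?thesis using IH(3)[of 0] by (simp add: Suc 0 cross_moment_Suc)
      next
        case False
        show ?thesis
        proof (cases "n' = 1")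
          case True
          then show ?thesis using IH(2)[of 0] IH'(2)[of 0] by (simp add: Suc 0 cross_moment_Suc)
        next
          case False
          then show ?thesis using \<open>n' \<noteq> 0\<close> IH(1)[of 1] IH'(1)[of 0] by (simp add: Suc 0 cross_moment_Suc)
        qed
      qed
    next
      case (Suc m')
      consider "m = n'" | "m + 1 = n'" | "m + 1 < n'" using mn \<open>n = Suc n'\<close> by linarith
      then show ?thesis
      proof cases
        case 1
        have "cross_moment n' (Suc m) = 0" using IH(3)[of 0] 1 by simp
        moreover have "cross_moment n' m' = 0" using IH(1)[of m'] 1 Suc by simp
        moreover have "(1 - q ^ n') * cross_moment (n' - 1) m = 0" using IH'(3)[of 0] 1 Suc by simp
        ultimately show ?thesis unfolding \<open>n = Suc n'\<close> Suc cross_moment_Suc by (simp flip: Suc)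
      next
        case 2
        obtain n'' where n'': "n' = Suc n''" using 2 by (cases n') auto
        have "cross_moment n' (Suc m) = ?P n' 0" using IH(2)[of 0] 2 by simp
        moreover have "cross_moment n' m' = 0" using IH(1)[of m'] 2 Suc by simp
        moreover have "(1 - q ^ n') * cross_moment (n' - 1) m = (1 - q ^ n') * ?P (n' - 1) 0"
        proof -
          have "m = n' - 1" using 2 by simp
          then show ?thesis using IH'(2)[of 0] by simp
        qed
        moreover have "?P n' 0 = ?P (n' - 1) 0 * (1 - q ^ n')" using prod_last[where n = n'' and k = 0] n'' by simp
        ultimately show ?thesis unfolding \<open>n = Suc n'\<close> Suc cross_moment_Suc by (auto simp flip: Suc)
      next
        case 3
        have "cross_moment n' (Suc m) = 0" "cross_moment n' m' = 0" using IH(1) 3 Suc by simp_all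
        moreover have "(1 - q ^ n') * cross_moment (n' - 1) m = 0" using IH'(1)[of m] 3 by simp
        ultimately show ?thesis unfolding \<open>n = Suc n'\<close> Suc cross_moment_Suc by (simp flip: Suc)
      qed
    qed
    moreover have "cross_moment n (n + 2 * k + 1) = 0" for k
    proof -
      have "(1 - q ^ n') * cross_moment (n' - 1) (Suc (n' + 2 * k + 1)) = 0"
        using IH'(3)[of "k + 1"] by (cases n') auto
      then show ?thesis
        using IH(3)[of "k + 1"] IH(3)[of k]
        by (simp add: Suc cross_moment_Suc)
    qed
    moreover have "cross_moment n (n + 2 * k) = theta_coeff k * ?P n k" for k
    proof -
      have a: "cross_moment n' (Suc (Suc (n' + 2 * k))) = theta_coeff (k + 1) * ?P n' (k + 1)"
        using IH(2)[of "k + 1"] by simp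
      have b: "(1 - q ^ n') * cross_moment (n' - 1) (Suc (n' + 2 * k)) =
          (1 - q ^ n') * (theta_coeff (k + 1) * ?P (n' - 1) (k + 1))"
        using IH'(2)[of "k + 1"] by (cases n') auto
      have "cross_moment n (n + 2 * k) = theta_coeff (k + 1) * ?P n' (k + 1) + theta_coeff k * ?P n' k
          - (1 - q ^ n') * (theta_coeff (k + 1) * ?P (n' - 1) (k + 1))"
        by (simp only: Suc add_Suc cross_moment_Suc a b IH(2))
      also have "\<dots> = theta_coeff k * ?P n k"
      proof (cases n')
        case 0
        then show ?thesis by (simp add: Suc algebra_simps)
      next
        case (Suc n'')
        \<comment> \<open>All products below share the factor \<open>c\<close>; what remains is an identity between polynomials.\<close>
        define c where "c = ?P n'' (k + 1)"
        define Q where "Q = q ^ k"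
        define T where "T = q ^ n''"
        have e: "q ^ (k + 1) = q * Q" "q ^ n' = q * T" "q ^ (k + 1 + 1 + n'') = q * q * Q * T" "q ^ (k + 1 + n') = q * q * Q * T"
          by (simp_all add: Q_def T_def Suc power_add)
        have P1: "?P n' (k + 1) = c * (1 - q ^ (k + 1 + 1 + n''))"
          using prod_last[where n = n'' and k = "k + 1"] by (simp only: Suc c_def)
        have P2: "?P n' k = (1 - q ^ (k + 1)) * c"
          using prod_first[where n = n'' and k = k] by (simp only: Suc c_def)
        have P3: "?P n k = (1 - q ^ (k + 1)) * c * (1 - q ^ (k + 1 + n'))"
          using prod_last[where n = n' and k = k] P2 by (simp only: \<open>n = Suc n'\<close>)
        have P4: "?P (n' - 1) (k + 1) = c" by (simp add: Suc c_def)
        have th: "theta_coeff (k + 1) = - (q * Q) * theta_coeff k" using e(1) by simp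
        show ?thesis unfolding P1 P2 P3 P4 th unfolding e by algebra
      qed
      finally show ?thesis .
    qed
    ultimately show ?thesis by blast
  qed
qed

definition qfact :: "nat \<Rightarrow> real" where
  "qfact n = (\<Prod>i<n. 1 - q ^ Suc i)"

lemma qfact_0 [simp]: "qfact 0 = 1" and qfact_Suc: "qfact (Suc n) = qfact n * (1 - q ^ Suc n)"
  by (simp_all add: qfact_def)

lemma qfact_pos: "0 < qfact n"
  unfolding qfact_def by (intro prod_pos ballI one_minus_q_power_pos) simp

lemma integral_qherm: "(\<integral>x. qherm n x \<partial>qlaw) = (if n = 0 then 1 else 0)"
proof -
  have "(\<integral>x. qherm n x \<partial>qlaw) = cross_moment n 0" by (simp add: cross_moment_def)
  also have "\<dots> = (if n = 0 then 1 else 0)"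
    using cross_moment_table[of n] sine_moment_0_pos by (auto simp: cross_moment_0)
  finally show ?thesis .
qed

text \<open>
  Once all \<open>H n\<close> with \<open>n > 0\<close> have mean zero, the three-term recurrence moves degree from one
  factor to the other.
\<close>

lemma qherm_orthogonal: "(\<integral>x. qherm m x * qherm n x \<partial>qlaw) = (if m = n then qfact n else 0)"
proof -
  define I where "I m n = (\<integral>x. qherm m x * qherm n x \<partial>qlaw)" for m n
  have int: "integrable qlaw (\<lambda>x. qherm i x * qherm j x)" for i j
    by (intro integrable_qlaw_continuous continuous_intros)
  have rec: "I m (Suc n) = I (Suc m) n + (1 - q ^ m) * I (m - 1) n - (1 - q ^ n) * I m (n - 1)" for m n
  proof -
    have "qherm m x * qherm (Suc n) x = qherm (Suc m) x * qherm n x + (1 - q ^ m) * (qherm (m - 1) x * qherm n x)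
       - (1 - q ^ n) * (qherm m x * qherm (n - 1) x)" for x
      by (simp add: qherm_Suc algebra_simps)
    then show ?thesis
      unfolding I_def by (simp only: int Bochner_Integration.integral_add Bochner_Integration.integral_diff
         Bochner_Integration.integrable_add integrable_mult_right integral_mult_right_zero)
  qed
  have "\<forall>m. I m n = (if m = n then qfact n else 0)" for n
  proof (induction n rule: less_induct)
    case (less n)
    show ?case
    proof (cases n)
      case 0
      then show ?thesis using integral_qherm by (simp add: I_def)
    next
      case (Suc n')
      have IH: "I m n' = (if m = n' then qfact n' else 0)" for m using less.IH[of n'] Suc by auto
      have IH': "(1 - q ^ n') * I m (n' - 1) = (1 - q ^ n') * (if m = n' - 1 then qfact (n' - 1) else 0)" for m
        using less.IH[of "n' - 1"] Suc by auto
      show ?thesis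
      proof
        fix m
        show "I m n = (if m = n then qfact n else 0)"
          unfolding Suc rec IH IH'
          by (cases m; cases n') (auto simp: qfact_Suc)
      qed
    qed
  qed
  then show ?thesis by (simp add: I_def)
qed

end

section \<open>Series in pairs of q-Hermite polynomials\<close>

text \<open>
  A ratio that only eventually stays below \<open>s\<close> costs a constant, and this constant does not depend on
  the parameter \<open>x\<close>.
\<close>

lemma eventually_geometric_bound:
  fixes f :: "nat \<Rightarrow> 'a \<Rightarrow> real"
  assumes bd: "\<And>n. \<exists>b. \<forall>x\<in>S. f n x \<le> b"
    and N: "\<And>n x. N \<le> n \<Longrightarrow> x \<in> S \<Longrightarrow> f (Suc n) x \<le> s * f n x" and s: "1 \<le> s"
  shows "\<exists>C\<ge>0. \<forall>n. \<forall>x\<in>S. f n x \<le> C * s ^ n"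
proof -
  obtain b where b: "\<And>n x. x \<in> S \<Longrightarrow> f n x \<le> b n" using bd by metis
  define C where "C = (\<Sum>i\<le>N. \<bar>b i\<bar>)"
  have "0 \<le> C" unfolding C_def by (intro sum_nonneg) simp
  have "f n x \<le> C * s ^ n" if x: "x \<in> S" for n x
  proof (induction n)
    case 0
    have "f 0 x \<le> \<bar>b 0\<bar>" using b[OF x, of 0] by linarith
    also have "\<dots> \<le> C" unfolding C_def by (rule member_le_sum) auto
    finally show ?case by simp
  next
    case (Suc n)
    show ?case
    proof (cases "N \<le> n")
      case True
      then have "f (Suc n) x \<le> s * f n x" using N x by blast
      also have "\<dots> \<le> s * (C * s ^ n)" using Suc s by (intro mult_left_mono) auto
      finally show ?thesis by (simp add: mult.left_commute)
    next
      case False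
      have "f (Suc n) x \<le> \<bar>b (Suc n)\<bar>" using b[OF x, of "Suc n"] by linarith
      also have "\<dots> \<le> C" unfolding C_def by (rule member_le_sum) (use False in auto)
      also have "\<dots> \<le> C * s ^ Suc n"
        using mult_left_mono[OF one_le_power[OF s, of "Suc n"] \<open>0 \<le> C\<close>] by simp
      finally show ?thesis .
    qed
  qed
  then show ?thesis using \<open>0 \<le> C\<close> by blast
qed

context q_parameter
begin

lemma inverse_qfact_bound:
  assumes "1 < s" shows "\<exists>C\<ge>0. \<forall>n. 1 / qfact n \<le> C * s ^ n"
proof -
  have "(\<lambda>n. q ^ Suc n) \<longlonglongrightarrow> 0" using tendsto_q_power by (rule LIMSEQ_Suc)
  then have "eventually (\<lambda>n. q ^ Suc n < 1 - 1 / s) sequentially"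
    using assms by (intro order_tendstoD) auto
  then obtain N where N: "\<And>n. N \<le> n \<Longrightarrow> q ^ Suc n < 1 - 1 / s" by (auto simp: eventually_sequentially)
  have "\<exists>C\<ge>0. \<forall>n. \<forall>x\<in>{()}. 1 / qfact n \<le> C * s ^ n"
  proof (rule eventually_geometric_bound[where N = N])
    fix n assume "N \<le> n"
    then have "1 / s < 1 - q ^ Suc n" using N[of n] by linarith
    then have "1 / (1 - q ^ Suc n) < s"
      using assms one_minus_q_power_pos[of "Suc n"] by (simp add: field_simps)
    then have "1 / qfact n * (1 / (1 - q ^ Suc n)) \<le> 1 / qfact n * s"
      using qfact_pos[of n] by (intro mult_left_mono) auto
    then show "1 / qfact (Suc n) \<le> s * (1 / qfact n)" by (simp add: qfact_Suc)
  next
    fix n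
    show "\<exists>b. \<forall>x\<in>{()}. 1 / qfact n \<le> b" by blast
  next
    show "1 \<le> s" using assms by simp
  qed
  then show ?thesis by simp
qed

lemma qherm_bounded: "\<exists>b. \<forall>x\<in>support. \<bar>qherm n x\<bar> \<le> b"
proof -
  have "compact (qherm n ` support)"
    by (intro compact_continuous_image continuous_qherm compact_support)
  then have "bounded (qherm n ` support)" by (rule compact_imp_bounded)
  then show ?thesis by (auto simp: bounded_iff)
qed

text \<open>
  On the support the recurrence is a summable perturbation of the Chebyshev recurrence, whose solutions
  grow linearly; any rate \<open>s > 1\<close> therefore suffices. The Chebyshev recurrence is factored with
  \<open>w = exp (\<i> * \<theta>)\<close>: the differences \<open>D n = H (n + 1) - w * H n\<close> keep their modulus up to the
  perturbation \<open>q ^ (n + 1) * H n\<close>, and \<open>D n\<close> controls the growth of \<open>H n\<close>.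
\<close>

lemma qherm_bound:
  assumes s: "1 < s" shows "\<exists>C\<ge>0. \<forall>n. \<forall>x\<in>support. \<bar>qherm n x\<bar> \<le> C * s ^ n"
proof -
  define e where "e = s - 1"
  have e: "0 < e" using s by (simp add: e_def)
  define w where "w x = cis (arccos (kap * x / 2))" for x
  define D where "D n x = of_real (qherm (Suc n) x) - w x * of_real (qherm n x)" for n x
  \<comment> \<open>The weight \<open>1 / e\<close> balances both parts: each grows by at most the factor \<open>1 + e = s\<close> per step.\<close>
  define f where "f n x = max \<bar>qherm n x\<bar> (norm (D n x) / e)" for n x
  have nw [simp]: "norm (w x) = 1" for x by (simp add: w_def)
  have wc: "w x * cnj (w x) = 1" for x by (simp add: w_def cis_cnj cis_mult)
  have ws: "w x + cnj (w x) = of_real (kap * x)" if "x \<in> support" for x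
  proof -
    have "cos (arccos (kap * x / 2)) = kap * x / 2"
      using that by (intro cos_arccos) (auto simp: support_def abs_le_iff)
    then show ?thesis by (simp add: w_def complex_eq_iff)
  qed
  have D_Suc: "D (Suc n) x = cnj (w x) * D n x + of_real (q ^ Suc n * qherm n x)" if x: "x \<in> support" for n x
  proof -
    have "of_real (qherm (Suc (Suc n)) x) = (w x + cnj (w x)) * of_real (qherm (Suc n) x)
        - of_real (1 - q ^ Suc n) * of_real (qherm n x)"
      unfolding ws[OF x] by simp
    then have "D (Suc n) x = cnj (w x) * of_real (qherm (Suc n) x) - of_real (1 - q ^ Suc n) * of_real (qherm n x)"
      unfolding D_def by (simp only:) (simp add: algebra_simps del: qherm.simps)
    also have "of_real (1 - q ^ Suc n) * of_real (qherm n x) =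
        (w x * cnj (w x) - of_real (q ^ Suc n)) * of_real (qherm n x)" unfolding wc by simp
    finally show ?thesis unfolding D_def by (simp add: algebra_simps del: qherm.simps)
  qed
  have "(\<lambda>n. \<bar>q\<bar> ^ Suc n) \<longlonglongrightarrow> 0"
    using abs_q_less_1 by (intro LIMSEQ_Suc LIMSEQ_power_zero) simp
  then have "eventually (\<lambda>n. \<bar>q\<bar> ^ Suc n < e * e) sequentially"
    using e by (intro order_tendstoD) auto
  then obtain N where N: "\<And>n. N \<le> n \<Longrightarrow> \<bar>q\<bar> ^ Suc n < e * e" by (auto simp: eventually_sequentially)
  have "\<exists>C\<ge>0. \<forall>n. \<forall>x\<in>support. f n x \<le> C * s ^ n"
  proof (rule eventually_geometric_bound[where N = N])
    fix n
    obtain b b' where b: "\<And>x. x \<in> support \<Longrightarrow> \<bar>qherm n x\<bar> \<le> b" "\<And>x. x \<in> support \<Longrightarrow> \<bar>qherm (Suc n) x\<bar> \<le> b'"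
      using qherm_bounded[of n] qherm_bounded[of "Suc n"] by blast
    have "norm (D n x) / e \<le> (b' + b) / e" if "x \<in> support" for x
    proof -
      have "norm (D n x) \<le> \<bar>qherm (Suc n) x\<bar> + \<bar>qherm n x\<bar>"
        unfolding D_def by (rule order_trans[OF norm_triangle_ineq4]) (simp add: norm_mult)
      then show ?thesis using b[OF that] e by (intro divide_right_mono) auto
    qed
    then have "f n x \<le> max b ((b' + b) / e)" if "x \<in> support" for x
      unfolding f_def using b(1) that by (intro max.mono) auto
    then show "\<exists>b. \<forall>x\<in>support. f n x \<le> b" by blast
  next
    fix n x assume n: "N \<le> n" and x: "x \<in> support"
    have "\<bar>qherm n x\<bar> \<le> f n x" and "norm (D n x) / e \<le> f n x"
      by (auto simp: f_def)
    then have f: "\<bar>qherm n x\<bar> \<le> f n x" "norm (D n x) \<le> e * f n x"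
      using e by (auto simp: field_simps)
    have f0: "0 \<le> f n x" by (simp add: f_def le_max_iff_disj)
    have "of_real (qherm (Suc n) x) = D n x + w x * of_real (qherm n x)" by (simp add: D_def)
    then have "norm (of_real (qherm (Suc n) x) :: complex) \<le> norm (D n x) + norm (w x * of_real (qherm n x))"
      by (metis norm_triangle_ineq)
    then have 1: "\<bar>qherm (Suc n) x\<bar> \<le> s * f n x"
      using f by (simp add: norm_mult e_def algebra_simps)
    have "norm (D (Suc n) x) \<le> norm (D n x) + \<bar>q\<bar> ^ Suc n * \<bar>qherm n x\<bar>"
      unfolding D_Suc[OF x] by (rule order_trans[OF norm_triangle_ineq]) (simp add: norm_mult abs_mult power_abs del: of_real_mult)
    also have "\<dots> \<le> e * f n x + (e * e) * f n x"
      using f N[OF n] f0 by (intro add_mono mult_mono) auto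
    also have "\<dots> = e * (s * f n x)" by (simp add: e_def algebra_simps)
    finally have "norm (D (Suc n) x) / e \<le> s * f n x" using e by (simp add: field_simps)
    with 1 show "f (Suc n) x \<le> s * f n x" by (simp add: f_def)
  qed (use s in \<open>auto simp: f_def le_max_iff_disj\<close>)
  then show ?thesis by (auto simp: f_def)
qed

definition herm_term :: "real \<Rightarrow> nat \<Rightarrow> nat \<Rightarrow> real \<Rightarrow> real \<Rightarrow> nat \<Rightarrow> real" where
  "herm_term t i j x y n = t ^ n * qherm (n + i) x * qherm (n + j) y / qfact n"

text \<open>
  The relations below express the three-term recurrence in either variable as linear relations between
  the sums with different shifts \<open>i\<close> and \<open>j\<close>.
\<close>

definition herm_sum :: "real \<Rightarrow> nat \<Rightarrow> nat \<Rightarrow> real \<Rightarrow> real \<Rightarrow> real" where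
  "herm_sum t i j x y = (\<Sum>n. herm_term t i j x y n)"

lemma herm_term_bound:
  assumes t: "\<bar>t\<bar> < 1"
  shows "\<exists>K r. 0 \<le> K \<and> 0 < r \<and> r < 1 \<and>
    (\<forall>n. \<forall>x\<in>support. \<forall>y\<in>support. \<bar>herm_term t i j x y n\<bar> \<le> K * r ^ n)"
proof -
  define m where "m = max \<bar>t\<bar> (1 / 2)"
  \<comment> \<open>Three sequences growing like \<open>s ^ n\<close> are multiplied with \<open>m ^ n\<close>; this choice leaves the rate
    \<open>sqrt m < 1\<close>. The lower bound \<open>1 / 2\<close> in \<open>m\<close> avoids division by zero.\<close>
  define s where "s = root 3 (1 / sqrt m)"
  have m: "0 < m" "m < 1" "\<bar>t\<bar> \<le> m" using t by (auto simp: m_def)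
  have s3: "s ^ 3 = 1 / sqrt m" using m by (simp add: s_def)
  have "1 < s" using m by (simp add: s_def)
  obtain C where C: "0 \<le> C" "\<And>n x. x \<in> support \<Longrightarrow> \<bar>qherm n x\<bar> \<le> C * s ^ n"
    using qherm_bound[OF \<open>1 < s\<close>] by blast
  obtain C' where C': "0 \<le> C'" "\<And>n. 1 / qfact n \<le> C' * s ^ n"
    using inverse_qfact_bound[OF \<open>1 < s\<close>] by blast
  show ?thesis
  proof (intro exI conjI allI ballI)
    show "0 \<le> C * s ^ i * (C * s ^ j) * C'" using C C' \<open>1 < s\<close> by (intro mult_nonneg_nonneg) auto
    show "0 < sqrt m" "sqrt m < 1" using m by auto
    fix n x y assume x: "x \<in> support" and y: "y \<in> support"
    have "\<bar>herm_term t i j x y n\<bar> = \<bar>t\<bar> ^ n * (\<bar>qherm (n + i) x\<bar> * \<bar>qherm (n + j) y\<bar> * (1 / qfact n))"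
      using qfact_pos[of n] by (simp add: herm_term_def abs_mult power_abs)
    also have "\<dots> \<le> m ^ n * ((C * s ^ (n + i)) * (C * s ^ (n + j)) * (C' * s ^ n))"
      using C C' m qfact_pos[of n] \<open>1 < s\<close> x y
      by (intro mult_mono power_mono mult_nonneg_nonneg) auto
    also have "\<dots> = C * s ^ i * (C * s ^ j) * C' * (m ^ n * (s ^ 3) ^ n)"
    proof -
      have "(s ^ 3) ^ n = s ^ n * s ^ n * s ^ n" by (simp add: power3_eq_cube power_mult_distrib)
      then show ?thesis by (simp only: power_add mult_ac)
    qed
    also have "m ^ n * (s ^ 3) ^ n = sqrt m ^ n"
      unfolding s3 power_mult_distrib[symmetric] using m by (simp add: real_div_sqrt)
    finally show "\<bar>herm_term t i j x y n\<bar> \<le> C * s ^ i * (C * s ^ j) * C' * sqrt m ^ n" .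
  qed
qed

lemma summable_herm_term:
  assumes "\<bar>t\<bar> < 1" "x \<in> support" "y \<in> support"
  shows "summable (herm_term t i j x y)"
proof -
  obtain K r where r: "0 < r" "r < 1" and K: "\<And>n. \<bar>herm_term t i j x y n\<bar> \<le> K * r ^ n"
    using herm_term_bound[OF assms(1), of i j] assms by blast
  show ?thesis
    by (rule summable_comparison_test'[of "\<lambda>n. K * r ^ n" 0]) (use r K in \<open>auto intro!: summable_mult summable_geometric\<close>)
qed

lemma herm_sum_sym: "herm_sum t i j x y = herm_sum t j i y x"
  unfolding herm_sum_def herm_term_def by (simp add: mult_ac)

lemma q_mult_abs_less_1: "\<bar>t\<bar> < 1 \<Longrightarrow> \<bar>q * t\<bar> < 1"
  using abs_q_less_1 mult_strict_mono'[of "\<bar>q\<bar>" 1 "\<bar>t\<bar>" 1] by (simp add: abs_mult)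

lemma qherm_mult: "kap * x * qherm n x = qherm (n + 1) x + (1 - q ^ n) * qherm (n - 1) x"
  by (simp add: qherm_Suc)

text \<open>
  The recurrence for \<open>kap * x * H n x\<close> gives the two sums on the right; in the second one the coefficient
  \<open>1 - q ^ n\<close> cancels against the last factor of the q-factorial and the index moves by one.
\<close>

lemma herm_sum_raise:
  assumes "\<bar>t\<bar> < 1" "x \<in> support" "y \<in> support"
  shows "kap * x * herm_sum t 0 j x y = herm_sum t 1 j x y + t * herm_sum t 0 (j + 1) x y"
proof -
  note s = summable_herm_term[OF assms]
  define g where "g n = t ^ n * ((1 - q ^ n) * qherm (n - 1) x) * qherm (n + j) y / qfact n" for n
  have g_Suc: "g (Suc n) = t * herm_term t 0 (j + 1) x y n" for n
    using qfact_pos[of n] one_minus_q_power_pos[of "Suc n"]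
    by (simp add: g_def herm_term_def qfact_Suc field_simps)
  have "(\<lambda>n. g (Suc n)) sums (t * herm_sum t 0 (j + 1) x y)"
    unfolding g_Suc herm_sum_def by (intro sums_mult summable_sums s)
  then have "g sums (t * herm_sum t 0 (j + 1) x y)"
    by (subst (asm) sums_Suc_iff) (simp add: g_def)
  then have "(\<lambda>n. herm_term t 1 j x y n + g n) sums (herm_sum t 1 j x y + t * herm_sum t 0 (j + 1) x y)"
    unfolding herm_sum_def by (intro sums_add summable_sums s)
  moreover have "herm_term t 1 j x y n + g n = kap * x * herm_term t 0 j x y n" for n
  proof -
    have "kap * x * herm_term t 0 j x y n = t ^ n * (kap * x * qherm n x) * qherm (n + j) y / qfact n"
      by (simp add: herm_term_def mult_ac)
    then show ?thesis
      unfolding qherm_mult by (simp add: herm_term_def g_def algebra_simps add_divide_distrib diff_divide_distrib)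
  qed
  moreover have "(\<lambda>n. kap * x * herm_term t 0 j x y n) sums (kap * x * herm_sum t 0 j x y)"
    unfolding herm_sum_def by (intro sums_mult summable_sums s)
  ultimately show ?thesis by (simp add: sums_unique2)
qed

text \<open>
  Here the coefficient \<open>1 - q ^ (n + 1)\<close> does not cancel; its power of \<open>q\<close> changes the parameter \<open>t\<close> to
  \<open>q * t\<close>.
\<close>

lemma herm_sum_raise_2:
  assumes "\<bar>t\<bar> < 1" "x \<in> support" "y \<in> support"
  shows "kap * x * herm_sum t 1 j x y =
    herm_sum t 2 j x y + herm_sum t 0 j x y - q * herm_sum (q * t) 0 j x y"
proof -
  note s = summable_herm_term[OF assms] summable_herm_term[OF q_mult_abs_less_1[OF assms(1)] assms(2,3)]
  have "(\<lambda>n. herm_term t 2 j x y n + herm_term t 0 j x y n - q * herm_term (q * t) 0 j x y n) sums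
    (herm_sum t 2 j x y + herm_sum t 0 j x y - q * herm_sum (q * t) 0 j x y)"
    unfolding herm_sum_def by (intro sums_add sums_diff sums_mult summable_sums s)
  moreover have "herm_term t 2 j x y n + herm_term t 0 j x y n - q * herm_term (q * t) 0 j x y n =
      kap * x * herm_term t 1 j x y n" for n
  proof -
    have "kap * x * qherm (n + 1) x = qherm (n + 2) x + qherm n x - q * q ^ n * qherm n x"
      using qherm_mult[of x "n + 1"] by (simp add: algebra_simps)
    then have "kap * x * herm_term t 1 j x y n = t ^ n * (qherm (n + 2) x + qherm n x - q * q ^ n * qherm n x) * qherm (n + j) y / qfact n"
      by (simp add: herm_term_def mult_ac)
    then show ?thesis
      by (simp add: herm_term_def power_mult_distrib algebra_simps add_divide_distrib diff_divide_distrib)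
  qed
  moreover have "(\<lambda>n. kap * x * herm_term t 1 j x y n) sums (kap * x * herm_sum t 1 j x y)"
    unfolding herm_sum_def by (intro sums_mult summable_sums s)
  ultimately show ?thesis by (simp add: sums_unique2)
qed

text \<open>
  Subtracting the series at \<open>q * t\<close> produces the coefficient \<open>1 - q ^ n\<close>, which cancels in the q-factorial.
\<close>

lemma herm_sum_diag:
  assumes "\<bar>t\<bar> < 1" "x \<in> support" "y \<in> support"
  shows "t * herm_sum t 1 1 x y = herm_sum t 0 0 x y - herm_sum (q * t) 0 0 x y"
proof -
  note s = summable_herm_term[OF assms] summable_herm_term[OF q_mult_abs_less_1[OF assms(1)] assms(2,3)]
  define g where "g n = herm_term t 0 0 x y n - herm_term (q * t) 0 0 x y n" for n
  have "g (Suc n) = t * herm_term t 1 1 x y n" for n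
  proof -
    have "g (Suc n) = t ^ Suc n * qherm (Suc n) x * qherm (Suc n) y * ((1 - q ^ Suc n) / qfact (Suc n))"
      unfolding g_def herm_term_def power_mult_distrib by (simp add: algebra_simps diff_divide_distrib)
    also have "(1 - q ^ Suc n) / qfact (Suc n) = 1 / qfact n"
      using qfact_pos[of n] one_minus_q_power_pos[of "Suc n"] by (simp add: qfact_Suc)
    finally show ?thesis by (simp add: herm_term_def mult_ac)
  qed
  then have "(\<lambda>n. g (Suc n)) sums (t * herm_sum t 1 1 x y)"
    unfolding herm_sum_def by (simp only:) (intro sums_mult summable_sums s)
  then have "g sums (t * herm_sum t 1 1 x y)"
    by (subst (asm) sums_Suc_iff) (simp add: g_def herm_term_def)
  moreover have "g sums (herm_sum t 0 0 x y - herm_sum (q * t) 0 0 x y)"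
    unfolding herm_sum_def g_def by (intro sums_diff summable_sums s)
  ultimately show ?thesis by (rule sums_unique2)
qed

section \<open>Positivity of the Mehler kernel\<close>

definition mehler :: "real \<Rightarrow> real \<Rightarrow> real \<Rightarrow> real" where
  "mehler t x y = herm_sum t 0 0 x y"

text \<open>
  The shift relations form a linear system for the sums with small shifts; eliminating all of them except
  the kernels at \<open>t\<close> and \<open>q * t\<close> leaves this equation. It is the functional equation of the infinite
  product that the q-Mehler formula gives for the kernel.
\<close>

lemma mehler_functional_equation:
  assumes "\<bar>t\<bar> < 1" "x \<in> support" "y \<in> support"
  shows "((1 - t\<^sup>2)\<^sup>2 - t * (kap * y - t * (kap * x)) * (kap * x - t * (kap * y))) * mehler t x y =
    (1 - t\<^sup>2) * (1 - q * t\<^sup>2) * mehler (q * t) x y"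
proof -
  define G Gq S10 S01 S11 S20 where "G = herm_sum t 0 0 x y" and "Gq = herm_sum (q * t) 0 0 x y"
    and "S10 = herm_sum t 1 0 x y" and "S01 = herm_sum t 0 1 x y"
    and "S11 = herm_sum t 1 1 x y" and "S20 = herm_sum t 2 0 x y"
  have 1: "kap * x * G = S10 + t * S01"
    using herm_sum_raise[OF assms, of 0] by (simp add: G_def S10_def S01_def)
  have 2: "kap * y * G = S01 + t * S10"
    using herm_sum_raise[OF assms(1,3,2), of 0] unfolding herm_sum_sym[of t _ _ y x]
    by (simp add: G_def S10_def S01_def)
  have 3: "kap * y * S10 = S11 + t * S20"
    using herm_sum_raise[OF assms(1,3,2), of 1] unfolding herm_sum_sym[of t _ _ y x]
    by (simp add: S10_def S11_def S20_def numeral_2_eq_2)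
  have 4: "kap * x * S10 = S20 + G - q * Gq"
    using herm_sum_raise_2[OF assms, of 0] by (simp add: S10_def S20_def G_def Gq_def)
  have 5: "t * S11 = G - Gq"
    using herm_sum_diag[OF assms] by (simp add: S11_def G_def Gq_def)
  have 6: "(1 - t\<^sup>2) * S10 = (kap * x - t * (kap * y)) * G" using 1 2 by algebra
  have 7: "t * ((kap * y - t * (kap * x)) * S10) = (G - Gq) - t\<^sup>2 * (G - q * Gq)" using 3 4 5 by algebra
  have "t * (kap * y - t * (kap * x)) * ((kap * x - t * (kap * y)) * G) =
     (1 - t\<^sup>2) * ((G - Gq) - t\<^sup>2 * (G - q * Gq))" using 6 7 by algebra
  then show ?thesis unfolding mehler_def G_def[symmetric] Gq_def[symmetric] by algebra
qed

text \<open>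
  With \<open>kap * x = 2 * cos a\<close> and \<open>kap * y = 2 * cos b\<close> the expression is the product of the squared distances
  of \<open>t\<close> from \<open>exp (\<i> * (a + b))\<close> and from \<open>exp (\<i> * (a - b))\<close>.
\<close>

lemma mehler_factor_pos:
  assumes t: "\<bar>t\<bar> < 1" and xy: "x \<in> support" "y \<in> support"
  shows "0 < (1 - t\<^sup>2)\<^sup>2 - t * (kap * y - t * (kap * x)) * (kap * x - t * (kap * y))"
proof -
  define a b where "a = arccos (kap * x / 2)" and "b = arccos (kap * y / 2)"
  have x: "kap * x = 2 * cos a" using xy by (simp add: a_def support_def cos_arccos abs_le_iff)
  have y: "kap * y = 2 * cos b" using xy by (simp add: b_def support_def cos_arccos abs_le_iff)
  have pos: "0 < 1 - 2 * t * cos c + t\<^sup>2" for c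
  proof -
    have "2 * t * cos c \<le> 2 * \<bar>t\<bar>"
    proof -
      have "t * cos c \<le> \<bar>t\<bar> * \<bar>cos c\<bar>" by (metis abs_ge_self abs_mult)
      also have "\<dots> \<le> \<bar>t\<bar> * 1" by (intro mult_left_mono) auto
      finally show ?thesis by simp
    qed
    moreover have "0 < (1 - \<bar>t\<bar>)\<^sup>2" using t by simp
    ultimately show ?thesis by (simp add: power2_diff)
  qed
  have "(1 - t\<^sup>2)\<^sup>2 - t * (2 * cos b - t * (2 * cos a)) * (2 * cos a - t * (2 * cos b)) =
     (1 - 2 * t * cos (a + b) + t\<^sup>2) * (1 - 2 * t * cos (a - b) + t\<^sup>2)"
  proof -
    have "(sin a)\<^sup>2 = 1 - (cos a)\<^sup>2" "(sin b)\<^sup>2 = 1 - (cos b)\<^sup>2" by (simp_all add: sin_squared_eq)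
    then show ?thesis unfolding cos_add cos_diff by algebra
  qed
  also have "0 < \<dots>" by (intro mult_pos_pos pos)
  finally show ?thesis unfolding x y .
qed

lemma mehler_0: "mehler 0 x y = 1"
  unfolding mehler_def herm_sum_def
  by (subst suminf_finite[of "{0}"]) (auto simp: herm_term_def)

text \<open>
  The functional equation transports positivity from \<open>q * t\<close> to \<open>t\<close>. For large \<open>n\<close> the kernel is positive at
  \<open>q ^ n * t\<close> by continuity at \<open>0\<close>.
\<close>

lemma mehler_pos:
  assumes t: "\<bar>t\<bar> < 1" and xy: "x \<in> support" "y \<in> support"
  shows "0 < mehler t x y"
proof -
  have "isCont (\<lambda>t. mehler t x y) 0"
  proof -
    have "summable (\<lambda>n. qherm n x * qherm n y / qfact n * (1/2) ^ n)"
    proof -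
      have "(\<lambda>n. qherm n x * qherm n y / qfact n * (1/2) ^ n) = herm_term (1/2) 0 0 x y"
        by (simp add: fun_eq_iff herm_term_def)
      then show ?thesis using summable_herm_term[of "1/2" x y 0 0] xy by simp
    qed
    then have "isCont (\<lambda>t. \<Sum>n. qherm n x * qherm n y / qfact n * t ^ n) 0"
      by (rule isCont_powser) simp
    then show ?thesis by (simp add: mehler_def herm_sum_def herm_term_def mult_ac)
  qed
  moreover have "(\<lambda>n. q ^ n * t) \<longlonglongrightarrow> 0 * t" by (intro tendsto_mult tendsto_q_power tendsto_const)
  ultimately have "(\<lambda>n. mehler (q ^ n * t) x y) \<longlonglongrightarrow> mehler 0 x y"
    by (intro isCont_tendsto_compose[of 0 "\<lambda>t. mehler t x y"]) auto
  then have "eventually (\<lambda>n. 0 < mehler (q ^ n * t) x y) sequentially"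
    by (rule order_tendstoD(1)) (simp add: mehler_0)
  then obtain N where "0 < mehler (q ^ N * t) x y" by (auto simp: eventually_sequentially)
  then show ?thesis
  proof (induction N)
    case (Suc N)
    define s where "s = q ^ N * t"
    have "\<bar>q ^ N\<bar> \<le> 1" using abs_q_less_1 by (simp add: power_abs power_le_one)
    then have "\<bar>s\<bar> \<le> 1 * \<bar>t\<bar>" unfolding s_def abs_mult by (rule mult_right_mono) simp
    then have s: "\<bar>s\<bar> < 1" using t by simp
    then have s2: "s\<^sup>2 < 1" by (simp add: abs_square_less_1)
    have "\<bar>q * s\<^sup>2\<bar> < 1" using q_mult_abs_less_1[of "s\<^sup>2"] s2 by simp
    then have "0 < (1 - s\<^sup>2) * (1 - q * s\<^sup>2) * mehler (q * s) x y"
      using s2 Suc.prems by (intro mult_pos_pos) (auto simp: s_def mult.assoc)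
    then have "0 < mehler s x y"
      unfolding mehler_functional_equation[OF s xy, symmetric]
      using mehler_factor_pos[OF s xy] by (simp add: zero_less_mult_iff)
    then show ?case using Suc.IH by (simp add: s_def)
  qed simp
qed

end

section \<open>Regression identities for the Mehler kernel\<close>

context q_parameter
begin

lemma qfact_ratio: "(1 - q ^ Suc n) / qfact (Suc n) = 1 / qfact n"
  using qfact_pos[of n] one_minus_q_power_pos[of "Suc n"] by (simp add: qfact_Suc)

lemma mehler_bounded:
  assumes "\<bar>t\<bar> < 1" shows "\<exists>b. \<forall>x\<in>support. \<forall>y\<in>support. \<bar>mehler t x y\<bar> \<le> b"
proof -
  obtain K r where r: "0 \<le> K" "0 < r" "r < 1"
    and K: "\<And>n x y. x \<in> support \<Longrightarrow> y \<in> support \<Longrightarrow> \<bar>herm_term t 0 0 x y n\<bar> \<le> K * r ^ n"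
    using herm_term_bound[OF assms, of 0 0] by blast
  have s: "summable (\<lambda>n. K * r ^ n)" using r by (intro summable_mult summable_geometric) auto
  have "\<bar>mehler t x y\<bar> \<le> (\<Sum>n. K * r ^ n)" if "x \<in> support" "y \<in> support" for x y
    unfolding mehler_def herm_sum_def real_norm_def[symmetric]
    by (rule norm_suminf_le[OF _ s]) (use K that in simp)
  then show ?thesis by blast
qed

lemma measurable_qherm [measurable]: "qherm n \<in> borel_measurable borel"
  by (intro borel_measurable_continuous_onI continuous_qherm)

lemma measurable_mehler:
  assumes [measurable]: "f \<in> borel_measurable M" "g \<in> borel_measurable M"
  shows "(\<lambda>x. mehler t (f x) (g x)) \<in> borel_measurable M"
  unfolding mehler_def herm_sum_def herm_term_def
  by (intro borel_measurable_suminf) measurable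

text \<open>
  Termwise integration is justified by the uniform geometric bound on the support.
\<close>

lemma integral_mult_mehler:
  fixes F :: "real \<Rightarrow> real"
  assumes t: "\<bar>t\<bar> < 1" and y: "y \<in> support"
    and F: "F \<in> borel_measurable borel" "\<And>x. x \<in> support \<Longrightarrow> \<bar>F x\<bar> \<le> b"
  shows "(\<lambda>m. t ^ m * qherm m y / qfact m * (\<integral>x. F x * qherm m x \<partial>qlaw)) sums
    (\<integral>x. F x * mehler t y x \<partial>qlaw)"
proof -
  interpret prob_space qlaw by (rule prob_space_qlaw)
  note F(1) [measurable]
  obtain K r where r: "0 \<le> K" "0 < r" "r < 1"
    and K: "\<And>n x y. x \<in> support \<Longrightarrow> y \<in> support \<Longrightarrow> \<bar>herm_term t 0 0 x y n\<bar> \<le> K * r ^ n"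
    using herm_term_bound[OF t, of 0 0] by blast
  have b: "0 \<le> \<bar>b\<bar>" by simp
  let ?f = "\<lambda>m x. F x * herm_term t 0 0 y x m"
  have term_meas: "?f m \<in> borel_measurable borel" for m
    unfolding herm_term_def by measurable
  have bound: "\<bar>?f m x\<bar> \<le> \<bar>b\<bar> * (K * r ^ m)" if "x \<in> support" for m x
    unfolding abs_mult using K[OF y that, of m] F(2)[OF that] b by (intro mult_mono) auto
  have int: "integrable qlaw (?f m)" for m
    using term_meas bound by (intro integrable_qlaw)
  have s: "summable (\<lambda>m. \<bar>b\<bar> * (K * r ^ m))" using r by (intro summable_mult summable_geometric) auto
  have "(\<lambda>m. \<integral>x. ?f m x \<partial>qlaw) sums (\<integral>x. (\<Sum>m. ?f m x) \<partial>qlaw)"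
  proof (rule sums_integral[OF int])
    show "AE x in qlaw. summable (\<lambda>m. norm (?f m x))"
      using AE_qlaw_support
      by eventually_elim (rule summable_comparison_test'[OF s, of 0], use bound in auto)
    show "summable (\<lambda>m. \<integral>x. norm (?f m x) \<partial>qlaw)"
    proof (rule summable_comparison_test'[OF s, of 0])
      fix m
      have "(\<integral>x. norm (?f m x) \<partial>qlaw) \<le> (\<integral>x. \<bar>b\<bar> * (K * r ^ m) \<partial>qlaw)"
        using int AE_qlaw_support by (intro integral_mono_AE integrable_norm) (auto elim!: eventually_mono intro: bound)
      then show "norm (\<integral>x. norm (?f m x) \<partial>qlaw) \<le> \<bar>b\<bar> * (K * r ^ m)" using prob_space by simp
    qed
  qed
  moreover have "(\<integral>x. ?f m x \<partial>qlaw) = t ^ m * qherm m y / qfact m * (\<integral>x. F x * qherm m x \<partial>qlaw)" for m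
  proof -
    have "?f m x = t ^ m * qherm m y / qfact m * (F x * qherm m x)" for x by (simp add: herm_term_def)
    then show ?thesis by (simp only: integral_mult_right_zero)
  qed
  moreover have "(\<integral>x. (\<Sum>m. ?f m x) \<partial>qlaw) = (\<integral>x. F x * mehler t y x \<partial>qlaw)"
  proof (rule integral_cong_AE)
    show "(\<lambda>x. \<Sum>m. ?f m x) \<in> borel_measurable qlaw" "(\<lambda>x. F x * mehler t y x) \<in> borel_measurable qlaw"
      using term_meas by (auto intro!: borel_measurable_suminf borel_measurable_times measurable_mehler F(1))
    show "AE x in qlaw. (\<Sum>m. ?f m x) = F x * mehler t y x"
      using AE_qlaw_support
      by eventually_elim (simp add: mehler_def herm_sum_def suminf_mult summable_herm_term[OF t y])
  qed
  ultimately show ?thesis by simp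
qed

text \<open>
  The kernel acts diagonally on the q-Hermite polynomials. The cases \<open>k = 0\<close> and \<open>k = 1\<close> say that it is a
  transition density and that the regression of the next state on the present one is linear.
\<close>

lemma integral_qherm_mehler:
  assumes t: "\<bar>t\<bar> < 1" and y: "y \<in> support"
  shows "(\<integral>x. qherm k x * mehler t y x \<partial>qlaw) = t ^ k * qherm k y"
proof -
  obtain b where b: "\<And>x. x \<in> support \<Longrightarrow> \<bar>qherm k x\<bar> \<le> b" using qherm_bounded[of k] by blast
  have "(\<lambda>m. t ^ m * qherm m y / qfact m * (\<integral>x. qherm k x * qherm m x \<partial>qlaw)) sums
      (\<integral>x. qherm k x * mehler t y x \<partial>qlaw)"
    by (rule integral_mult_mehler[OF t y measurable_qherm b])
  also have "(\<lambda>m. t ^ m * qherm m y / qfact m * (\<integral>x. qherm k x * qherm m x \<partial>qlaw)) =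
      (\<lambda>m. if m = k then t ^ m * qherm m y else 0)"
    using qfact_pos[of k] by (auto simp: fun_eq_iff qherm_orthogonal)
  finally show ?thesis using sums_single[of k "\<lambda>m. t ^ m * qherm m y"] by (rule sums_unique2)
qed

text \<open>
  Only the first kernel is expanded. For polynomial \<open>F\<close> the remaining integrals are evaluated by
  \<open>integral_qherm_mehler\<close>.
\<close>

lemma integral_mehler_mehler_sums:
  fixes F :: "real \<Rightarrow> real"
  assumes t: "\<bar>t\<bar> < 1" and y: "y \<in> support" and z: "z \<in> support"
    and F: "F \<in> borel_measurable borel" "\<And>x. x \<in> support \<Longrightarrow> \<bar>F x\<bar> \<le> b"
  shows "(\<lambda>m. t ^ m * qherm m y / qfact m * (\<integral>x. F x * qherm m x * mehler t z x \<partial>qlaw)) sums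
    (\<integral>x. mehler t y x * mehler t x z * F x \<partial>qlaw)"
proof -
  obtain b' where b': "\<And>x. x \<in> support \<Longrightarrow> \<bar>mehler t z x\<bar> \<le> b'"
    using mehler_bounded[OF t] z by blast
  have sym: "mehler t z x = mehler t x z" for x unfolding mehler_def by (rule herm_sum_sym)
  have "(\<lambda>m. t ^ m * qherm m y / qfact m * (\<integral>x. (F x * mehler t z x) * qherm m x \<partial>qlaw)) sums
      (\<integral>x. (F x * mehler t z x) * mehler t y x \<partial>qlaw)"
  proof (rule integral_mult_mehler[OF t y])
    show "(\<lambda>x. F x * mehler t z x) \<in> borel_measurable borel"
      using F(1) by (intro borel_measurable_times measurable_mehler) auto
    show "\<bar>F x * mehler t z x\<bar> \<le> \<bar>b\<bar> * b'" if "x \<in> support" for x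
      unfolding abs_mult using F(2)[OF that] b'[OF that] by (intro mult_mono) auto
  qed
  then show ?thesis by (simp add: sym mult_ac)
qed

lemma integrable_qherm_mehler:
  assumes t: "\<bar>t\<bar> < 1" and z: "z \<in> support"
  shows "integrable qlaw (\<lambda>x. qherm k x * mehler t z x)"
proof -
  obtain b where b: "\<And>x. x \<in> support \<Longrightarrow> \<bar>qherm k x\<bar> \<le> b" using qherm_bounded[of k] by blast
  obtain b' where b': "\<And>x. x \<in> support \<Longrightarrow> \<bar>mehler t z x\<bar> \<le> b'"
    using mehler_bounded[OF t] z by blast
  show ?thesis
  proof (rule integrable_qlaw)
    show "(\<lambda>x. qherm k x * mehler t z x) \<in> borel_measurable borel"
      by (intro borel_measurable_times measurable_mehler measurable_qherm) auto
    show "\<bar>qherm k x * mehler t z x\<bar> \<le> \<bar>b\<bar> * b'" if "x \<in> support" for x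
      unfolding abs_mult using b[OF that] b'[OF that] by (intro mult_mono) auto
  qed
qed

lemma square_less_1: "\<bar>t\<bar> < 1 \<Longrightarrow> \<bar>t\<^sup>2\<bar> < (1::real)"
  by (simp add: abs_square_less_1)

lemma mehler_compose:
  assumes t: "\<bar>t\<bar> < 1" and y: "y \<in> support" and z: "z \<in> support"
  shows "(\<integral>x. mehler t y x * mehler t x z \<partial>qlaw) = mehler (t\<^sup>2) y z"
proof -
  have "(\<lambda>m. t ^ m * qherm m y / qfact m * (\<integral>x. 1 * qherm m x * mehler t z x \<partial>qlaw)) sums
    (\<integral>x. mehler t y x * mehler t x z * 1 \<partial>qlaw)"
    by (rule integral_mehler_mehler_sums[OF t y z, where b = 1]) auto
  then have "(\<lambda>m. herm_term (t\<^sup>2) 0 0 y z m) sums (\<integral>x. mehler t y x * mehler t x z \<partial>qlaw)"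
    by (simp add: integral_qherm_mehler[OF t z] herm_term_def power_mult_distrib power2_eq_square mult_ac)
  then show ?thesis by (simp add: sums_iff mehler_def herm_sum_def)
qed

lemma mehler_first_moment:
  assumes t: "\<bar>t\<bar> < 1" and y: "y \<in> support" and z: "z \<in> support"
  shows "(\<integral>x. mehler t y x * mehler t x z * (kap * x) \<partial>qlaw) =
    t * (herm_sum (t\<^sup>2) 0 1 y z + herm_sum (t\<^sup>2) 1 0 y z)"
proof -
  let ?I = "\<lambda>m. \<integral>x. kap * x * qherm m x * mehler t z x \<partial>qlaw"
  note s = summable_herm_term[OF square_less_1[OF t] y z]
  have 1: "(\<lambda>m. t ^ m * qherm m y / qfact m * ?I m) sums (\<integral>x. mehler t y x * mehler t x z * (kap * x) \<partial>qlaw)"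
    by (rule integral_mehler_mehler_sums[OF t y z, where b = 2]) (auto simp: support_def)
  have I: "?I m = t ^ (m + 1) * qherm (m + 1) z + (1 - q ^ m) * (t ^ (m - 1) * qherm (m - 1) z)" for m
  proof -
    have "?I m = (\<integral>x. qherm (m + 1) x * mehler t z x + (1 - q ^ m) * (qherm (m - 1) x * mehler t z x) \<partial>qlaw)"
      unfolding qherm_mult by (simp add: algebra_simps)
    then show ?thesis
      by (simp only: Bochner_Integration.integral_add integrable_mult_right integrable_qherm_mehler[OF t z]
          integral_mult_right_zero integral_qherm_mehler[OF t z])
  qed
  define g where "g m = t ^ m * qherm m y / qfact m * ((1 - q ^ m) * (t ^ (m - 1) * qherm (m - 1) z))" for m
  have "g (Suc m) = t * herm_term (t\<^sup>2) 1 0 y z m" for m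
  proof -
    have "g (Suc m) = t ^ Suc m * qherm (Suc m) y * (t ^ m * qherm m z) * ((1 - q ^ Suc m) / qfact (Suc m))"
      by (simp add: g_def del: qherm.simps power_Suc)
    then show ?thesis
      unfolding qfact_ratio by (simp add: herm_term_def power_mult_distrib power2_eq_square del: qherm.simps)
  qed
  then have "(\<lambda>m. g (Suc m)) sums (t * herm_sum (t\<^sup>2) 1 0 y z)"
    unfolding herm_sum_def by (simp only:) (intro sums_mult summable_sums s)
  then have "g sums (t * herm_sum (t\<^sup>2) 1 0 y z)"
    by (subst (asm) sums_Suc_iff) (simp add: g_def)
  then have "(\<lambda>m. t * herm_term (t\<^sup>2) 0 1 y z m + g m) sums (t * herm_sum (t\<^sup>2) 0 1 y z + t * herm_sum (t\<^sup>2) 1 0 y z)"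
    unfolding herm_sum_def by (intro sums_add sums_mult summable_sums s)
  moreover have "t * herm_term (t\<^sup>2) 0 1 y z m + g m = t ^ m * qherm m y / qfact m * ?I m" for m
    unfolding I distrib_left g_def[symmetric]
    by (simp add: herm_term_def power_mult_distrib power2_eq_square)
  ultimately have "(\<lambda>m. t ^ m * qherm m y / qfact m * ?I m) sums (t * herm_sum (t\<^sup>2) 0 1 y z + t * herm_sum (t\<^sup>2) 1 0 y z)"
    by simp
  with 1 show ?thesis by (simp add: sums_iff distrib_left)
qed

lemma mehler_second_moment:
  assumes t: "\<bar>t\<bar> < 1" and y: "y \<in> support" and z: "z \<in> support"
  shows "(\<integral>x. mehler t y x * mehler t x z * (kap * x)\<^sup>2 \<partial>qlaw) =
    t\<^sup>2 * (herm_sum (t\<^sup>2) 0 2 y z + herm_sum (t\<^sup>2) 2 0 y z) +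
    2 * mehler (t\<^sup>2) y z - (1 + q) * mehler (q * t\<^sup>2) y z"
proof -
  let ?I = "\<lambda>m. \<integral>x. (kap * x)\<^sup>2 * qherm m x * mehler t z x \<partial>qlaw"
  note s = summable_herm_term[OF square_less_1[OF t] y z]
    and s' = summable_herm_term[OF q_mult_abs_less_1[OF square_less_1[OF t]] y z]
  have 1: "(\<lambda>m. t ^ m * qherm m y / qfact m * ?I m) sums (\<integral>x. mehler t y x * mehler t x z * (kap * x)\<^sup>2 \<partial>qlaw)"
  proof (rule integral_mehler_mehler_sums[OF t y z, where b = 4])
    show "\<bar>(kap * x)\<^sup>2\<bar> \<le> 4" if "x \<in> support" for x
      using that abs_le_square_iff[of "kap * x" 2] by (simp add: support_def)
  qed simp
  have I: "?I m = t ^ (m + 2) * qherm (m + 2) z + (2 - q ^ m - q ^ Suc m) * (t ^ m * qherm m z)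
      + (1 - q ^ m) * (1 - q ^ (m - 1)) * (t ^ (m - 2) * qherm (m - 2) z)" for m
  proof -
    have "(kap * x)\<^sup>2 * qherm m x = qherm (m + 2) x + (2 - q ^ m - q ^ Suc m) * qherm m x
       + (1 - q ^ m) * (1 - q ^ (m - 1)) * qherm (m - 2) x" for x
    proof -
      have "(kap * x)\<^sup>2 * qherm m x = kap * x * qherm (m + 1) x + (1 - q ^ m) * (kap * x * qherm (m - 1) x)"
      proof -
        have "(kap * x)\<^sup>2 * qherm m x = kap * x * (kap * x * qherm m x)" by (simp add: power2_eq_square)
        also have "\<dots> = kap * x * (qherm (m + 1) x + (1 - q ^ m) * qherm (m - 1) x)" by (simp only: qherm_mult)
        finally show ?thesis by (simp add: algebra_simps)
      qed
      also have "\<dots> = qherm (m + 2) x + (1 - q ^ Suc m) * qherm m x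
         + (1 - q ^ m) * (qherm (m - 1 + 1) x + (1 - q ^ (m - 1)) * qherm (m - 2) x)"
        using qherm_mult[of x "m + 1"] qherm_mult[of x "m - 1"]
        by (simp add: numeral_2_eq_2 del: qherm.simps)
      also have "(1 - q ^ m) * (qherm (m - 1 + 1) x + (1 - q ^ (m - 1)) * qherm (m - 2) x) =
         (1 - q ^ m) * (qherm m x + (1 - q ^ (m - 1)) * qherm (m - 2) x)"
        by (cases m) auto
      finally show ?thesis by (simp add: algebra_simps)
    qed
    then have "?I m = (\<integral>x. qherm (m + 2) x * mehler t z x + (2 - q ^ m - q ^ Suc m) * (qherm m x * mehler t z x)
        + (1 - q ^ m) * (1 - q ^ (m - 1)) * (qherm (m - 2) x * mehler t z x) \<partial>qlaw)"
      by (simp only: distrib_right mult.assoc)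
    then show ?thesis
      by (simp only: Bochner_Integration.integral_add Bochner_Integration.integrable_add integrable_mult_right integrable_qherm_mehler[OF t z]
          integral_mult_right_zero integral_qherm_mehler[OF t z])
  qed
  define g where "g m = t ^ m * qherm m y / qfact m * ((1 - q ^ m) * (1 - q ^ (m - 1)) * (t ^ (m - 2) * qherm (m - 2) z))" for m
  have "g (Suc (Suc m)) = t\<^sup>2 * herm_term (t\<^sup>2) 2 0 y z m" for m
  proof -
    have "g (Suc (Suc m)) = t ^ Suc (Suc m) * qherm (Suc (Suc m)) y * (t ^ m * qherm m z) *
        ((1 - q ^ Suc (Suc m)) / qfact (Suc (Suc m)) * (1 - q ^ Suc m))"
      by (simp add: g_def del: qherm.simps power_Suc)
    also have "(1 - q ^ Suc (Suc m)) / qfact (Suc (Suc m)) * (1 - q ^ Suc m) = 1 / qfact m"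
      unfolding qfact_ratio[of "Suc m"] using qfact_ratio[of m] by simp
    finally show ?thesis
      by (simp add: herm_term_def power_mult_distrib power2_eq_square numeral_2_eq_2 del: qherm.simps)
  qed
  then have "(\<lambda>m. g (Suc (Suc m))) sums (t\<^sup>2 * herm_sum (t\<^sup>2) 2 0 y z)"
    unfolding herm_sum_def by (simp only:) (intro sums_mult summable_sums s)
  then have "(\<lambda>m. g (Suc m)) sums (t\<^sup>2 * herm_sum (t\<^sup>2) 2 0 y z)"
    by (subst (asm) sums_Suc_iff[of "\<lambda>m. g (Suc m)"]) (simp add: g_def)
  then have "g sums (t\<^sup>2 * herm_sum (t\<^sup>2) 2 0 y z)"
    by (subst (asm) sums_Suc_iff) (simp add: g_def)
  then have "(\<lambda>m. t\<^sup>2 * herm_term (t\<^sup>2) 0 2 y z m + (2 * herm_term (t\<^sup>2) 0 0 y z m - (1 + q) * herm_term (q * t\<^sup>2) 0 0 y z m) + g m)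
     sums (t\<^sup>2 * herm_sum (t\<^sup>2) 0 2 y z + (2 * mehler (t\<^sup>2) y z - (1 + q) * mehler (q * t\<^sup>2) y z) + t\<^sup>2 * herm_sum (t\<^sup>2) 2 0 y z)"
    unfolding herm_sum_def mehler_def by (intro sums_add sums_diff sums_mult summable_sums s s')
  moreover have "t\<^sup>2 * herm_term (t\<^sup>2) 0 2 y z m + (2 * herm_term (t\<^sup>2) 0 0 y z m - (1 + q) * herm_term (q * t\<^sup>2) 0 0 y z m) + g m
     = t ^ m * qherm m y / qfact m * ?I m" for m
  proof -
    have "t ^ m * qherm m y / qfact m * (t ^ (m + 2) * qherm (m + 2) z) = t\<^sup>2 * herm_term (t\<^sup>2) 0 2 y z m"
      by (simp add: herm_term_def power_mult_distrib power2_eq_square del: qherm.simps)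
    moreover have "t ^ m * qherm m y / qfact m * ((2 - q ^ m - q ^ Suc m) * (t ^ m * qherm m z)) =
        2 * herm_term (t\<^sup>2) 0 0 y z m - (1 + q) * herm_term (q * t\<^sup>2) 0 0 y z m"
      by (simp add: herm_term_def power_mult_distrib power2_eq_square diff_divide_distrib add_divide_distrib algebra_simps)
    ultimately show ?thesis unfolding I distrib_left g_def[symmetric] by simp
  qed
  ultimately have "(\<lambda>m. t ^ m * qherm m y / qfact m * ?I m) sums (t\<^sup>2 * herm_sum (t\<^sup>2) 0 2 y z + (2 * mehler (t\<^sup>2) y z - (1 + q) * mehler (q * t\<^sup>2) y z) + t\<^sup>2 * herm_sum (t\<^sup>2) 2 0 y z)"
    by simp
  with 1 show ?thesis by (simp add: sums_iff algebra_simps)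
qed

text \<open>
  The sums in \<open>mehler_first_moment\<close> are recovered from the expansions of \<open>kap * y\<close> and \<open>kap * z\<close> times the
  two-step kernel.
\<close>

lemma mehler_regression:
  assumes t: "\<bar>t\<bar> < 1" and y: "y \<in> support" and z: "z \<in> support"
  shows "(\<integral>x. mehler t y x * mehler t x z * (kap * x) \<partial>qlaw) =
    t / (1 + t\<^sup>2) * (kap * y + kap * z) * mehler (t\<^sup>2) y z"
proof -
  note t2 = square_less_1[OF t]
  define S10 S01 where "S10 = herm_sum (t\<^sup>2) 1 0 y z" and "S01 = herm_sum (t\<^sup>2) 0 1 y z"
  have 1: "kap * y * mehler (t\<^sup>2) y z = S10 + t\<^sup>2 * S01"
    using herm_sum_raise[OF t2 y z, of 0] by (simp add: mehler_def S10_def S01_def)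
  have 2: "kap * z * mehler (t\<^sup>2) y z = S01 + t\<^sup>2 * S10"
    using herm_sum_raise[OF t2 z y, of 0] unfolding herm_sum_sym[of _ _ _ z y]
    by (simp add: mehler_def S10_def S01_def)
  have "0 < 1 + t\<^sup>2" by (simp add: add_pos_nonneg)
  have "(kap * y + kap * z) * mehler (t\<^sup>2) y z = (1 + t\<^sup>2) * (S10 + S01)"
    unfolding distrib_right 1 2 by algebra
  then have "t / (1 + t\<^sup>2) * ((kap * y + kap * z) * mehler (t\<^sup>2) y z) = t * (S10 + S01)"
    using \<open>0 < 1 + t\<^sup>2\<close> by simp
  then show ?thesis
    unfolding mehler_first_moment[OF assms] S10_def S01_def by (simp add: mult_ac add.commute)
qed

text \<open>
  The products of the two-step kernel with \<open>y\<^sup>2\<close>, \<open>z\<^sup>2\<close> and \<open>y * z\<close> are all combinations of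
  \<open>S20 + t ^ 4 * S02\<close> and its mirror image, of \<open>S20 + S02\<close>, of the kernel \<open>G\<close> at \<open>t\<^sup>2\<close> and of the kernel
  \<open>W\<close> at \<open>q * t\<^sup>2\<close>. The two hypotheses on \<open>A\<close> and \<open>B\<close> match the coefficients of \<open>S20 + S02\<close> and of \<open>W\<close>
  with those of the second moment; the coefficient of \<open>G\<close> determines the constant term.
\<close>

lemma mehler_quadratic_regression:
  assumes t: "\<bar>t\<bar> < 1" "t \<noteq> 0" and y: "y \<in> support" and z: "z \<in> support"
    and A: "A * (1 + t ^ 4) + B * t\<^sup>2 = t\<^sup>2"
    and B: "2 * A * (1 + q) + B * (1 / t\<^sup>2 + q * t\<^sup>2) = 1 + q"
  shows "(\<integral>x. mehler t y x * mehler t x z * (kap * x)\<^sup>2 \<partial>qlaw) =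
    (A * ((kap * y)\<^sup>2 + (kap * z)\<^sup>2) + B * (kap * y) * (kap * z)
      + (2 - 4 * A - B * (1 / t\<^sup>2 + t\<^sup>2))) * mehler (t\<^sup>2) y z"
proof -
  define s where "s = t\<^sup>2"
  have s: "\<bar>s\<bar> < 1" "0 < s" using square_less_1[OF t(1)] t(2) by (auto simp: s_def)
  define G W S10 S01 S11 S20 S02 where "G = herm_sum s 0 0 y z" and "W = herm_sum (q * s) 0 0 y z"
    and "S10 = herm_sum s 1 0 y z" and "S01 = herm_sum s 0 1 y z" and "S11 = herm_sum s 1 1 y z"
    and "S20 = herm_sum s 2 0 y z" and "S02 = herm_sum s 0 2 y z"
  note defs = G_def W_def S10_def S01_def S11_def S20_def S02_def numeral_2_eq_2
  note sym = herm_sum_sym[of _ _ _ z y]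
  define u v where "u = kap * y" and "v = kap * z"
  have e1: "u * G = S10 + s * S01" using herm_sum_raise[OF s(1) y z, of 0] by (simp add: defs u_def)
  have e2: "v * G = S01 + s * S10" using herm_sum_raise[OF s(1) z y, of 0] unfolding sym by (simp add: defs v_def)
  have e3: "u * S01 = S11 + s * S02" using herm_sum_raise[OF s(1) y z, of 1] by (simp add: defs u_def)
  have e4: "v * S10 = S11 + s * S20" using herm_sum_raise[OF s(1) z y, of 1] unfolding sym by (simp add: defs v_def)
  have e5: "u * S10 = S20 + G - q * W" using herm_sum_raise_2[OF s(1) y z, of 0] by (simp add: defs u_def)
  have e6: "v * S01 = S02 + G - q * W" using herm_sum_raise_2[OF s(1) z y, of 0] unfolding sym by (simp add: defs v_def)
  have e7: "s * S11 = G - W" using herm_sum_diag[OF s(1) y z] by (simp add: defs)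
  have e7': "S11 = (1 / s) * (G - W)" using e7 s(2) by (simp add: field_simps)
  define inv_s where "inv_s = 1 / s"
  have uu: "u\<^sup>2 * G = S20 + s\<^sup>2 * S02 + 2 * G - (1 + q) * W" using e1 e3 e5 e7 by algebra
  have vv: "v\<^sup>2 * G = S02 + s\<^sup>2 * S20 + 2 * G - (1 + q) * W" using e2 e4 e6 e7 by algebra
  have uv: "u * v * G = inv_s * (G - W) + s * (S20 + S02) + s * (G - q * W)"
    using e1 e4 e6 e7'[folded inv_s_def] by algebra
  have A': "A * (1 + s\<^sup>2) + B * s = s" using A by (simp add: s_def flip: power_mult)
  have B': "2 * A * (1 + q) + B * (inv_s + q * s) = 1 + q" using B by (simp add: s_def inv_s_def)
  have "(A * (u\<^sup>2 + v\<^sup>2) + B * u * v + (2 - 4 * A - B * (inv_s + s))) * G =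
      A * (u\<^sup>2 * G) + A * (v\<^sup>2 * G) + B * (u * v * G) + (2 - 4 * A - B * (inv_s + s)) * G" by algebra
  also have "\<dots> = (A * (1 + s\<^sup>2) + B * s) * (S20 + S02) + 2 * G - (2 * A * (1 + q) + B * (inv_s + q * s)) * W"
    unfolding uu vv uv by algebra
  also have "\<dots> = s * (S02 + S20) + 2 * G - (1 + q) * W" unfolding A' B' by algebra
  finally show ?thesis
    unfolding mehler_second_moment[OF t(1) y z] unfolding s_def[symmetric] mehler_def
    by (simp add: G_def W_def S20_def S02_def u_def v_def inv_s_def)
qed

end

context q_parameter
begin

text \<open>
  Off the support the series need not converge. Clamping the arguments gives a density that is
  nonnegative and normalised for all real states.
\<close>

definition clamp_support :: "real \<Rightarrow> real" where
  "clamp_support x = max (- (2 / kap)) (min (2 / kap) x)"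

lemma support_eq: "support = {- (2 / kap)..2 / kap}"
  using kap_pos unfolding support_def by (auto simp: abs_le_iff field_simps)

lemma clamp_support_in: "clamp_support x \<in> support"
  using kap_pos by (auto simp: support_eq clamp_support_def)

lemma clamp_support_id: "x \<in> support \<Longrightarrow> clamp_support x = x"
  by (auto simp: support_eq clamp_support_def)

lemma measurable_clamp_support [measurable]: "clamp_support \<in> borel_measurable borel"
  unfolding clamp_support_def by measurable

definition qkernel :: "real \<Rightarrow> real \<Rightarrow> real \<Rightarrow> real" where
  "qkernel t x y = mehler t (clamp_support x) (clamp_support y)"

lemma qkernel_eq_mehler: "x \<in> support \<Longrightarrow> y \<in> support \<Longrightarrow> qkernel t x y = mehler t x y"
  by (simp add: qkernel_def clamp_support_id)

lemma integral_qkernel: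
  assumes y: "y \<in> support" and F: "F \<in> borel_measurable borel"
  shows "(\<integral>x. qkernel t y x * F x \<partial>qlaw) = (\<integral>x. F x * mehler t y x \<partial>qlaw)"
proof (rule integral_cong_AE)
  show "(\<lambda>x. qkernel t y x * F x) \<in> borel_measurable qlaw" "(\<lambda>x. F x * mehler t y x) \<in> borel_measurable qlaw"
    unfolding qkernel_def using F by (auto intro!: borel_measurable_times measurable_mehler)
  show "AE x in qlaw. qkernel t y x * F x = F x * mehler t y x"
    using AE_qlaw_support by eventually_elim (simp add: qkernel_eq_mehler y)
qed

lemma integral_qkernel_qkernel:
  assumes y: "y \<in> support" and z: "z \<in> support" and F: "F \<in> borel_measurable borel"
  shows "(\<integral>x. qkernel t y x * qkernel t x z * F x \<partial>qlaw) = (\<integral>x. mehler t y x * mehler t x z * F x \<partial>qlaw)"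
proof (rule integral_cong_AE)
  show "(\<lambda>x. qkernel t y x * qkernel t x z * F x) \<in> borel_measurable qlaw"
    "(\<lambda>x. mehler t y x * mehler t x z * F x) \<in> borel_measurable qlaw"
    unfolding qkernel_def using F by (auto intro!: borel_measurable_times measurable_mehler)
  show "AE x in qlaw. qkernel t y x * qkernel t x z * F x = mehler t y x * mehler t x z * F x"
    using AE_qlaw_support by eventually_elim (simp add: qkernel_eq_mehler y z)
qed

lemma stationary_kernel_qkernel:
  assumes t: "\<bar>t\<bar> < 1" shows "stationary_kernel qlaw (qkernel t)"
proof (intro stationary_kernel.intro stationary_kernel_axioms.intro)
  show "prob_space qlaw" by (rule prob_space_qlaw)
  show "sets qlaw = sets borel" by simp
  show "(\<lambda>(x, y). qkernel t x y) \<in> borel_measurable (borel \<Otimes>\<^sub>M borel)"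
    unfolding qkernel_def case_prod_beta by (intro measurable_mehler) measurable
  show "0 \<le> qkernel t x y" for x y
    unfolding qkernel_def by (intro less_imp_le mehler_pos t clamp_support_in)
  show "qkernel t x y = qkernel t y x" for x y
    unfolding qkernel_def mehler_def by (rule herm_sum_sym)
  show "(\<integral>\<^sup>+y. ennreal (qkernel t x y) \<partial>qlaw) = 1" for x
  proof -
    let ?c = "clamp_support x"
    have "(\<integral>\<^sup>+y. ennreal (qkernel t x y) \<partial>qlaw) = (\<integral>\<^sup>+y. ennreal (mehler t ?c y) \<partial>qlaw)"
      using AE_qlaw_support
      by (intro nn_integral_cong_AE) (auto elim!: eventually_mono simp: qkernel_def clamp_support_id)
    also have "\<dots> = ennreal (\<integral>y. mehler t ?c y \<partial>qlaw)"
    proof (rule nn_integral_eq_integral)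
      show "integrable qlaw (mehler t ?c)"
        using integrable_qherm_mehler[OF t clamp_support_in, of 0 x] by simp
      show "AE y in qlaw. 0 \<le> mehler t ?c y"
        using AE_qlaw_support
        by eventually_elim (intro less_imp_le mehler_pos t clamp_support_in)
    qed
    also have "(\<integral>y. mehler t ?c y \<partial>qlaw) = 1"
      using integral_qherm_mehler[OF t clamp_support_in, of 0 x] by simp
    finally show ?thesis by simp
  qed
qed

lemma qlaw_moments: "integrable qlaw (\<lambda>x. x\<^sup>2)" "(\<integral>x. x \<partial>qlaw) = 0" "(\<integral>x. x\<^sup>2 \<partial>qlaw) = 1"
proof -
  show "integrable qlaw (\<lambda>x. x\<^sup>2)" by (intro integrable_qlaw_continuous continuous_intros)
  have "kap * (\<integral>x. x \<partial>qlaw) = 0" using integral_qherm[of 1] by simp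
  then show "(\<integral>x. x \<partial>qlaw) = 0" using kap_pos by simp
  have "(kap\<^sup>2) * (\<integral>x. x\<^sup>2 \<partial>qlaw) = (\<integral>x. qherm 1 x * qherm 1 x \<partial>qlaw)"
    by (simp add: power2_eq_square mult_ac flip: integral_mult_right_zero)
  also have "\<dots> = kap\<^sup>2" by (simp only: qherm_orthogonal) (simp add: kap_sq qfact_def)
  finally show "(\<integral>x. x\<^sup>2 \<partial>qlaw) = 1" using kap_pos by simp
qed

lemma q_chain_exists:
  assumes t: "\<rho>\<^sup>2 < 1" "\<rho> \<noteq> 0"
    and A: "A * (1 + \<rho> ^ 4) + B * \<rho>\<^sup>2 = \<rho>\<^sup>2"
    and B: "2 * A * (1 + q) + B * (1 / \<rho>\<^sup>2 + q * \<rho>\<^sup>2) = 1 + q"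
  shows "\<exists>(M :: (int \<Rightarrow> real) measure) X. quadratic_regression_chain M X \<rho> (\<rho> / (1 + \<rho>\<^sup>2)) A B
    ((2 - 4 * A - B * (1 / \<rho>\<^sup>2 + \<rho>\<^sup>2)) / kap\<^sup>2)"
proof (rule quadratic_chain_exists[OF stationary_kernel_qkernel t(1) AE_qlaw_support qlaw_moments])
  show r: "\<bar>\<rho>\<bar> < 1" using t by (simp add: abs_square_less_1)
  fix y assume y: "y \<in> support"
  have "kap * (\<integral>x. qkernel \<rho> y x * x \<partial>qlaw) = kap * (\<integral>x. x * mehler \<rho> y x \<partial>qlaw)"
    by (subst integral_qkernel[OF y]) auto
  also have "\<dots> = \<rho> * (kap * y)"
    using integral_qherm_mehler[OF r y, of 1] by (simp add: mult.assoc)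
  finally show "(\<integral>x. qkernel \<rho> y x * x \<partial>qlaw) = \<rho> * y" using kap_pos by simp
  fix z assume z: "z \<in> support"
  have base: "(\<integral>x. qkernel \<rho> y x * qkernel \<rho> x z \<partial>qlaw) = mehler (\<rho>\<^sup>2) y z"
    using integral_qkernel_qkernel[OF y z, of "\<lambda>_. 1" \<rho>] mehler_compose[OF r y z] by simp
  have "kap * (\<integral>x. qkernel \<rho> y x * qkernel \<rho> x z * x \<partial>qlaw) =
      (\<integral>x. mehler \<rho> y x * mehler \<rho> x z * (kap * x) \<partial>qlaw)"
    by (subst integral_qkernel_qkernel[OF y z]) (simp_all add: mult.left_commute flip: integral_mult_right_zero)
  also have "\<dots> = kap * (\<rho> / (1 + \<rho>\<^sup>2) * (y + z) * mehler (\<rho>\<^sup>2) y z)"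
    unfolding mehler_regression[OF r y z] by (simp add: algebra_simps)
  finally have "kap * (\<integral>x. qkernel \<rho> y x * qkernel \<rho> x z * x \<partial>qlaw) =
      kap * (\<rho> / (1 + \<rho>\<^sup>2) * (y + z) * mehler (\<rho>\<^sup>2) y z)" .
  moreover have "kap \<noteq> 0" using kap_pos by simp
  ultimately show "(\<integral>x. qkernel \<rho> y x * qkernel \<rho> x z * x \<partial>qlaw) =
      \<rho> / (1 + \<rho>\<^sup>2) * (y + z) * (\<integral>x. qkernel \<rho> y x * qkernel \<rho> x z \<partial>qlaw)"
    unfolding base by (rule mult_left_cancel[THEN iffD1, rotated])
  let ?C = "2 - 4 * A - B * (1 / \<rho>\<^sup>2 + \<rho>\<^sup>2)"
  have "kap\<^sup>2 * (\<integral>x. qkernel \<rho> y x * qkernel \<rho> x z * x\<^sup>2 \<partial>qlaw) =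
      (\<integral>x. mehler \<rho> y x * mehler \<rho> x z * (kap * x)\<^sup>2 \<partial>qlaw)"
    by (subst integral_qkernel_qkernel[OF y z])
       (simp_all add: mult.left_commute power_mult_distrib flip: integral_mult_right_zero)
  also have "\<dots> = (kap\<^sup>2 * (A * (y\<^sup>2 + z\<^sup>2) + B * y * z) + ?C) * mehler (\<rho>\<^sup>2) y z"
    unfolding mehler_quadratic_regression[OF r t(2) y z A B]
    by (simp add: power_mult_distrib) (simp add: power2_eq_square algebra_simps)
  also have "\<dots> = kap\<^sup>2 * ((A * (y\<^sup>2 + z\<^sup>2) + B * y * z + ?C / kap\<^sup>2) * mehler (\<rho>\<^sup>2) y z)"
    using kap_pos by (simp add: distrib_left distrib_right)
  finally show "(\<integral>x. qkernel \<rho> y x * qkernel \<rho> x z * x\<^sup>2 \<partial>qlaw) =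
      (A * (y\<^sup>2 + z\<^sup>2) + B * y * z + ?C / kap\<^sup>2) * (\<integral>x. qkernel \<rho> y x * qkernel \<rho> x z \<partial>qlaw)"
    unfolding base using kap_pos by simp
qed

end

section \<open>The two-valued chain\<close>

definition sign_law :: "real measure" where
  "sign_law = distr (measure_pmf (pmf_of_set {-1, 1})) borel (\<lambda>x. x)"

lemma sets_sign_law [simp]: "sets sign_law = sets borel"
  by (simp add: sign_law_def)

lemma prob_space_sign_law: "prob_space sign_law"
  unfolding sign_law_def by (rule measure_pmf.prob_space_distr) simp

lemma nn_integral_sign_law:
  assumes "f \<in> borel_measurable borel"
  shows "(\<integral>\<^sup>+x. f x \<partial>sign_law) = (f (-1) + f 1) / 2"
  unfolding sign_law_def using assms
  by (simp add: nn_integral_distr nn_integral_pmf_of_set)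

lemma integral_sign_law:
  fixes f :: "real \<Rightarrow> real"
  assumes "f \<in> borel_measurable borel"
  shows "(\<integral>x. f x \<partial>sign_law) = (f (-1) + f 1) / 2"
  unfolding sign_law_def using assms
  by (simp add: integral_distr integral_pmf_of_set)

definition sign_kernel :: "real \<Rightarrow> real \<Rightarrow> real \<Rightarrow> real" where
  "sign_kernel \<rho> x y = 1 + \<rho> * (max (-1) (min 1 x) * max (-1) (min 1 y))"

lemma stationary_kernel_sign:
  assumes "\<rho>\<^sup>2 < 1" shows "stationary_kernel sign_law (sign_kernel \<rho>)"
proof (intro stationary_kernel.intro stationary_kernel_axioms.intro)
  show "prob_space sign_law" by (rule prob_space_sign_law)
  show "(\<lambda>(x, y). sign_kernel \<rho> x y) \<in> borel_measurable (borel \<Otimes>\<^sub>M borel)"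
    unfolding sign_kernel_def by measurable
  have r: "\<bar>\<rho>\<bar> < 1" using assms by (simp add: abs_square_less_1)
  show pos: "0 \<le> sign_kernel \<rho> x y" for x y
  proof -
    let ?u = "max (-1) (min 1 x)" and ?v = "max (-1) (min 1 y)"
    have "\<bar>?u\<bar> \<le> 1" "\<bar>?v\<bar> \<le> 1" by auto
    then have "\<bar>?u\<bar> * \<bar>?v\<bar> \<le> 1 * 1" by (intro mult_mono) auto
    then have "\<bar>\<rho>\<bar> * \<bar>?u * ?v\<bar> \<le> \<bar>\<rho>\<bar> * 1" by (intro mult_left_mono) (auto simp: abs_mult)
    then have "\<bar>\<rho> * (?u * ?v)\<bar> < 1" using r by (simp add: abs_mult)
    then show ?thesis unfolding sign_kernel_def by linarith
  qed
  show "sign_kernel \<rho> x y = sign_kernel \<rho> y x" for x y by (simp add: sign_kernel_def mult.commute)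
  show "(\<integral>\<^sup>+y. ennreal (sign_kernel \<rho> x y) \<partial>sign_law) = 1" for x
  proof -
    have "(\<integral>\<^sup>+y. ennreal (sign_kernel \<rho> x y) \<partial>sign_law) = (ennreal (sign_kernel \<rho> x (-1)) + ennreal (sign_kernel \<rho> x 1)) / 2"
      by (rule nn_integral_sign_law) (simp add: sign_kernel_def)
    also have "ennreal (sign_kernel \<rho> x (-1)) + ennreal (sign_kernel \<rho> x 1) = ennreal (sign_kernel \<rho> x (-1) + sign_kernel \<rho> x 1)"
      using pos by (intro ennreal_plus[symmetric])
    also have "sign_kernel \<rho> x (-1) + sign_kernel \<rho> x 1 = 2" by (simp add: sign_kernel_def)
    finally show ?thesis by simp
  qed
qed simp

text \<open>
  The squares are constant here, so \<open>A\<close> is arbitrary and \<open>B\<close> has to vanish.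
\<close>

lemma sign_chain_exists:
  assumes t: "\<rho>\<^sup>2 < 1"
  shows "\<exists>(M :: (int \<Rightarrow> real) measure) X. quadratic_regression_chain M X \<rho> (\<rho> / (1 + \<rho>\<^sup>2)) A 0 (1 - 2 * A)"
proof (rule quadratic_chain_exists[OF stationary_kernel_sign t, where S = "{-1, 1}"])
  show "\<rho>\<^sup>2 < 1" by fact
  show "AE x in sign_law. x \<in> {-1, 1}"
    unfolding sign_law_def by (subst AE_distr_iff) (auto simp: AE_measure_pmf_iff)
  have fin: "integrable sign_law f" if "f \<in> borel_measurable borel" for f :: "real \<Rightarrow> real"
    unfolding sign_law_def using that by (subst integrable_distr_eq) (auto intro!: integrable_measure_pmf_finite)
  show "integrable sign_law (\<lambda>x. x\<^sup>2)" by (rule fin) simp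
  show "(\<integral>x. x \<partial>sign_law) = 0" "(\<integral>x. x\<^sup>2 \<partial>sign_law) = 1" by (subst integral_sign_law; simp)+
  have m: "(\<lambda>x. sign_kernel \<rho> y x * sign_kernel \<rho> x z * f x) \<in> borel_measurable borel"
    "(\<lambda>x. sign_kernel \<rho> y x * f x) \<in> borel_measurable borel"
    "(\<lambda>x. sign_kernel \<rho> y x * sign_kernel \<rho> x z) \<in> borel_measurable borel"
    if [measurable]: "f \<in> borel_measurable borel" for f y z
    unfolding sign_kernel_def by measurable
  show "(\<integral>y. sign_kernel \<rho> x y * y \<partial>sign_law) = \<rho> * x" if "x \<in> {-1, 1}" for x
    using that by (subst integral_sign_law[OF m(2)]) (auto simp: sign_kernel_def)
  have nz: "1 + \<rho>\<^sup>2 \<noteq> 0" using zero_le_power2[of \<rho>] by linarith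
  show "(\<integral>x. sign_kernel \<rho> y x * sign_kernel \<rho> x z * x \<partial>sign_law) =
     \<rho> / (1 + \<rho>\<^sup>2) * (y + z) * (\<integral>x. sign_kernel \<rho> y x * sign_kernel \<rho> x z \<partial>sign_law)"
    if "y \<in> {-1, 1}" "z \<in> {-1, 1}" for y z
    using that nz
    by (subst integral_sign_law[OF m(1)], simp, subst integral_sign_law[OF m(3)[where f = "\<lambda>x. x"]], simp)
       (auto simp: sign_kernel_def field_simps power2_eq_square)
  show "(\<integral>x. sign_kernel \<rho> y x * sign_kernel \<rho> x z * x\<^sup>2 \<partial>sign_law) =
     (A * (y\<^sup>2 + z\<^sup>2) + 0 * y * z + (1 - 2 * A)) * (\<integral>x. sign_kernel \<rho> y x * sign_kernel \<rho> x z \<partial>sign_law)"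
    if "y \<in> {-1, 1}" "z \<in> {-1, 1}" for y z
    using that
    by (subst integral_sign_law[OF m(1)], simp, subst integral_sign_law[OF m(3)[where f = "\<lambda>x. x"]], simp) auto
qed

section \<open>The Gaussian chain\<close>

abbreviation gauss_law :: "real measure" where
  "gauss_law \<equiv> density lborel std_normal_density"

text \<open>
  The classical Mehler kernel in closed form: the density of \<open>N(\<rho> x, 1 - \<rho>\<^sup>2)\<close> relative to \<open>N(0, 1)\<close>.
\<close>

definition gauss_kernel :: "real \<Rightarrow> real \<Rightarrow> real \<Rightarrow> real" where
  "gauss_kernel \<rho> x y =
    exp (- (\<rho>\<^sup>2 * x\<^sup>2 - 2 * \<rho> * x * y + \<rho>\<^sup>2 * y\<^sup>2) / (2 * (1 - \<rho>\<^sup>2))) / sqrt (1 - \<rho>\<^sup>2)"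

lemma integral_gauss_law:
  fixes f :: "real \<Rightarrow> real"
  assumes "f \<in> borel_measurable borel"
  shows "(\<integral>x. f x \<partial>gauss_law) = (\<integral>x. std_normal_density x * f x \<partial>lborel)"
  by (rule integral_real_density) (use assms normal_density_nonneg in auto)

lemma gauss_kernel_transition:
  assumes "\<rho>\<^sup>2 < 1"
  shows "std_normal_density y * gauss_kernel \<rho> x y = normal_density (\<rho> * x) (sqrt (1 - \<rho>\<^sup>2)) y"
proof -
  define v where "v = 1 - \<rho>\<^sup>2"
  have v: "0 < v" "\<rho>\<^sup>2 = 1 - v" using assms by (auto simp: v_def)
  have "- y\<^sup>2 / 2 + - (\<rho>\<^sup>2 * x\<^sup>2 - 2 * \<rho> * x * y + \<rho>\<^sup>2 * y\<^sup>2) / (2 * v) = - (y - \<rho> * x)\<^sup>2 / (2 * v)"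
    using v(1) by (simp add: field_simps power2_diff power_mult_distrib v(2))
  then have "exp (- y\<^sup>2 / 2) * exp (- (\<rho>\<^sup>2 * x\<^sup>2 - 2 * \<rho> * x * y + \<rho>\<^sup>2 * y\<^sup>2) / (2 * v)) = exp (- (y - \<rho> * x)\<^sup>2 / (2 * v))"
    by (simp add: exp_add[symmetric])
  then have "1 / sqrt (2 * pi) * exp (- y\<^sup>2 / 2) * (exp (- (\<rho>\<^sup>2 * x\<^sup>2 - 2 * \<rho> * x * y + \<rho>\<^sup>2 * y\<^sup>2) / (2 * v)) / sqrt v)
      = 1 / (sqrt (2 * pi) * sqrt v) * exp (- (y - \<rho> * x)\<^sup>2 / (2 * v))"
    by (simp add: mult.assoc)
  then show ?thesis
    using v(1) by (simp add: gauss_kernel_def std_normal_density_def normal_density_def v_def[symmetric] real_sqrt_mult)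
qed

text \<open>
  Completing the square shows that a state is Gaussian given its two neighbours. The constant \<open>D\<close>
  is the value of the two-step kernel and cancels from the regressions.
\<close>

lemma gauss_kernel_bridge:
  assumes "\<rho>\<^sup>2 < 1"
  shows "\<exists>D. \<forall>x. std_normal_density x * (gauss_kernel \<rho> y x * gauss_kernel \<rho> x z) =
    D * normal_density (\<rho> / (1 + \<rho>\<^sup>2) * (y + z)) (sqrt ((1 - \<rho>\<^sup>2) / (1 + \<rho>\<^sup>2))) x"
proof -
  define v w where "v = 1 - \<rho>\<^sup>2" and "w = 1 + \<rho>\<^sup>2"
  have v: "0 < v" "v = 1 - \<rho>\<^sup>2" using assms by (auto simp: v_def)
  have w: "0 < w" "w = 1 + \<rho>\<^sup>2" by (auto simp: w_def add_pos_nonneg)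
  define m where "m = \<rho> / w * (y + z)"
  define E where "E = - (\<rho>\<^sup>2 * (y\<^sup>2 + z\<^sup>2)) / (2 * v) + w * m\<^sup>2 / (2 * v)"
  define N where "N = sqrt (2 * pi * (v / w))"
  have N: "N \<noteq> 0" using v w by (simp add: N_def)
  have wm: "w * m = \<rho> * (y + z)" using w(1) by (simp add: m_def)
  have exponent: "- x\<^sup>2 / 2 + (- (\<rho>\<^sup>2 * y\<^sup>2 - 2 * \<rho> * y * x + \<rho>\<^sup>2 * x\<^sup>2) / (2 * v)
      + - (\<rho>\<^sup>2 * x\<^sup>2 - 2 * \<rho> * x * z + \<rho>\<^sup>2 * z\<^sup>2) / (2 * v)) = E + - (x - m)\<^sup>2 / (2 * (v / w))" for x
  proof -
    have "- (x - m)\<^sup>2 / (2 * (v / w)) = - (w * x\<^sup>2 - 2 * (w * m) * x + w * m\<^sup>2) / (2 * v)"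
      using v(1) w(1) by (simp add: field_simps power2_diff)
    moreover have "- x\<^sup>2 / 2 = - (v * x\<^sup>2) / (2 * v)" using v(1) by simp
    ultimately show ?thesis
      unfolding E_def wm by (simp only: add_divide_distrib[symmetric]) (simp add: v(2) w(2) algebra_simps)
  qed
  have "std_normal_density x * (gauss_kernel \<rho> y x * gauss_kernel \<rho> x z) =
    (exp E * N / (sqrt (2 * pi) * sqrt v * sqrt v)) * normal_density m (sqrt (v / w)) x" for x
  proof -
    have "std_normal_density x * (gauss_kernel \<rho> y x * gauss_kernel \<rho> x z) =
      exp (- x\<^sup>2 / 2 + (- (\<rho>\<^sup>2 * y\<^sup>2 - 2 * \<rho> * y * x + \<rho>\<^sup>2 * x\<^sup>2) / (2 * v)
      + - (\<rho>\<^sup>2 * x\<^sup>2 - 2 * \<rho> * x * z + \<rho>\<^sup>2 * z\<^sup>2) / (2 * v))) / (sqrt (2 * pi) * sqrt v * sqrt v)"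
      unfolding exp_add by (simp add: std_normal_density_def gauss_kernel_def v_def[symmetric])
    also have "\<dots> = exp E * exp (- (x - m)\<^sup>2 / (2 * (v / w))) / (sqrt (2 * pi) * sqrt v * sqrt v)"
      unfolding exponent exp_add ..
    also have "exp (- (x - m)\<^sup>2 / (2 * (v / w))) = N * normal_density m (sqrt (v / w)) x"
    proof -
      have "(sqrt (v / w))\<^sup>2 = v / w" using v(1) w(1) by simp
      then have "normal_density m (sqrt (v / w)) x = 1 / N * exp (- (x - m)\<^sup>2 / (2 * (v / w)))"
        by (simp only: normal_density_def N_def)
      then show ?thesis using N by simp
    qed
    finally show ?thesis by simp
  qed
  then show ?thesis unfolding m_def v_def w_def by blast
qed

lemma measurable_gauss_kernel:
  assumes [measurable]: "f \<in> borel_measurable M" "g \<in> borel_measurable M"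
  shows "(\<lambda>x. gauss_kernel \<rho> (f x) (g x)) \<in> borel_measurable M"
  unfolding gauss_kernel_def by measurable

lemma stationary_kernel_gauss:
  assumes t: "\<rho>\<^sup>2 < 1" shows "stationary_kernel gauss_law (gauss_kernel \<rho>)"
proof (intro stationary_kernel.intro stationary_kernel_axioms.intro)
  show "prob_space gauss_law" by (rule prob_space_normal_density) simp
  show "sets gauss_law = sets borel" by simp
  show "(\<lambda>(x, y). gauss_kernel \<rho> x y) \<in> borel_measurable (borel \<Otimes>\<^sub>M borel)"
    unfolding case_prod_beta by (intro measurable_gauss_kernel) measurable
  show "0 \<le> gauss_kernel \<rho> x y" for x y using t by (simp add: gauss_kernel_def)
  show "gauss_kernel \<rho> x y = gauss_kernel \<rho> y x" for x y
    by (simp add: gauss_kernel_def algebra_simps)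
  show "(\<integral>\<^sup>+y. ennreal (gauss_kernel \<rho> x y) \<partial>gauss_law) = 1" for x
  proof -
    interpret N: prob_space "density lborel (normal_density (\<rho> * x) (sqrt (1 - \<rho>\<^sup>2)))"
      using t by (intro prob_space_normal_density) simp
    have "(\<integral>\<^sup>+y. ennreal (gauss_kernel \<rho> x y) \<partial>gauss_law) =
        (\<integral>\<^sup>+y. ennreal (std_normal_density y) * ennreal (gauss_kernel \<rho> x y) \<partial>lborel)"
      by (rule nn_integral_density) (auto intro!: measurable_gauss_kernel measurable_compose[OF _ measurable_ennreal])
    also have "\<dots> = (\<integral>\<^sup>+y. ennreal (normal_density (\<rho> * x) (sqrt (1 - \<rho>\<^sup>2)) y) \<partial>lborel)"
      by (intro nn_integral_cong) (simp add: gauss_kernel_transition[OF t, symmetric] ennreal_mult' normal_density_nonneg)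
    also have "\<dots> = 1" using N.emeasure_space_1 by (simp add: emeasure_density)
    finally show ?thesis .
  qed
qed

lemma integral_normal_square:
  assumes "0 < \<sigma>"
  shows "(\<integral>x. normal_density \<mu> \<sigma> x * x\<^sup>2 \<partial>lborel) = \<mu>\<^sup>2 + \<sigma>\<^sup>2"
proof -
  have "(\<integral>x. normal_density \<mu> \<sigma> x * x\<^sup>2 \<partial>lborel) =
      (\<integral>x. normal_density \<mu> \<sigma> x * (x - \<mu>)\<^sup>2 + 2 * \<mu> * (normal_density \<mu> \<sigma> x * x) - \<mu>\<^sup>2 * normal_density \<mu> \<sigma> x \<partial>lborel)"
    by (simp add: power2_diff algebra_simps power2_eq_square)
  also have "\<dots> = \<sigma>\<^sup>2 + 2 * \<mu> * \<mu> - \<mu>\<^sup>2 * 1"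
    using integral_normal_moment_even[OF assms, of \<mu> 1] integrable_normal_moment[OF assms, of \<mu> 2]
      integral_normal_moment_nz_1[OF assms, of \<mu>] integrable_normal_moment_nz_1[OF assms, of \<mu>] assms
    by (simp add: integral_normal_density integrable_normal_density)
  finally show ?thesis by (simp add: power2_eq_square)
qed

lemma gauss_chain_exists:
  assumes t: "\<rho>\<^sup>2 < 1"
  shows "\<exists>(M :: (int \<Rightarrow> real) measure) X. quadratic_regression_chain M X \<rho> (\<rho> / (1 + \<rho>\<^sup>2)) ((\<rho> / (1 + \<rho>\<^sup>2))\<^sup>2)
    (2 * (\<rho> / (1 + \<rho>\<^sup>2))\<^sup>2) ((1 - \<rho>\<^sup>2) / (1 + \<rho>\<^sup>2))"
proof (rule quadratic_chain_exists[OF stationary_kernel_gauss t, where S = UNIV])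
  show "\<rho>\<^sup>2 < 1" by fact
  show "AE x in gauss_law. x \<in> UNIV" by simp
  show "integrable gauss_law (\<lambda>x. x\<^sup>2)"
    using integrable_std_normal_moment[of 2] by (subst integrable_real_density) auto
  show "(\<integral>x. x \<partial>gauss_law) = 0"
    using integral_normal_moment_nz_1[of 1 0] by (simp add: integral_gauss_law)
  show "(\<integral>x. x\<^sup>2 \<partial>gauss_law) = 1"
    using integral_normal_square[of 1 0] by (simp add: integral_gauss_law)
  show "(\<integral>y. gauss_kernel \<rho> x y * y \<partial>gauss_law) = \<rho> * x" for x
  proof -
    have "(\<integral>y. gauss_kernel \<rho> x y * y \<partial>gauss_law) = (\<integral>y. std_normal_density y * gauss_kernel \<rho> x y * y \<partial>lborel)"
      by (subst integral_gauss_law) (auto intro!: borel_measurable_times measurable_gauss_kernel simp: mult.assoc)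
    also have "\<dots> = \<rho> * x"
      unfolding gauss_kernel_transition[OF t] using t by (intro integral_normal_moment_nz_1) simp
    finally show ?thesis .
  qed
  fix y z :: real
  let ?m = "\<rho> / (1 + \<rho>\<^sup>2) * (y + z)" and ?s = "sqrt ((1 - \<rho>\<^sup>2) / (1 + \<rho>\<^sup>2))"
  have w: "0 < 1 + \<rho>\<^sup>2" by (simp add: add_pos_nonneg)
  have s: "0 < ?s" "?s\<^sup>2 = (1 - \<rho>\<^sup>2) / (1 + \<rho>\<^sup>2)" using t w by simp_all
  obtain D where D: "\<And>x. std_normal_density x * (gauss_kernel \<rho> y x * gauss_kernel \<rho> x z) = D * normal_density ?m ?s x"
    using gauss_kernel_bridge[OF t, of y z] by blast
  have int: "(\<integral>x. gauss_kernel \<rho> y x * gauss_kernel \<rho> x z * f x \<partial>gauss_law) = D * (\<integral>x. normal_density ?m ?s x * f x \<partial>lborel)"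
    if f: "f \<in> borel_measurable borel" for f
  proof -
    have "(\<integral>x. gauss_kernel \<rho> y x * gauss_kernel \<rho> x z * f x \<partial>gauss_law) =
        (\<integral>x. std_normal_density x * (gauss_kernel \<rho> y x * gauss_kernel \<rho> x z) * f x \<partial>lborel)"
      using f by (subst integral_gauss_law) (auto intro!: borel_measurable_times measurable_gauss_kernel simp: mult.assoc)
    then show ?thesis unfolding D by (simp add: mult.assoc)
  qed
  have base: "(\<integral>x. gauss_kernel \<rho> y x * gauss_kernel \<rho> x z \<partial>gauss_law) = D"
    using int[of "\<lambda>_. 1"] s(1) by (simp add: integral_normal_density)
  show "(\<integral>x. gauss_kernel \<rho> y x * gauss_kernel \<rho> x z * x \<partial>gauss_law) =
     \<rho> / (1 + \<rho>\<^sup>2) * (y + z) * (\<integral>x. gauss_kernel \<rho> y x * gauss_kernel \<rho> x z \<partial>gauss_law)"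
    unfolding base using int[of "\<lambda>x. x"] integral_normal_moment_nz_1[OF s(1), of ?m] by simp
  have "(\<integral>x. gauss_kernel \<rho> y x * gauss_kernel \<rho> x z * x\<^sup>2 \<partial>gauss_law) = D * (?m\<^sup>2 + ?s\<^sup>2)"
    using int[of "\<lambda>x. x\<^sup>2"] unfolding integral_normal_square[OF s(1), of ?m] by simp
  also have "?m\<^sup>2 + ?s\<^sup>2 = (\<rho> / (1 + \<rho>\<^sup>2))\<^sup>2 * (y\<^sup>2 + z\<^sup>2) + 2 * (\<rho> / (1 + \<rho>\<^sup>2))\<^sup>2 * y * z + (1 - \<rho>\<^sup>2) / (1 + \<rho>\<^sup>2)"
  proof -
    have "(a * (y + z))\<^sup>2 + c = a\<^sup>2 * (y\<^sup>2 + z\<^sup>2) + 2 * a\<^sup>2 * y * z + c" for a c :: real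
      by algebra
    then show ?thesis unfolding s(2) .
  qed
  finally show "(\<integral>x. gauss_kernel \<rho> y x * gauss_kernel \<rho> x z * x\<^sup>2 \<partial>gauss_law) =
     ((\<rho> / (1 + \<rho>\<^sup>2))\<^sup>2 * (y\<^sup>2 + z\<^sup>2) + 2 * (\<rho> / (1 + \<rho>\<^sup>2))\<^sup>2 * y * z + (1 - \<rho>\<^sup>2) / (1 + \<rho>\<^sup>2)) *
       (\<integral>x. gauss_kernel \<rho> y x * gauss_kernel \<rho> x z \<partial>gauss_law)"
    unfolding base by (simp only: mult.commute)
qed

section \<open>All values of R\<close>

text \<open>
  The value of \<open>q\<close> solves \<open>R = (1 - s\<^sup>2) * (1 + q) / (1 - q * s\<^sup>2)\<close> with \<open>s = \<rho>\<^sup>2\<close>. The values of \<open>B\<close> and \<open>A\<close> are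
  those that the two equations of the theorem force, and the second conclusion is the condition of
  \<open>mehler_quadratic_regression\<close> that those equations do not already contain.
\<close>

lemma q_from_R:
  fixes s R :: real
  assumes s: "0 < s" "s < 1" and R: "0 < R" "R < 2"
  defines "q \<equiv> (R - 1 + s\<^sup>2) / (1 + (R - 1) * s\<^sup>2)" and "B \<equiv> R * s / (1 + s)\<^sup>2"
  defines "A \<equiv> s * (1 - B) / (1 + s\<^sup>2)"
  shows "\<bar>q\<bar> < 1" "2 * A * (1 + q) + B * (1 / s + q * s) = 1 + q"
proof -
  define d where "d = 1 + (R - 1) * s\<^sup>2"
  have s2: "0 < s\<^sup>2" "s\<^sup>2 < 1" using s by (auto simp: abs_square_less_1)
  have d: "0 < d"
  proof -
    have "0 < R * s\<^sup>2" using R s2 by simp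
    then show ?thesis unfolding d_def using s2 by (simp add: left_diff_distrib)
  qed
  have qd: "q * d = R - 1 + s\<^sup>2" using d by (simp add: q_def d_def)
  have q1d: "(1 + q) * d = R * (1 + s\<^sup>2)" using qd d_def by algebra
  have q2d: "(1 - q) * d = (2 - R) * (1 - s\<^sup>2)" using qd d_def by algebra
  have q1: "1 + q = R * (1 + s\<^sup>2) / d" and q2: "1 - q = (2 - R) * (1 - s\<^sup>2) / d"
    using q1d q2d d by (simp_all add: eq_divide_eq)
  have ps: "0 < 1 + s\<^sup>2" "0 < (1 + s)\<^sup>2" using s by (simp_all add: add_pos_nonneg)
  have "0 < 1 + q" unfolding q1 using d R s2 ps by (intro divide_pos_pos mult_pos_pos) auto
  moreover have "0 < 1 - q" unfolding q2 using d R s2 ps by (intro divide_pos_pos mult_pos_pos) auto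
  ultimately show "\<bar>q\<bar> < 1" by linarith
  have Bd: "B * (1 + s)\<^sup>2 = R * s" using ps by (simp add: B_def)
  have Ad: "A * (1 + s\<^sup>2) = s * (1 - B)" using ps by (simp add: A_def)
  have "(2 * A * (1 + q) * s + B * (1 + q * s\<^sup>2) - (1 + q) * s) * (d * (1 + s)\<^sup>2 * (1 + s\<^sup>2)) = 0"
    using qd q1d Bd Ad d_def by algebra
  then have "2 * A * (1 + q) * s + B * (1 + q * s\<^sup>2) - (1 + q) * s = 0"
    using d ps by (simp add: mult_eq_0_iff)
  then show "2 * A * (1 + q) + B * (1 / s + q * s) = 1 + q"
    using s by (simp add: field_simps power2_eq_square)
qed

theorem proposition8p1:
  fixes \<rho> R :: real
  assumes "0 < \<rho>\<^sup>2" and "\<rho>\<^sup>2 < 1" and "0 \<le> R" and "R \<le> 2"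
  shows "\<exists>(M :: (int \<Rightarrow> real) measure) (X :: int \<Rightarrow> (int \<Rightarrow> real) \<Rightarrow> real).
    prob_space M \<and>
    (\<forall>k. X k \<in> borel_measurable M \<and> integrable M (\<lambda>\<omega>. (X k \<omega>)\<^sup>2)) \<and>
    stationary M X \<and> markov_chain M X \<and>
    (\<forall>k. integral\<^sup>L M (X k) = 0 \<and> integral\<^sup>L M (\<lambda>\<omega>. (X k \<omega>)\<^sup>2) = 1) \<and>
    corr M (X 0) (X 1) = \<rho> \<and>
    corr M (X 0) (X 2) + 1 - 2 * \<bar>\<rho>\<bar> > 0 \<and>
    (\<exists>a b A B C :: real.
       (\<forall>k. AE \<omega> in M. cond_exp_others M X k (X k) \<omega> =
          a * (X (k - 1) \<omega> + X (k + 1) \<omega>) + b) \<and>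
       (\<forall>k. AE \<omega> in M. cond_exp_others M X k (\<lambda>\<omega>. (X k \<omega>)\<^sup>2) \<omega> =
          A * ((X (k - 1) \<omega>)\<^sup>2 + (X (k + 1) \<omega>)\<^sup>2) + B * X (k - 1) \<omega> * X (k + 1) \<omega> + C) \<and>
       A * (\<rho>\<^sup>2 + 1 / \<rho>\<^sup>2) + B = 1 \<and>
       R = B * (\<rho> + 1 / \<rho>)\<^sup>2)"
proof -
  define s where "s = \<rho>\<^sup>2"
  have s: "0 < s" "s < 1" and r0: "\<rho> \<noteq> 0" using assms by (auto simp: s_def)
  have ps: "0 < 1 + s\<^sup>2" "0 < (1 + s)\<^sup>2" using s by (simp_all add: add_pos_nonneg)
  have R_iff: "(\<rho> + 1 / \<rho>)\<^sup>2 = (1 + s)\<^sup>2 / s"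
    using r0 by (simp add: s_def power2_eq_square field_simps)
  define B where "B = R * s / (1 + s)\<^sup>2"
  define A where "A = s * (1 - B) / (1 + s\<^sup>2)"
  have AB: "A * (\<rho>\<^sup>2 + 1 / \<rho>\<^sup>2) + B = 1"
  proof -
    have "A * (s + 1 / s) = 1 - B"
    proof -
      have "s + 1 / s = (1 + s\<^sup>2) / s" using s(1) by (simp add: field_simps power2_eq_square)
      then show ?thesis using s(1) ps(1) by (simp add: A_def)
    qed
    then show ?thesis by (simp add: s_def)
  qed
  have RB: "R = B * (\<rho> + 1 / \<rho>)\<^sup>2" unfolding R_iff B_def using s ps by simp
  have "\<exists>(M :: (int \<Rightarrow> real) measure) X C. quadratic_regression_chain M X \<rho> (\<rho> / (1 + \<rho>\<^sup>2)) A B C"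
  proof -
    consider "R = 0" | "R = 2" | "0 < R" "R < 2" using assms by linarith
    then show ?thesis
    proof cases
      case 1
      then have "B = 0" by (simp add: B_def)
      then show ?thesis using sign_chain_exists[OF assms(2), of A] by blast
    next
      case 2
      have sq: "(\<rho> / (1 + \<rho>\<^sup>2))\<^sup>2 = s / (1 + s)\<^sup>2" by (simp add: s_def power_divide)
      have B2: "B = 2 * (\<rho> / (1 + \<rho>\<^sup>2))\<^sup>2" unfolding sq by (simp add: B_def 2)
      have "1 - B = (1 + s\<^sup>2) / (1 + s)\<^sup>2"
        using ps by (simp add: B_def 2 field_simps) (simp add: power2_sum)
      then have "A = (\<rho> / (1 + \<rho>\<^sup>2))\<^sup>2" unfolding sq using ps by (simp add: A_def)
      then show ?thesis using gauss_chain_exists[OF assms(2)] B2 by blast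
    next
      case 3
      define q where "q = (R - 1 + s\<^sup>2) / (1 + (R - 1) * s\<^sup>2)"
      note qR = q_from_R[OF s 3, folded q_def B_def, folded A_def]
      interpret q_parameter q using qR(1) by unfold_locales
      have "A * (1 + \<rho> ^ 4) + B * \<rho>\<^sup>2 = \<rho>\<^sup>2"
      proof -
        have "\<rho> ^ 4 = s\<^sup>2" by (simp add: s_def flip: power_mult)
        moreover have "A * (1 + s\<^sup>2) = s * (1 - B)" using ps by (simp add: A_def)
        ultimately show ?thesis by (simp add: s_def algebra_simps)
      qed
      from q_chain_exists[OF assms(2) r0 this qR(2)[unfolded s_def]] show ?thesis by blast
    qed
  qed
  then obtain M :: "(int \<Rightarrow> real) measure" and X C
    where chain: "quadratic_regression_chain M X \<rho> (\<rho> / (1 + \<rho>\<^sup>2)) A B C" by blast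
  show ?thesis
  proof (rule exI[of _ M], rule exI[of _ X], intro conjI)
    show "\<exists>a b A B C :: real.
       (\<forall>k. AE \<omega> in M. cond_exp_others M X k (X k) \<omega> =
          a * (X (k - 1) \<omega> + X (k + 1) \<omega>) + b) \<and>
       (\<forall>k. AE \<omega> in M. cond_exp_others M X k (\<lambda>\<omega>. (X k \<omega>)\<^sup>2) \<omega> =
          A * ((X (k - 1) \<omega>)\<^sup>2 + (X (k + 1) \<omega>)\<^sup>2) + B * X (k - 1) \<omega> * X (k + 1) \<omega> + C) \<and>
       A * (\<rho>\<^sup>2 + 1 / \<rho>\<^sup>2) + B = 1 \<and> R = B * (\<rho> + 1 / \<rho>)\<^sup>2"
      by (rule exI[of _ "\<rho> / (1 + \<rho>\<^sup>2)"], rule exI[of _ 0], rule exI[of _ A], rule exI[of _ B], rule exI[of _ C])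
         (use chain AB RB in \<open>simp only: quadratic_regression_chain_def add_0_right simp_thms\<close>)
  qed (use chain in \<open>simp_all only: quadratic_regression_chain_def simp_thms\<close>)
qed

end
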